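(* Suppose $d \geq 3$. Whenever $\widehat{u}_0 \in \mathfrak{G}$ and $v_0$ is a (nonzero) scalar multiple of $u_0$, then $(u_0,v_0)$ is not a critical point for the functional $$(u_0,v_0) \mapsto \frac{\|(-\Delta)^{\frac{2-d}{4}}(uv) \|_{L^2(\mathbb{R}^{1+d})}}{\|u_0\|_{L^2(\mathbb{R}^d)} \|v_0\|_{L^2(\mathbb{R}^d)}}$$ defined for nonzero $u_0,v_0\in L^2(\mathbb{R}^d)$, where $u$ and $v$ denote the solutions of the free Schrödinger equation $i\partial_t u + \Delta u = 0$ on $\mathbb{R}^{1+d}$ with initial data $u_0$ and $v_0$, respectively.
   Context: The Fourier transform is $\widehat{f}(\xi) = \int_{\mathbb{R}^d} f(x) e^{-ix \cdot \xi}\,\mathrm{d}x$. The solution with initial data $u_0$ is $u(t,\cdot)=e^{it\Delta}u_0$, i.e. the spatial Fourier transform of $u(t,\cdot)$ is $e^{-it|\xi|^2}\widehat{u}_0(\xi)$. The operator $(-\Delta)^\sigma$ acts in the spatial variable as the Fourier multiplier $|\xi|^{2\sigma}$. $\mathfrak{G}$ is the class of Gaussian functions on $\mathbb{R}^d$ of the form $\eta\mapsto\exp(a|\eta|^2 + b \cdot \eta + c)$ with $a, c \in \mathbb{C}$, $b \in \mathbb{C}^d$ and $\mathrm{Re}(a) < 0$. A pair $(u_0,v_0)$ is a critical point of a functional $\Phi$ on pairs of nonzero functions in $L^2(\mathbb{R}^d)$ if $$\lim_{\varepsilon \to 0} \frac{\Phi(u_0+\varepsilon U_0,v_0+\varepsilon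 V_0)-\Phi(u_0,v_0)}{\varepsilon}=0$$ (with $\varepsilon$ real) for all $(U_0,V_0) \in L^2(\mathbb{R}^d) \times L^2(\mathbb{R}^d)$. *)

theory Defs
  imports "HOL-Analysis.Analysis"
begin

text \<open>
  Elements of \<open>L\<^sup>2\<close> are represented by Borel functions; the notions below do not depend on the
  choice of representative of a function of \<open>x\<close>.
\<close>

definition L2 :: "('a::euclidean_space \<Rightarrow> complex) set" where
  "L2 = {f \<in> borel_measurable borel. integrable lborel (\<lambda>x. (cmod (f x))\<^sup>2)}"

definition L2norm :: "('a::euclidean_space \<Rightarrow> complex) \<Rightarrow> real" where
  "L2norm f = sqrt (LINT x|lborel. (cmod (f x))\<^sup>2)"

definition fourier :: "(real ^ 'n \<Rightarrow> complex) \<Rightarrow> real ^ 'n \<Rightarrow> complex" where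
  "fourier f \<xi> = (LINT x|lborel. f x * exp (- \<i> * complex_of_real (x \<bullet> \<xi>)))"

text \<open>
  The Fourier integral need not converge for \<open>f \<in> L\<^sup>2\<close>. As usual, the Fourier transform of \<open>f\<close> is
  then the limit in \<open>L\<^sup>2\<close>, as \<open>R \<rightarrow> \<infinity>\<close>, of the Fourier integrals over the balls of radius \<open>R\<close>. It is
  determined up to null sets only, hence a relation: \<open>F\<close> is a version of the Fourier transform of \<open>f\<close>.
\<close>

definition is_fourier_L2 :: "(real ^ 'n \<Rightarrow> complex) \<Rightarrow> (real ^ 'n \<Rightarrow> complex) \<Rightarrow> bool" where
  "is_fourier_L2 f F \<longleftrightarrow> f \<in> L2 \<and> F \<in> L2 \<and>
     ((\<lambda>R::real. \<integral>\<^sup>+ \<xi>. ennreal ((cmod (fourier (\<lambda>x. indicator (cball 0 R) x * f x) \<xi> - F \<xi>))\<^sup>2) \<partial>lborel)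
        \<longlongrightarrow> 0) at_top"

text \<open>
  The free solution \<open>u(t,\<cdot>) = e\<^sup>i\<^sup>t\<^sup>\<Delta> u\<^sub>0\<close>. For each \<open>t\<close> the condition determines \<open>u(t,\<cdot>)\<close> up to a null
  set; joint measurability selects a version on space-time (one exists since \<open>t \<mapsto> u(t,\<cdot>)\<close> is
  continuous into \<open>L\<^sup>2\<close>), which is then unique almost everywhere in \<open>(t,x)\<close>.
\<close>

definition is_free_solution ::
    "(real ^ 'n \<Rightarrow> complex) \<Rightarrow> (real \<Rightarrow> real ^ 'n \<Rightarrow> complex) \<Rightarrow> bool" where
  "is_free_solution u\<^sub>0 u \<longleftrightarrow>
     (\<lambda>(t, x). u t x) \<in> borel_measurable borel \<and>
     (\<exists>F. is_fourier_L2 u\<^sub>0 F \<and>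
       (\<forall>t. is_fourier_L2 (u t) (\<lambda>\<xi>. exp (- \<i> * complex_of_real (t * (norm \<xi>)\<^sup>2)) * F \<xi>)))"

definition free_solution :: "(real ^ 'n \<Rightarrow> complex) \<Rightarrow> real \<Rightarrow> real ^ 'n \<Rightarrow> complex" where
  "free_solution u\<^sub>0 = (SOME u. is_free_solution u\<^sub>0 u)"

text \<open>
  \<open>W = (-\<Delta>)\<^sup>\<sigma> w\<close>, acting in \<open>x\<close> only, for \<open>w(t,\<cdot>) \<in> L\<^sup>1\<close> (as is the case for a product of two free
  solutions, so that its spatial Fourier transform is given by the integral). Square integrability
  of the spatial slices of \<open>W\<close> can be required for almost every \<open>t\<close> only.
\<close>

definition is_frac_laplacian ::
    "real \<Rightarrow> (real \<Rightarrow> real ^ 'n \<Rightarrow> complex) \<Rightarrow> (real \<Rightarrow> real ^ 'n \<Rightarrow> complex) \<Rightarrow> bool" where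
  "is_frac_laplacian \<sigma> w W \<longleftrightarrow>
     (\<lambda>(t, x). W t x) \<in> borel_measurable borel \<and>
     (AE t in lborel. is_fourier_L2 (W t)
        (\<lambda>\<xi>. complex_of_real (norm \<xi> powr (2 * \<sigma>)) * fourier (w t) \<xi>))"

definition frac_laplacian ::
    "real \<Rightarrow> (real \<Rightarrow> real ^ 'n \<Rightarrow> complex) \<Rightarrow> real \<Rightarrow> real ^ 'n \<Rightarrow> complex" where
  "frac_laplacian \<sigma> w = (SOME W. is_frac_laplacian \<sigma> w W)"

definition bilinear_functional :: "(real ^ 'n \<Rightarrow> complex) \<Rightarrow> (real ^ 'n \<Rightarrow> complex) \<Rightarrow> real" where
  "bilinear_functional u\<^sub>0 v\<^sub>0 =
     L2norm (\<lambda>(t, x). frac_laplacian ((2 - real CARD('n)) / 4)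
                (\<lambda>t x. free_solution u\<^sub>0 t x * free_solution v\<^sub>0 t x) t x)
     / (L2norm u\<^sub>0 * L2norm v\<^sub>0)"

definition gaussians :: "(real ^ 'n \<Rightarrow> complex) set" where
  "gaussians = {G. \<exists>(a::complex) (b::complex ^ 'n) (c::complex). Re a < 0 \<and>
     G = (\<lambda>\<eta>. exp (a * complex_of_real ((norm \<eta>)\<^sup>2)
                    + (\<Sum>i\<in>UNIV. b $ i * complex_of_real (\<eta> $ i)) + c))}"

definition is_critical_point ::
    "((real ^ 'n \<Rightarrow> complex) \<Rightarrow> (real ^ 'n \<Rightarrow> complex) \<Rightarrow> real) \<Rightarrow>
     (real ^ 'n \<Rightarrow> complex) \<Rightarrow> (real ^ 'n \<Rightarrow> complex) \<Rightarrow> bool" where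
  "is_critical_point \<Phi> u\<^sub>0 v\<^sub>0 \<longleftrightarrow>
     (\<forall>U\<^sub>0\<in>L2. \<forall>V\<^sub>0\<in>L2.
       ((\<lambda>\<epsilon>::real. (\<Phi> (\<lambda>x. u\<^sub>0 x + complex_of_real \<epsilon> * U\<^sub>0 x) (\<lambda>x. v\<^sub>0 x + complex_of_real \<epsilon> * V\<^sub>0 x)
                   - \<Phi> u\<^sub>0 v\<^sub>0) / \<epsilon>) \<longlongrightarrow> 0) (at 0))"

end

theory Submission
  imports Defs "HOL-Real_Asymp.Real_Asymp" "HOL-Probability.Sinc_Integral"
begin

text \<open>
  The spatial Fourier transform of \<open>uv\<close> is a convolution, so by Plancherel
  the squared numerator of the functional is a constant multiple of the integral of
  \<open>|\<xi>|\<^sup>2\<^sup>-\<^sup>d |K(t,\<xi>)|\<^sup>2\<close> over space-time, where \<open>K(t,\<cdot>)\<close> is the convolution of \<open>exp(-it|\<eta>|\<^sup>2) F\<close> and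
  \<open>exp(-it|\<eta>|\<^sup>2) H\<close>, with \<open>F\<close> and \<open>H\<close>
  the Fourier transforms of \<open>u\<^sub>0\<close> and \<open>v\<^sub>0\<close>. Only \<open>u\<^sub>0\<close> is perturbed, by the function whose Fourier transform is \<open>q G\<close>, with \<open>G\<close> the
  given Gaussian, centred at \<open>k\<close>, and \<open>q\<close> a real polynomial. Substituting \<open>\<eta> = \<xi>/2 + \<zeta>\<close> separates
  the variables, so \<open>K\<close> is multiplied by the average \<open>P(t,\<xi>)\<close> of \<open>q(\<xi>/2 + \<zeta>)\<close> against the complex
  Gaussian \<open>exp(-2 s |\<zeta>|\<^sup>2)\<close>, \<open>s = it - a\<close>. Criticality would force the average of \<open>Re P\<close> with weight
  \<open>|\<xi>|\<^sup>2\<^sup>-\<^sup>d |K|\<^sup>2\<close> to equal the average of \<open>q\<close> with weight \<open>|G|\<^sup>2\<close>.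

  If \<open>k \<noteq> 0\<close>, take \<open>q(\<eta>) = (\<eta> - k) \<bullet> k\<close>: the second average vanishes by symmetry, whereas
  \<open>P = (\<xi>/2 - k) \<bullet> k\<close> and the decreasing factor \<open>|\<xi>|\<^sup>2\<^sup>-\<^sup>d\<close> makes the first one negative. If \<open>k = 0\<close>, take
  \<open>q(\<eta>) = |\<eta>|\<^sup>4\<close>: with \<open>\<alpha> = - Re a\<close>, the first average minus the second equals
  \<open>- (d - 2)\<^sup>2 / (16 \<alpha>\<^sup>2 d)\<close>.
\<close>

section \<open>Differentiation under the integral sign\<close>

text \<open>The symmetries dictate the choice of q. A linear q moves the centre of the Gaussian in
  frequency, and the multiplier, which singles out the origin, is what destroys invariance under
  such shifts; if the centre is the origin, the linear variation vanishes by parity. The choice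
  \<open>|\<eta>|^2\<close> amounts to changing Re a, hence to a dilation, under which the
  functional is invariant: for k = 0 both averages then equal d/(4 \<alpha>). The next radial power
  is the fourth, and its defect vanishes at d = 2, where the multiplier becomes trivial. The
  obstacle is that the functional is built from Hilbert choices: before anything can be varied, the
  chosen solution and the chosen fractional derivative must be shown to exist and to be unique
  almost everywhere. Existence comes from an inversion statement for integrable elements of
  \<open>L2\<close>, uniqueness from the Plancherel isometry. Multiplying the Gaussian by
  polynomials stays within integrable functions, so the inversion statement covers every
  perturbation in use. Gaussian integrals with complex parameter are found from differential
  equations in a real variable.\<close>

lemma has_vector_derivative_iff_diff_quot:
  fixes f :: "real \<Rightarrow> 'b::real_normed_vector"
  shows "(f has_vector_derivative D) (at t) \<longleftrightarrow> ((\<lambda>h. (f h - f t) /\<^sub>R (h - t)) \<longlongrightarrow> D) (at t)"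
proof -
  have "norm ((1 / norm (h - t)) *\<^sub>R (f h - (f t + (h - t) *\<^sub>R D)))
      = norm ((f h - f t) /\<^sub>R (h - t) - D)" if "h \<noteq> t" for h
  proof -
    have "(f h - f t) /\<^sub>R (h - t) - D = (f h - (f t + (h - t) *\<^sub>R D)) /\<^sub>R (h - t)"
      using that by (simp add: scaleR_diff_right scaleR_add_right)
    then show ?thesis using that by (simp add: divide_inverse)
  qed
  then have "((\<lambda>h. norm ((1 / norm (h - t)) *\<^sub>R (f h - (f t + (h - t) *\<^sub>R D)))) \<longlongrightarrow> 0) (at t)
      \<longleftrightarrow> ((\<lambda>h. norm ((f h - f t) /\<^sub>R (h - t) - D)) \<longlongrightarrow> 0) (at t)"
    by (intro Lim_cong_within) auto
  then show ?thesis
    unfolding has_vector_derivative_def has_derivative_within tendsto_norm_zero_iff Lim_null[of _ D]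
    using bounded_linear_scaleR_left by blast
qed

text \<open>The mean value inequality bounds every difference quotient by the majorant g, and
  dominated convergence along an arbitrary sequence tending to t does the rest. Values may be
  complex, while the parameter is real, as are all parameters varied below.\<close>

lemma has_vector_derivative_lebesgue_integral:
  fixes f :: "real \<Rightarrow> 'a \<Rightarrow> 'b::{banach, second_countable_topology}"
  assumes "0 < \<delta>"
    and f: "\<And>h. h \<in> ball t \<delta> \<Longrightarrow> integrable M (f h)"
    and der: "\<And>h x. h \<in> ball t \<delta> \<Longrightarrow> x \<in> space M \<Longrightarrow> ((\<lambda>h. f h x) has_vector_derivative f' h x) (at h)"
    and bound: "\<And>h x. h \<in> ball t \<delta> \<Longrightarrow> x \<in> space M \<Longrightarrow> norm (f' h x) \<le> g x"
    and g: "integrable M g" and f': "f' t \<in> borel_measurable M"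
  shows "((\<lambda>h. \<integral>x. f h x \<partial>M) has_vector_derivative (\<integral>x. f' t x \<partial>M)) (at t)"
proof -
  have "((\<lambda>h. ((\<integral>x. f h x \<partial>M) - (\<integral>x. f t x \<partial>M)) /\<^sub>R (h - t)) \<longlongrightarrow> (\<integral>x. f' t x \<partial>M)) (at t)"
    unfolding tendsto_at_iff_sequentially
  proof (intro allI impI)
    fix X :: "nat \<Rightarrow> real" assume X: "\<forall>i. X i \<in> UNIV - {t}" "X \<longlonglongrightarrow> t"
    then obtain N where N: "\<And>n. n \<ge> N \<Longrightarrow> X n \<in> ball t \<delta>"
      using \<open>0 < \<delta>\<close> by (metis LIMSEQ_def mem_ball dist_commute)
    have t: "t \<in> ball t \<delta>" using \<open>0 < \<delta>\<close> by simp
    \<comment> \<open>The sequence is shifted by N because integrability and the derivative bound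
      hold only inside the ball.\<close>
    have "(\<lambda>n. \<integral>x. (f (X (n + N)) x - f t x) /\<^sub>R (X (n + N) - t) \<partial>M) \<longlonglongrightarrow> (\<integral>x. f' t x \<partial>M)"
    proof (rule integral_dominated_convergence[where w = g])
      show "(\<lambda>x. (f (X (n + N)) x - f t x) /\<^sub>R (X (n + N) - t)) \<in> borel_measurable M" for n
        using f[OF N, of "n + N"] f[OF t] by simp
      show "AE x in M. (\<lambda>n. (f (X (n + N)) x - f t x) /\<^sub>R (X (n + N) - t)) \<longlonglongrightarrow> f' t x"
      proof (rule AE_I2)
        fix x assume "x \<in> space M"
        then have "((\<lambda>h. (f h x - f t x) /\<^sub>R (h - t)) \<longlongrightarrow> f' t x) (at t)"
          using der[OF t] by (simp add: has_vector_derivative_iff_diff_quot)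
        then have "((\<lambda>h. (f h x - f t x) /\<^sub>R (h - t)) \<circ> X) \<longlonglongrightarrow> f' t x"
          using X unfolding tendsto_at_iff_sequentially by blast
        then show "(\<lambda>n. (f (X (n + N)) x - f t x) /\<^sub>R (X (n + N) - t)) \<longlonglongrightarrow> f' t x"
          using LIMSEQ_ignore_initial_segment[of _ "f' t x" N] by (simp add: o_def)
      qed
      show "AE x in M. norm ((f (X (n + N)) x - f t x) /\<^sub>R (X (n + N) - t)) \<le> g x" for n
      proof (rule AE_I2)
        fix x assume x: "x \<in> space M"
        have "norm (f (X (n + N)) x - f t x) \<le> g x * norm (X (n + N) - t)"
        proof (rule differentiable_bound[where S = "ball t \<delta>" and f' = "\<lambda>h k. k *\<^sub>R f' h x"])
          fix h assume h: "h \<in> ball t \<delta>"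
          show "((\<lambda>h. f h x) has_derivative (\<lambda>k. k *\<^sub>R f' h x)) (at h within ball t \<delta>)"
            using der[OF h x] by (simp add: has_vector_derivative_def has_derivative_at_withinI)
          show "onorm (\<lambda>k. k *\<^sub>R f' h x) \<le> g x"
            using bound[OF h x] by (intro onorm_le) (simp add: mult.commute mult_left_mono)
        qed (use N t in auto)
        moreover have "X (n + N) - t \<noteq> 0" using X(1) by simp
        ultimately show "norm ((f (X (n + N)) x - f t x) /\<^sub>R (X (n + N) - t)) \<le> g x"
          unfolding norm_scaleR by (simp add: field_simps)
      qed
    qed (use g f' in auto)
    moreover have "(\<integral>x. (f (X (n + N)) x - f t x) /\<^sub>R (X (n + N) - t) \<partial>M)
        = ((\<integral>x. f (X (n + N)) x \<partial>M) - (\<integral>x. f t x \<partial>M)) /\<^sub>R (X (n + N) - t)" for n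
      using f[OF N, of "n + N"] f[OF t] by simp
    ultimately have "(\<lambda>n. ((\<lambda>h. ((\<integral>x. f h x \<partial>M) - (\<integral>x. f t x \<partial>M)) /\<^sub>R (h - t)) \<circ> X) (n + N))
        \<longlonglongrightarrow> (\<integral>x. f' t x \<partial>M)"
      by (simp only: o_def)
    then show "((\<lambda>h. ((\<integral>x. f h x \<partial>M) - (\<integral>x. f t x \<partial>M)) /\<^sub>R (h - t)) \<circ> X)
        \<longlonglongrightarrow> (\<integral>x. f' t x \<partial>M)"
      by (rule LIMSEQ_offset)
  qed
  then show ?thesis
    by (simp add: has_vector_derivative_iff_diff_quot)
qed

section \<open>Affine substitutions and integrals of derivatives\<close>

lemma integral_lborel_affine:
  fixes f :: "'a::euclidean_space \<Rightarrow> 'b::{banach, second_countable_topology}"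
  assumes [measurable]: "f \<in> borel_measurable borel" and c: "c \<noteq> 0"
  shows "(\<integral>x. f x \<partial>lborel) = \<bar>c\<bar> ^ DIM('a) *\<^sub>R (\<integral>x. f (t + c *\<^sub>R x) \<partial>lborel)"
  by (subst lborel_affine[OF c, of t]) (simp add: integral_density integral_distr)

lemma nn_integral_lborel_affine:
  fixes f :: "'a::euclidean_space \<Rightarrow> ennreal"
  assumes [measurable]: "f \<in> borel_measurable borel" and c: "c \<noteq> 0"
  shows "(\<integral>\<^sup>+x. f x \<partial>lborel) = ennreal (\<bar>c\<bar> ^ DIM('a)) * (\<integral>\<^sup>+x. f (t + c *\<^sub>R x) \<partial>lborel)"
  by (subst lborel_affine[OF c, of t]) (simp add: nn_integral_density nn_integral_distr nn_integral_cmult)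

lemma integrable_lborel_affine:
  fixes f :: "'a::euclidean_space \<Rightarrow> 'b::{banach, second_countable_topology}"
  assumes f: "integrable lborel f" and c: "c \<noteq> 0"
  shows "integrable lborel (\<lambda>x. f (t + c *\<^sub>R x))"
proof -
  have [measurable]: "f \<in> borel_measurable borel" using f by auto
  have "(\<integral>\<^sup>+x. norm (f x) \<partial>lborel) < \<infinity>" using f by (simp add: integrable_iff_bounded)
  then have "(\<integral>\<^sup>+x. norm (f (t + c *\<^sub>R x)) \<partial>lborel) < \<infinity>"
    using c by (subst (asm) nn_integral_lborel_affine[OF _ c, of _ t]) (auto simp: ennreal_mult_less_top)
  then show ?thesis by (simp add: integrable_iff_bounded)
qed

text \<open>Integration by parts on the whole space: the integral of a translate does not depend on
  the translation, so its derivative at 0, computed under the integral sign, vanishes. The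
  derivative at displacement h from x is the derivative at displacement 0 from
  \<open>x + h *\<^sub>R v\<close>, which is why \<open>der\<close> speaks of 0 only.\<close>

lemma has_vector_derivative_translation_imp_integral_eq_0:
  fixes f f' :: "'a::euclidean_space \<Rightarrow> 'b::{banach, second_countable_topology}"
  assumes "0 < \<delta>" and f: "integrable lborel f"
    and der: "\<And>x. ((\<lambda>h. f (x + h *\<^sub>R v)) has_vector_derivative f' x) (at 0)"
    and bound: "\<And>h x. \<bar>h\<bar> < \<delta> \<Longrightarrow> norm (f' (x + h *\<^sub>R v)) \<le> g x"
    and g: "integrable lborel g" and f': "f' \<in> borel_measurable borel"
  shows "(\<integral>x. f' x \<partial>lborel) = 0"
proof -
  have fm: "f \<in> borel_measurable borel" using f by auto
  have der': "((\<lambda>h. f (x + h *\<^sub>R v)) has_vector_derivative f' (x + h *\<^sub>R v)) (at h)" for x h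
  proof -
    have "((\<lambda>k. f ((x + h *\<^sub>R v) + (k - h) *\<^sub>R v)) has_vector_derivative 1 *\<^sub>R f' (x + h *\<^sub>R v)) (at h)"
      by (rule vector_diff_chain_at[where f = "\<lambda>k. k - h" and g = "\<lambda>k. f ((x + h *\<^sub>R v) + k *\<^sub>R v)",
            unfolded o_def]) (auto intro!: derivative_eq_intros der)
    then show ?thesis by (simp add: algebra_simps)
  qed
  have "((\<lambda>h. \<integral>x. f (x + h *\<^sub>R v) \<partial>lborel) has_vector_derivative (\<integral>x. f' (x + 0 *\<^sub>R v) \<partial>lborel)) (at 0)"
  proof (rule has_vector_derivative_lebesgue_integral[OF \<open>0 < \<delta>\<close>, where g = g])
    show "integrable lborel (\<lambda>x. f (x + h *\<^sub>R v))" for h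
      using integrable_lborel_affine[OF f, of 1 "h *\<^sub>R v"] by (simp add: add.commute)
  qed (use der' bound g f' in auto)
  moreover have "(\<integral>x. f (x + h *\<^sub>R v) \<partial>lborel) = (\<integral>x. f x \<partial>lborel)" for h
    using integral_lborel_affine[OF fm, of 1 "h *\<^sub>R v"] by (simp add: add.commute)
  ultimately have "((\<lambda>h::real. \<integral>x. f x \<partial>lborel) has_vector_derivative (\<integral>x. f' x \<partial>lborel)) (at 0)"
    by simp
  then show ?thesis using has_vector_derivative_const vector_derivative_unique_at by blast
qed

section \<open>Integrability of Gaussians and of power singularities\<close>

abbreviation rgauss :: "real \<Rightarrow> 'a::real_normed_vector \<Rightarrow> real" where
  "rgauss \<delta> x \<equiv> exp (- (\<delta> * (norm x)\<^sup>2))"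

abbreviation cgauss :: "complex \<Rightarrow> 'a::real_normed_vector \<Rightarrow> complex" where
  "cgauss s x \<equiv> exp (- (s * complex_of_real ((norm x)\<^sup>2)))"

text \<open>A substitute for polar coordinates. A radial function decaying to 0 is the integral of
  minus its derivative over \<open>{norm x..}\<close>, and exchanging the order of integration
  leaves only the volumes of balls, proportional to \<open>r ^ DIM('a)\<close>.\<close>

lemma nn_integral_layer_cake_norm:
  fixes \<psi> :: "real \<Rightarrow> ennreal"
  assumes [measurable]: "\<psi> \<in> borel_measurable borel"
  shows "(\<integral>\<^sup>+x. (\<integral>\<^sup>+r. \<psi> r * indicator {norm x..} r \<partial>lborel) \<partial>(lborel :: 'a::euclidean_space measure))
    = ennreal (unit_ball_vol (real DIM('a))) * (\<integral>\<^sup>+r. \<psi> r * ennreal (r ^ DIM('a)) * indicator {0..} r \<partial>lborel)"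
proof -
  have "(\<integral>\<^sup>+x. (\<integral>\<^sup>+r. \<psi> r * indicator {norm x..} r \<partial>lborel) \<partial>(lborel :: 'a measure))
      = (\<integral>\<^sup>+x. (\<integral>\<^sup>+r. \<psi> r * indicator {(x::'a, r). norm x \<le> r} (x, r) \<partial>lborel) \<partial>lborel)"
    by (auto intro!: nn_integral_cong split: split_indicator)
  also have "\<dots> = (\<integral>\<^sup>+r. (\<integral>\<^sup>+x. \<psi> r * indicator {(x::'a, r). norm x \<le> r} (x, r) \<partial>lborel) \<partial>lborel)"
    by (rule lborel_pair.Fubini'[symmetric]) measurable
  also have "\<dots> = (\<integral>\<^sup>+r. \<psi> r * emeasure lborel (cball 0 r :: 'a set) \<partial>lborel)"
  proof (rule nn_integral_cong)
    fix r :: real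
    have "(\<integral>\<^sup>+x. \<psi> r * indicator {(x::'a, r). norm x \<le> r} (x, r) \<partial>lborel)
        = (\<integral>\<^sup>+x. \<psi> r * indicator (cball 0 r :: 'a set) x \<partial>lborel)"
      by (auto intro!: nn_integral_cong split: split_indicator)
    then show "(\<integral>\<^sup>+x. \<psi> r * indicator {(x::'a, r). norm x \<le> r} (x, r) \<partial>lborel)
        = \<psi> r * emeasure lborel (cball 0 r :: 'a set)"
      by (simp only:) (simp add: nn_integral_cmult_indicator)
  qed
  also have "\<dots> = (\<integral>\<^sup>+r. ennreal (unit_ball_vol (real DIM('a)))
      * (\<psi> r * ennreal (r ^ DIM('a)) * indicator {0..} r) \<partial>lborel)"
  proof (rule nn_integral_cong)
    fix r :: real
    show "\<psi> r * emeasure lborel (cball 0 r :: 'a set) = ennreal (unit_ball_vol (real DIM('a)))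
      * (\<psi> r * ennreal (r ^ DIM('a)) * indicator {0..} r)"
      by (cases "r \<ge> 0") (simp_all add: emeasure_cball ennreal_mult mult_ac)
  qed
  finally show ?thesis by (simp add: nn_integral_cmult)
qed

lemma power_le_exp_square:
  fixes \<delta> :: real
  assumes "0 < \<delta>"
  shows "\<exists>C>0. \<forall>r. \<bar>r\<bar> ^ k \<le> C * exp (\<delta> * r\<^sup>2)"
proof -
  \<comment> \<open>The single term of order k of the exponential series controls
    \<open>(r^2)^k\<close> with the constant \<open>fact k / \<delta>^k\<close>; the summand 1
    covers small r, where \<open>|r|^k\<close> may exceed \<open>r^(2k)\<close>.\<close>
  have "\<bar>r\<bar> ^ k \<le> (1 + fact k / \<delta> ^ k) * exp (\<delta> * r\<^sup>2)" for r
  proof -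
    have "(\<delta> * r\<^sup>2) ^ k / fact k \<le> exp (\<delta> * r\<^sup>2)"
      using exp_converges[of "\<delta> * r\<^sup>2"] \<open>0 < \<delta>\<close> sum_le_suminf[of "\<lambda>n. (\<delta> * r\<^sup>2) ^ n /\<^sub>R fact n" "{k}"]
      by (auto simp: sums_iff field_simps)
    then have *: "(r\<^sup>2) ^ k \<le> fact k / \<delta> ^ k * exp (\<delta> * r\<^sup>2)"
      using \<open>0 < \<delta>\<close> by (simp add: field_simps power_mult_distrib)
    have "\<bar>r\<bar> ^ k \<le> 1 + (r\<^sup>2) ^ k"
    proof (cases "\<bar>r\<bar> \<le> 1")
      case True
      then show ?thesis by (smt (verit) power_le_one abs_ge_zero zero_le_power zero_le_power2)
    next
      case False
      then have "\<bar>r\<bar> ^ k \<le> \<bar>r\<bar> ^ (2 * k)" by (intro power_increasing) auto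
      then show ?thesis by (simp add: power_mult)
    qed
    also have "1 \<le> exp (\<delta> * r\<^sup>2)" using \<open>0 < \<delta>\<close> by simp
    finally show ?thesis using * by (simp add: algebra_simps)
  qed
  moreover have "0 < 1 + fact k / \<delta> ^ k" using \<open>0 < \<delta>\<close> by (simp add: add_pos_nonneg)
  ultimately show ?thesis by blast
qed

lemma tendsto_exp_neg_square: "0 < \<delta> \<Longrightarrow> ((\<lambda>r. exp (- (\<delta> * r\<^sup>2))) \<longlongrightarrow> 0) at_top" for \<delta> :: real
  by real_asymp

lemma integrable_gaussian:
  assumes "0 < \<delta>"
  shows "integrable lborel (\<lambda>x::'a::euclidean_space. rgauss \<delta> x)"
proof -
  \<comment> \<open>Minus the derivative of the radial profile \<open>exp (-(\<delta> r^2))\<close>.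
    Half of the decay of \<psi> later absorbs \<open>r ^ DIM('a)\<close>, and what remains has an
    elementary primitive.\<close>
  define \<psi> where "\<psi> r = 2 * \<delta> * r * exp (- (\<delta> * r\<^sup>2))" for r :: real
  have [measurable]: "\<psi> \<in> borel_measurable borel" unfolding \<psi>_def by measurable
  obtain C where C: "C > 0" "\<And>r. \<bar>r\<bar> ^ DIM('a) \<le> C * exp (\<delta> / 2 * r\<^sup>2)"
    using power_le_exp_square[of "\<delta> / 2" "DIM('a)"] \<open>0 < \<delta>\<close> by auto
  have inner: "(\<integral>\<^sup>+r. ennreal (\<psi> r) * indicator {norm x..} r \<partial>lborel) = ennreal (rgauss \<delta> x)"
    for x :: 'a
  proof -
    have "(\<integral>\<^sup>+r. ennreal (\<psi> r) * indicator {norm x..} r \<partial>lborel) = ennreal (0 - (- rgauss \<delta> x))"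
    proof (rule nn_integral_FTC_atLeast)
      show "((\<lambda>r. - exp (- (\<delta> * r\<^sup>2))) has_real_derivative \<psi> r) (at r)" for r
        unfolding \<psi>_def by (auto intro!: derivative_eq_intros)
      show "0 \<le> \<psi> r" if "norm x \<le> r" for r
        using that \<open>0 < \<delta>\<close> order_trans[OF norm_ge_zero that] by (simp add: \<psi>_def)
      show "((\<lambda>r. - exp (- (\<delta> * r\<^sup>2))) \<longlongrightarrow> 0) at_top"
        using tendsto_minus[OF tendsto_exp_neg_square[OF \<open>0 < \<delta>\<close>]] by simp
    qed (auto simp: \<psi>_def)
    then show ?thesis by simp
  qed
  have "(\<integral>\<^sup>+x. ennreal (rgauss \<delta> x) \<partial>(lborel::'a measure))
      = ennreal (unit_ball_vol (real DIM('a))) * (\<integral>\<^sup>+r. ennreal (\<psi> r) * ennreal (r ^ DIM('a)) * indicator {0..} r \<partial>lborel)"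
    by (subst nn_integral_layer_cake_norm[symmetric]) (simp_all add: inner)
  also have "\<dots> \<le> ennreal (unit_ball_vol (real DIM('a)))
      * (\<integral>\<^sup>+r. ennreal (2 * \<delta> * C * r * exp (- (\<delta> / 2 * r\<^sup>2))) * indicator {0..} r \<partial>lborel)"
  proof (intro mult_left_mono nn_integral_mono)
    fix r :: real
    have "\<psi> r * r ^ DIM('a) \<le> 2 * \<delta> * C * r * exp (- (\<delta> / 2 * r\<^sup>2))" if "r \<ge> 0"
    proof -
      have "\<psi> r * r ^ DIM('a) \<le> \<psi> r * (C * exp (\<delta> / 2 * r\<^sup>2))"
        using C(2)[of r] that \<open>0 < \<delta>\<close> by (intro mult_left_mono) (auto simp: \<psi>_def)
      also have "\<dots> = 2 * \<delta> * C * r * exp (- (\<delta> / 2 * r\<^sup>2))"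
        by (simp add: \<psi>_def flip: exp_add)
      finally show ?thesis .
    qed
    then show "ennreal (\<psi> r) * ennreal (r ^ DIM('a)) * indicator {0..} r
        \<le> ennreal (2 * \<delta> * C * r * exp (- (\<delta> / 2 * r\<^sup>2))) * indicator {0..} r"
      using \<open>0 < \<delta>\<close> by (auto split: split_indicator simp: \<psi>_def simp flip: ennreal_mult intro!: ennreal_leI)
  qed auto
  also have "(\<integral>\<^sup>+r. ennreal (2 * \<delta> * C * r * exp (- (\<delta> / 2 * r\<^sup>2))) * indicator {0..} r \<partial>lborel)
      = ennreal (0 - (- 2 * C * exp (- (\<delta> / 2 * 0\<^sup>2))))"
  proof (rule nn_integral_FTC_atLeast)
    show "((\<lambda>r. - 2 * C * exp (- (\<delta> / 2 * r\<^sup>2))) has_real_derivative 2 * \<delta> * C * r * exp (- (\<delta> / 2 * r\<^sup>2))) (at r)" for r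
      by (auto intro!: derivative_eq_intros)
    show "((\<lambda>r. - 2 * C * exp (- (\<delta> / 2 * r\<^sup>2))) \<longlongrightarrow> 0) at_top"
      using tendsto_mult_right_zero[OF tendsto_exp_neg_square[of "\<delta> / 2"], of "- 2 * C"] \<open>0 < \<delta>\<close> by simp
  qed (use \<open>0 < \<delta>\<close> C in auto)
  also have "ennreal (unit_ball_vol (real DIM('a))) * \<dots> < \<infinity>"
    by (simp add: ennreal_mult_less_top)
  finally show ?thesis by (simp add: integrable_iff_bounded)
qed

text \<open>On the punctured unit ball the power is 1 plus the integral of
  \<open>(- p) r^(p-1)\<close> over \<open>[|x|, 1]\<close>, so the layer-cake formula applies. The
  lower bound on p makes \<open>r^(p-1+n)\<close>, with n the dimension, at most 1 on (0,1]; it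
  admits the exponents (2 - d)/2 and 2 - d of the multiplier and of its square.\<close>

lemma integrable_norm_powr_cball:
  assumes p: "1 - real DIM('a::euclidean_space) \<le> p" "p < 0"
  shows "integrable lborel (\<lambda>x::'a. indicator (cball 0 1) x * norm x powr p)"
proof -
  define \<psi> where "\<psi> r = (if 0 < r \<and> r \<le> 1 then (- p) * r powr (p - 1) else 0)" for r :: real
  have [measurable]: "\<psi> \<in> borel_measurable borel" unfolding \<psi>_def by measurable
  have [measurable]: "(cball 0 1 :: 'a set) \<in> sets borel" by simp
  have "(\<lambda>x::'a. \<integral>\<^sup>+r. ennreal (\<psi> r) * indicator {(x::'a, r). norm x \<le> r} (x, r) \<partial>lborel) \<in> borel_measurable borel"
    by measurable
  then have [measurable]: "(\<lambda>x::'a. \<integral>\<^sup>+r. ennreal (\<psi> r) * indicator {norm x..} r \<partial>lborel) \<in> borel_measurable borel"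
    by (simp add: indicator_def)
  have inner: "ennreal (indicator (cball 0 1) x * norm x powr p)
     \<le> ennreal (indicator (cball 0 1) x) + (\<integral>\<^sup>+r. ennreal (\<psi> r) * indicator {norm x..} r \<partial>lborel)" for x :: 'a
  proof (cases "0 < norm x \<and> norm x \<le> 1")
    case True
    have "(\<integral>\<^sup>+r. ennreal (\<psi> r) * indicator {norm x..} r \<partial>lborel)
       = (\<integral>\<^sup>+r. ennreal ((- p) * r powr (p - 1)) * indicator {norm x..1} r \<partial>lborel)"
      using True less_le_trans[of 0 "norm x"]
      by (intro nn_integral_cong) (auto simp: \<psi>_def split: split_indicator)
    also have "\<dots> = ennreal ((- (1 powr p)) - (- (norm x powr p)))"
    proof (rule nn_integral_FTC_Icc)
      fix r assume "r \<in> {norm x..1}"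
      then have "0 < r" using True by (meson atLeastAtMost_iff less_le_trans)
      then show "((\<lambda>r. - (r powr p)) has_real_derivative (- p) * r powr (p - 1)) (at r)"
        by (auto intro!: derivative_eq_intros)
    qed (use True p in \<open>auto simp: mult_nonpos_nonneg\<close>)
    finally have "(\<integral>\<^sup>+r. ennreal (\<psi> r) * indicator {norm x..} r \<partial>lborel) = ennreal (norm x powr p - 1)"
      by simp
    moreover have "1 \<le> norm x powr p" using powr_mono2'[of p "norm x" 1] True p by simp
    ultimately show ?thesis using True by (simp add: indicator_def flip: ennreal_plus ennreal_1)
  qed (auto simp: not_le indicator_def)
  have "(\<integral>\<^sup>+x. ennreal (indicator (cball 0 1) x * norm x powr p) \<partial>(lborel::'a measure))
      \<le> (\<integral>\<^sup>+x. ennreal (indicator (cball 0 1) x) + (\<integral>\<^sup>+r. ennreal (\<psi> r) * indicator {norm x..} r \<partial>lborel) \<partial>(lborel::'a measure))"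
    by (intro nn_integral_mono inner)
  also have "\<dots> = (\<integral>\<^sup>+x. ennreal (indicator (cball 0 1) x) \<partial>(lborel::'a measure))
      + ennreal (unit_ball_vol (real DIM('a))) * (\<integral>\<^sup>+r. ennreal (\<psi> r) * ennreal (r ^ DIM('a)) * indicator {0..} r \<partial>lborel)"
    by (subst nn_integral_add) (simp_all add: nn_integral_layer_cake_norm)
  also have "\<dots> \<le> emeasure lborel (cball 0 1 :: 'a set)
      + ennreal (unit_ball_vol (real DIM('a))) * (\<integral>\<^sup>+r. ennreal (- p) * indicator {0..1::real} r \<partial>lborel)"
  proof (intro add_mono mult_left_mono nn_integral_mono)
    fix r :: real
    have "(- p) * r powr (p - 1) * r ^ DIM('a) \<le> - p" if "0 < r" "r \<le> 1"
    proof -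
      have "r powr (p - 1) * r ^ DIM('a) = r powr (p - 1 + DIM('a))"
        using that by (simp add: powr_add powr_realpow)
      also have "\<dots> \<le> 1" using that p by (intro powr_le1) auto
      finally show ?thesis using p mult_left_mono[of "r powr (p - 1) * r ^ DIM('a)" 1 "- p"]
        by (simp add: mult.assoc)
    qed
    then show "ennreal (\<psi> r) * ennreal (r ^ DIM('a)) * indicator {0..} r \<le> ennreal (- p) * indicator {0..1} r"
      using p by (auto split: split_indicator simp: \<psi>_def mult_nonpos_nonneg simp flip: ennreal_mult intro!: ennreal_leI)
  qed (auto simp: ennreal_indicator)
  also have "\<dots> < \<infinity>"
    using emeasure_lborel_cball_finite[of "0::'a" 1]
    by (simp add: nn_integral_cmult ennreal_mult_less_top less_top)
  finally show ?thesis by (simp add: integrable_iff_bounded)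
qed

lemma power_mult_gaussian_bound:
  assumes "\<delta>' < \<delta>"
  shows "\<exists>C>0. \<forall>x::'a::real_normed_vector. (1 + norm x) ^ k * rgauss \<delta> x \<le> C * rgauss (\<delta>') x"
proof -
  obtain C where C: "C > 0" "\<And>r. \<bar>r\<bar> ^ k \<le> C * exp ((\<delta> - \<delta>') / 2 * r\<^sup>2)"
    using power_le_exp_square[of "(\<delta> - \<delta>') / 2" k] assms by auto
  have "(1 + norm x) ^ k * rgauss \<delta> x \<le> C * exp (\<delta> - \<delta>') * rgauss (\<delta>') x" for x :: 'a
  proof -
    have "(1 + norm x) ^ k \<le> C * exp ((\<delta> - \<delta>') / 2 * (1 + norm x)\<^sup>2)"
      using C(2)[of "1 + norm x"] by simp
    \<comment> \<open>The bound \<open>(1 + |x|)^2 \<le> 2 (1 + |x|^2)\<close> doubles the rate,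
      which is why only half of \<open>\<delta> - \<delta>'\<close> was spent above; the constant
      part of the exponent becomes the factor \<open>exp (\<delta> - \<delta>')\<close>.\<close>
    also have "(\<delta> - \<delta>') / 2 * (1 + norm x)\<^sup>2 \<le> (\<delta> - \<delta>') / 2 * (2 * (1 + (norm x)\<^sup>2))"
      using assms sum_squares_bound[of 1 "norm x"] by (intro mult_left_mono) (auto simp: power2_sum)
    then have "C * exp ((\<delta> - \<delta>') / 2 * (1 + norm x)\<^sup>2) \<le> C * exp ((\<delta> - \<delta>') / 2 * (2 * (1 + (norm x)\<^sup>2)))"
      using C(1) by simp
    finally have "(1 + norm x) ^ k * rgauss \<delta> x
        \<le> C * exp ((\<delta> - \<delta>') / 2 * (2 * (1 + (norm x)\<^sup>2))) * rgauss \<delta> x"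
      by (intro mult_right_mono) auto
    also have "\<dots> = C * exp (\<delta> - \<delta>') * rgauss (\<delta>') x"
      by (simp add: mult.assoc flip: exp_add) (simp add: field_simps)
    finally show ?thesis .
  qed
  then show ?thesis using C(1) by (intro exI[of _ "C * exp (\<delta> - \<delta>')"]) auto
qed

section \<open>Moments and Fourier transforms of Gaussians\<close>

lemma norm_exp_neg_mult [simp]: "cmod (exp (- (s * complex_of_real r))) = exp (- (Re s * r))"
  by simp

lemma integrable_power_mult_gaussian:
  assumes "0 < \<delta>"
  shows "integrable lborel (\<lambda>x::'a::euclidean_space. (1 + norm x) ^ k * rgauss \<delta> x)"
proof -
  obtain C where C: "\<And>x::'a. (1 + norm x) ^ k * rgauss \<delta> x \<le> C * rgauss (\<delta> / 2) x"
    using power_mult_gaussian_bound[of "\<delta> / 2" \<delta> k] assms by auto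
  show ?thesis
  proof (rule Bochner_Integration.integrable_bound)
    show "integrable lborel (\<lambda>x::'a. C * rgauss (\<delta> / 2) x)"
      using assms by (intro integrable_mult_right integrable_gaussian) simp
    show "AE x::'a in lborel. norm ((1 + norm x) ^ k * rgauss \<delta> x)
        \<le> norm (C * rgauss (\<delta> / 2) x)" (is "AE x in _. ?B x")
    proof (rule AE_I2)
      fix x :: 'a
      show "?B x"
        using C[of x] by (simp add: abs_mult) (smt (verit) abs_ge_self exp_gt_zero mult_right_mono)
    qed
  qed measurable
qed

lemma integrable_complex_gaussian:
  assumes "0 < Re s"
  shows "integrable lborel (\<lambda>x::'a::euclidean_space. cgauss s x)"
  by (rule Bochner_Integration.integrable_bound[OF integrable_gaussian[OF assms]]) auto

text \<open>Euler's identity for homogeneous functions in integrated form. By scaling, the integral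
  of \<open>\<rho> x * exp (-(s h^2 |x|^2))\<close> is a constant times
  \<open>h powr -(n + p)\<close>, n the dimension; the two ways of differentiating it at h = 1 give
  the two sides. Only the exponential is differentiated, so \<rho> may be singular at the origin,
  like a negative power of the norm.\<close>

lemma homogeneous_gaussian_identity:
  fixes \<rho> :: "'a::euclidean_space \<Rightarrow> real"
  assumes [measurable]: "\<rho> \<in> borel_measurable borel"
    and hom: "\<And>c x. 0 < c \<Longrightarrow> \<rho> (c *\<^sub>R x) = c powr p * \<rho> x"
    and int: "\<And>\<delta>. 0 < \<delta> \<Longrightarrow> integrable lborel (\<lambda>x. \<rho> x * rgauss \<delta> x)"
    and s: "0 < Re s"
  shows "complex_of_real (real DIM('a) + p) * (\<integral>x. complex_of_real (\<rho> x) * cgauss s x \<partial>lborel)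
    = 2 * s * (\<integral>x. complex_of_real (\<rho> x * (norm x)\<^sup>2) * cgauss s x \<partial>lborel)"
proof -
  define f where "f h x = complex_of_real (\<rho> x) * exp (- (s * complex_of_real (h\<^sup>2 * (norm x)\<^sup>2)))" for h x
  define f' where "f' h x = - (2 * h *\<^sub>R s * complex_of_real (\<rho> x * (norm x)\<^sup>2))
    * exp (- (s * complex_of_real (h\<^sup>2 * (norm x)\<^sup>2)))" for h x
  have [measurable]: "f h \<in> borel_measurable borel" "f' h \<in> borel_measurable borel" for h
    unfolding f_def f'_def by measurable
  have norm_f: "cmod (f h x) = \<bar>\<rho> x\<bar> * rgauss (Re s * h\<^sup>2) x" for h x
    unfolding f_def norm_mult by (simp add: mult.assoc)
  have int_f: "integrable lborel (f h)" if "h \<in> ball 1 (1/2)" for h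
  proof -
    have "h \<noteq> 0" using that by (auto simp: dist_real_def)
    then have "integrable lborel (\<lambda>x. \<rho> x * rgauss (Re s * h\<^sup>2) x)"
      using s by (intro int) auto
    then show ?thesis
      by (rule Bochner_Integration.integrable_bound) (auto simp: norm_f abs_mult)
  qed
  obtain C where C: "\<And>x::'a. (1 + norm x) ^ 2 * rgauss (Re s / 4) x \<le> C * rgauss (Re s / 8) x"
    using power_mult_gaussian_bound[of "Re s / 8" "Re s / 4" 2] s by auto
  have "((\<lambda>h. \<integral>x. f h x \<partial>lborel) has_vector_derivative (\<integral>x. f' 1 x \<partial>lborel)) (at 1)"
  \<comment> \<open>For h between 1/2 and 3/2 the decay rate \<open>Re s * h^2\<close> is at least
    \<open>Re s / 4\<close>; half of that pays for the factor \<open>|x|^2\<close> and leaves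
    \<open>Re s / 8\<close>. The 3 bounds 2h.\<close>
  proof (rule has_vector_derivative_lebesgue_integral[where \<delta> = "1/2"
        and g = "\<lambda>x. 3 * cmod s * C * \<bar>\<rho> x * rgauss (Re s / 8) x\<bar>"])
    fix h :: real and x assume "h \<in> ball 1 (1/2)"
    then have h: "1/2 \<le> h" "h \<le> 3/2" unfolding mem_ball dist_real_def by linarith+
    show "((\<lambda>h. f h x) has_vector_derivative f' h x) (at h)"
      unfolding f_def f'_def
      by (auto intro!: derivative_eq_intros has_vector_derivative_real_field simp: scaleR_conv_of_real)
    have "(1/2)\<^sup>2 \<le> h\<^sup>2" using h by (intro power_mono) auto
    then have "Re s / 4 * (norm x)\<^sup>2 \<le> Re s * h\<^sup>2 * (norm x)\<^sup>2"
      using s by (intro mult_right_mono) (auto simp: power2_eq_square)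
    then have e: "rgauss (Re s * h\<^sup>2) x \<le> rgauss (Re s / 4) x" by simp
    have "cmod (f' h x) = 2 * h * cmod s * (\<bar>\<rho> x\<bar> * (norm x)\<^sup>2) * rgauss (Re s * h\<^sup>2) x"
      unfolding f'_def norm_mult norm_minus_cancel using h by (simp add: norm_mult norm_power abs_mult mult.assoc)
    also have "\<dots> \<le> 3 * cmod s * (\<bar>\<rho> x\<bar> * (1 + norm x)\<^sup>2) * rgauss (Re s / 4) x"
      using h e by (intro mult_mono) (auto intro!: power_mono)
    also have "\<dots> = 3 * cmod s * \<bar>\<rho> x\<bar> * ((1 + norm x)\<^sup>2 * rgauss (Re s / 4) x)" by simp
    also have "\<dots> \<le> 3 * cmod s * \<bar>\<rho> x\<bar> * (C * rgauss (Re s / 8) x)"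
      by (intro mult_left_mono C) auto
    finally show "cmod (f' h x) \<le> 3 * cmod s * C * \<bar>\<rho> x * rgauss (Re s / 8) x\<bar>"
      by (simp add: abs_mult mult_ac)
  next
    show "integrable lborel (\<lambda>x. 3 * cmod s * C * \<bar>\<rho> x * rgauss (Re s / 8) x\<bar>)"
      using int[of "Re s / 8"] s by (intro integrable_mult_right integrable_abs) simp
  qed (use int_f in auto)
  moreover have I: "(\<integral>x. f h x \<partial>lborel) = complex_of_real (h powr - (real DIM('a) + p)) * (\<integral>x. f 1 x \<partial>lborel)" if "0 < h" for h
  proof -
    have "(\<integral>x. f 1 x \<partial>lborel) = \<bar>h\<bar> ^ DIM('a) *\<^sub>R (\<integral>x. f 1 (0 + h *\<^sub>R x) \<partial>lborel)"
      using that by (intro integral_lborel_affine) auto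
    also have "(\<integral>x. f 1 (0 + h *\<^sub>R x) \<partial>lborel) = complex_of_real (h powr p) * (\<integral>x. f h x \<partial>lborel)"
      using that by (simp add: f_def hom power_mult_distrib mult.assoc)
    finally have "(\<integral>x. f 1 x \<partial>lborel) = complex_of_real (h powr (real DIM('a) + p)) * (\<integral>x. f h x \<partial>lborel)"
      using that by (simp add: powr_add powr_realpow scaleR_conv_of_real)
    then have "complex_of_real (h powr - (real DIM('a) + p)) * (\<integral>x. f 1 x \<partial>lborel)
        = complex_of_real (h powr - (real DIM('a) + p) * h powr (real DIM('a) + p)) * (\<integral>x. f h x \<partial>lborel)"
      by simp
    also have "h powr - (real DIM('a) + p) * h powr (real DIM('a) + p) = 1"
      using that by (simp flip: powr_add)
    finally show ?thesis by simp
  qed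
  have "((\<lambda>h. complex_of_real (h powr - (real DIM('a) + p)) * (\<integral>x. f 1 x \<partial>lborel))
      has_vector_derivative complex_of_real (- (real DIM('a) + p)) * (\<integral>x. f 1 x \<partial>lborel)) (at 1)"
    by (auto intro!: derivative_eq_intros)
  then have "((\<lambda>h. \<integral>x. f h x \<partial>lborel) has_vector_derivative complex_of_real (- (real DIM('a) + p)) * (\<integral>x. f 1 x \<partial>lborel)) (at 1)"
  proof (rule has_vector_derivative_transform_within_open[where S = "{0<..}"])
    show "complex_of_real (h powr - (real DIM('a) + p)) * (\<integral>x. f 1 x \<partial>lborel) = (\<integral>x. f h x \<partial>lborel)"
      if "h \<in> {0<..}" for h using that by (intro I[symmetric]) simp
  qed auto
  ultimately have "(\<integral>x. f' 1 x \<partial>lborel) = complex_of_real (- (real DIM('a) + p)) * (\<integral>x. f 1 x \<partial>lborel)"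
    by (rule vector_derivative_unique_at)
  moreover have "(\<integral>x. f' 1 x \<partial>lborel) = - (2 * s * (\<integral>x. complex_of_real (\<rho> x * (norm x)\<^sup>2) * cgauss s x \<partial>lborel))"
    by (simp add: f'_def mult.assoc)
  ultimately have "complex_of_real (real DIM('a) + p) * (\<integral>x. f 1 x \<partial>lborel)
      = 2 * s * (\<integral>x. complex_of_real (\<rho> x * (norm x)\<^sup>2) * cgauss s x \<partial>lborel)"
    by (simp only: of_real_minus mult_minus_left neg_equal_iff_equal)
  then show ?thesis by (simp add: f_def)
qed

text \<open>Expanding \<open>|x + 2y|^2 \<ge> 0\<close> gives it. It lets a Gaussian be translated
  at the price of half of its decay rate and a constant factor.\<close>

lemma norm_add_sq_lower: "(norm x)\<^sup>2 / 2 - (norm y)\<^sup>2 \<le> (norm (x + y))\<^sup>2"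
  for x y :: "'a::real_inner"
proof -
  have "0 \<le> (norm (x + 2 *\<^sub>R y))\<^sup>2" by simp
  then show ?thesis by (simp add: power2_norm_eq_inner inner_simps inner_commute algebra_simps)
qed

text \<open>Integration by parts against a Gaussian: the integrand is the derivative of
  \<open>q * cgauss s\<close> along v. The Gaussian supplies the majorant, so polynomial growth of q
  and of its derivative is all that is asked of them.\<close>

lemma integral_directional_derivative_gaussian:
  fixes v :: "'a::euclidean_space" and q q' :: "'a \<Rightarrow> complex" and w :: complex
  assumes s: "0 < Re s"
    and der: "\<And>x. ((\<lambda>h. q (x + h *\<^sub>R v)) has_vector_derivative q' x) (at 0)"
    and q: "\<And>x. cmod (q x) \<le> B * (1 + norm x) ^ k" and q': "\<And>x. cmod (q' x) \<le> B * (1 + norm x) ^ k"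
    and [measurable]: "q \<in> borel_measurable borel" "q' \<in> borel_measurable borel"
  shows "(\<integral>x. (q' x - 2 * s * complex_of_real (x \<bullet> v) * q x) * cgauss s x \<partial>lborel) = 0"
proof -
  define g where "g x = (q' x - 2 * s * complex_of_real (x \<bullet> v) * q x) * cgauss s x" for x
  have B: "0 \<le> B" using order_trans[OF norm_ge_zero q[of 0]] by simp
  obtain C where C: "C > 0" "\<And>x::'a. (1 + norm x) ^ (k + 1) * rgauss (Re s) x \<le> C * rgauss (Re s / 2) x"
    using power_mult_gaussian_bound[of "Re s / 2" "Re s" "k + 1"] s by auto
  define D where "D = B * (1 + 2 * cmod s * norm v) * C"
  have D: "0 \<le> D" unfolding D_def using B C(1) by simp
  have g_bound: "cmod (g x) \<le> D * rgauss (Re s / 2) x" for x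
  proof -
    have "cmod (q' x - 2 * s * complex_of_real (x \<bullet> v) * q x)
        \<le> cmod (q' x) + 2 * cmod s * \<bar>x \<bullet> v\<bar> * cmod (q x)"
      by (rule order_trans[OF norm_triangle_ineq4]) (simp add: norm_mult)
    also have "\<dots> \<le> B * (1 + norm x) ^ k * (1 + norm x) + 2 * cmod s * ((1 + norm x) * norm v) * (B * (1 + norm x) ^ k)"
    proof (intro add_mono mult_mono)
      show "cmod (q' x) \<le> B * (1 + norm x) ^ k * (1 + norm x)"
        using mult_left_mono[of 1 "1 + norm x" "B * (1 + norm x) ^ k"] q'[of x] B by simp
      show "\<bar>x \<bullet> v\<bar> \<le> (1 + norm x) * norm v"
        by (rule order_trans[OF Cauchy_Schwarz_ineq2]) (simp add: mult_right_mono)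
    qed (use q B in auto)
    also have "\<dots> = B * (1 + 2 * cmod s * norm v) * (1 + norm x) ^ (k + 1)"
      by (simp add: algebra_simps)
    finally have "cmod (g x) \<le> B * (1 + 2 * cmod s * norm v) * (1 + norm x) ^ (k + 1) * rgauss (Re s) x"
      unfolding g_def norm_mult norm_exp_neg_mult by (intro mult_right_mono) auto
    also have "\<dots> \<le> B * (1 + 2 * cmod s * norm v) * (C * rgauss (Re s / 2) x)"
      using C(2)[of x] B by (subst mult.assoc) (intro mult_left_mono, auto)
    finally show ?thesis by (simp add: D_def mult.assoc)
  qed
  have "(\<integral>x. g x \<partial>lborel) = 0"
  \<comment> \<open>The rate drops from \<open>Re s / 2\<close> to \<open>Re s / 4\<close> because
    the majorant has to hold for all translates by multiples of v with |h| < 1.\<close>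
  proof (rule has_vector_derivative_translation_imp_integral_eq_0[where \<delta> = 1 and v = v
        and f = "\<lambda>x. q x * cgauss s x"
        and g = "\<lambda>x. D * exp (Re s / 2 * (norm v)\<^sup>2) * rgauss (Re s / 4) x"])
    have "integrable lborel (\<lambda>x::'a. B * ((1 + norm x) ^ k * rgauss (Re s) x))"
      using s by (intro integrable_mult_right integrable_power_mult_gaussian) auto
    then show "integrable lborel (\<lambda>x. q x * cgauss s x)"
    proof (rule Bochner_Integration.integrable_bound)
      show "AE x in lborel. cmod (q x * cgauss s x)
          \<le> norm (B * ((1 + norm x) ^ k * rgauss (Re s) x))"
        unfolding norm_mult norm_exp_neg_mult using q B
        by (intro AE_I2) (simp add: mult_right_mono flip: mult.assoc)
    qed measurable
    show "integrable lborel (\<lambda>x. D * exp (Re s / 2 * (norm v)\<^sup>2) * rgauss (Re s / 4) x)"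
      using s by (intro integrable_mult_right integrable_gaussian) simp
    show "((\<lambda>h. q (x + h *\<^sub>R v) * cgauss s (x + h *\<^sub>R v)) has_vector_derivative g x) (at 0)" for x
    proof -
      have eq: "(norm (x + h *\<^sub>R v))\<^sup>2 = (norm x)\<^sup>2 + 2 * h * (x \<bullet> v) + h\<^sup>2 * (norm v)\<^sup>2" for h
        by (simp only: power2_norm_eq_inner) (simp add: inner_simps inner_commute algebra_simps power2_eq_square)
      have "((\<lambda>h. cgauss s (x + h *\<^sub>R v)) has_vector_derivative
          - (2 * s * complex_of_real (x \<bullet> v)) * cgauss s x) (at 0)"
        unfolding eq by (auto intro!: derivative_eq_intros has_vector_derivative_real_field)
      from has_vector_derivative_mult[OF der[of x] this] show ?thesis
        by (simp add: g_def algebra_simps)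
    qed
    show "cmod (g (x + h *\<^sub>R v)) \<le> D * exp (Re s / 2 * (norm v)\<^sup>2) * rgauss (Re s / 4) x" if "\<bar>h\<bar> < 1" for h x
    proof -
      have "(norm (h *\<^sub>R v))\<^sup>2 \<le> (norm v)\<^sup>2"
        using that by (intro power_mono) (auto intro: mult_left_le_one_le)
      then have "(norm x)\<^sup>2 / 2 - (norm v)\<^sup>2 \<le> (norm (x + h *\<^sub>R v))\<^sup>2"
        using norm_add_sq_lower[of x "h *\<^sub>R v"] by linarith
      then have "Re s / 2 * ((norm x)\<^sup>2 / 2 - (norm v)\<^sup>2) \<le> Re s / 2 * (norm (x + h *\<^sub>R v))\<^sup>2"
        using s by (intro mult_left_mono) auto
      then have "rgauss (Re s / 2) (x + h *\<^sub>R v) \<le> exp (Re s / 2 * (norm v)\<^sup>2 + - (Re s / 4 * (norm x)\<^sup>2))"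
        by (simp add: algebra_simps)
      then have "D * rgauss (Re s / 2) (x + h *\<^sub>R v) \<le> D * exp (Re s / 2 * (norm v)\<^sup>2 + - (Re s / 4 * (norm x)\<^sup>2))"
        using D by (rule mult_left_mono)
      with g_bound[of "x + h *\<^sub>R v"] show ?thesis unfolding exp_add mult.assoc by linarith
    qed
    show "g \<in> borel_measurable borel" unfolding g_def by measurable
  qed auto
  then show ?thesis by (simp add: g_def)
qed

lemma integral_odd_eq_0:
  fixes f :: "'a::euclidean_space \<Rightarrow> 'b::{banach, second_countable_topology}"
  assumes "f \<in> borel_measurable borel" "\<And>x. f (- x) = - f x"
  shows "(\<integral>x. f x \<partial>lborel) = 0"
proof -
  have "(\<integral>x. f x \<partial>lborel) = - (\<integral>x. f x \<partial>lborel)"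
    using integral_lborel_affine[of f "-1" 0] assms by simp
  then show ?thesis by (simp add: eq_neg_iff_add_eq_0 flip: scaleR_2)
qed

text \<open>Integration by parts with \<open>q x = x \<bullet> v\<close>, whose derivative along v
  is the constant \<open>(norm v)^2\<close>.\<close>

lemma gaussian_second_moment:
  fixes v :: "'a::euclidean_space"
  assumes s: "0 < Re s"
  shows "2 * s * (\<integral>x. complex_of_real ((x \<bullet> v)\<^sup>2) * cgauss s x \<partial>lborel)
    = complex_of_real ((norm v)\<^sup>2) * (\<integral>(x::'a). cgauss s x \<partial>lborel)"
proof -
  let ?E = "\<lambda>x::'a. cgauss s x"
  have int: "integrable lborel (\<lambda>x. complex_of_real ((x \<bullet> v)\<^sup>2) * ?E x)"
  proof (rule Bochner_Integration.integrable_bound)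
    show "integrable lborel (\<lambda>x::'a. (norm v)\<^sup>2 * ((1 + norm x)\<^sup>2 * rgauss (Re s) x))"
      using s by (intro integrable_mult_right integrable_power_mult_gaussian) auto
    have "(x \<bullet> v)\<^sup>2 \<le> (norm v)\<^sup>2 * (1 + norm x)\<^sup>2" for x
    proof -
      have "\<bar>x \<bullet> v\<bar> \<le> norm v * (1 + norm x)"
        using Cauchy_Schwarz_ineq2[of x v] by (simp add: algebra_simps) (smt (verit) norm_ge_zero)
      then have "\<bar>x \<bullet> v\<bar>\<^sup>2 \<le> (norm v * (1 + norm x))\<^sup>2" by (intro power_mono) auto
      then show ?thesis by (simp add: power_mult_distrib)
    qed
    then show "AE x in lborel. cmod (complex_of_real ((x \<bullet> v)\<^sup>2) * ?E x)
        \<le> norm ((norm v)\<^sup>2 * ((1 + norm x)\<^sup>2 * rgauss (Re s) x))"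
      unfolding norm_mult norm_exp_neg_mult
      by (intro AE_I2) (simp add: mult_right_mono norm_power flip: mult.assoc)
  qed measurable
  have "(\<integral>x. (complex_of_real ((norm v)\<^sup>2) - 2 * s * complex_of_real (x \<bullet> v) * complex_of_real (x \<bullet> v)) * ?E x \<partial>lborel) = 0"
  proof (rule integral_directional_derivative_gaussian[OF s, where B = "norm v + (norm v)\<^sup>2" and k = 1])
    fix x
    show "((\<lambda>h. complex_of_real ((x + h *\<^sub>R v) \<bullet> v)) has_vector_derivative complex_of_real ((norm v)\<^sup>2)) (at 0)"
      by (auto intro!: derivative_eq_intros simp: inner_simps power2_norm_eq_inner)
    show "cmod (complex_of_real (x \<bullet> v)) \<le> (norm v + (norm v)\<^sup>2) * (1 + norm x) ^ 1"
      using Cauchy_Schwarz_ineq2[of x v] by (simp add: algebra_simps) (smt (verit) norm_ge_zero zero_le_power2 mult_nonneg_nonneg)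
    show "cmod (complex_of_real ((norm v)\<^sup>2)) \<le> (norm v + (norm v)\<^sup>2) * (1 + norm x) ^ 1"
      by (simp add: algebra_simps norm_power)
  qed measurable
  moreover have "(complex_of_real ((norm v)\<^sup>2) - 2 * s * complex_of_real (x \<bullet> v) * complex_of_real (x \<bullet> v)) * ?E x
      = complex_of_real ((norm v)\<^sup>2) * ?E x - 2 * s * (complex_of_real ((x \<bullet> v)\<^sup>2) * ?E x)" for x
    by (simp add: algebra_simps power2_eq_square)
  ultimately show ?thesis
    using int integrable_complex_gaussian[OF s, where 'a = 'a] by simp
qed

lemma integrable_norm_power_gaussian:
  assumes "0 < \<delta>"
  shows "integrable lborel (\<lambda>x::'a::euclidean_space. norm x ^ k * rgauss \<delta> x)"
  by (rule Bochner_Integration.integrable_bound[OF integrable_power_mult_gaussian[OF assms, of k]])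
    (auto simp: power_mono)

lemma gaussian_norm_moment:
  assumes "0 < Re s"
  shows "complex_of_real (real DIM('a) + real k) * (\<integral>(x::'a::euclidean_space). complex_of_real (norm x ^ k) * cgauss s x \<partial>lborel)
    = 2 * s * (\<integral>(x::'a). complex_of_real (norm x ^ k * (norm x)\<^sup>2) * cgauss s x \<partial>lborel)"
proof -
  have "norm (c *\<^sub>R x) ^ k = c powr real k * norm x ^ k" if "0 < c" for c and x :: 'a
    using that by (simp add: power_mult_distrib powr_realpow)
  from homogeneous_gaussian_identity[OF _ this integrable_norm_power_gaussian assms] show ?thesis by simp
qed

text \<open>Along the ray through \<xi> the transform \<phi>(h) satisfies
  \<open>\<phi>' = - h |\<xi>|^2 / (2 s) * \<phi>\<close>: the factor
  \<open>x \<bullet> \<xi>\<close> produced by differentiation is removed by integrating by parts.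
  Hence \<phi> times the reciprocal exponential is constant in the real variable h, for complex s as
  well. The value at frequency 0 stays an unevaluated integral.\<close>

lemma gaussian_fourier_integral:
  fixes \<xi> :: "'a::euclidean_space"
  assumes s: "0 < Re s"
  shows "(\<integral>x. cgauss s x * exp (- \<i> * complex_of_real (x \<bullet> \<xi>)) \<partial>lborel)
    = exp (- (complex_of_real ((norm \<xi>)\<^sup>2) / (4 * s))) * (\<integral>(x::'a). cgauss s x \<partial>lborel)"
proof -
  have s0: "s \<noteq> 0" using s by auto
  let ?E = "\<lambda>x::'a. cgauss s x"
  define e where "e h x = exp (- \<i> * complex_of_real (h * (x \<bullet> \<xi>)))" for h :: real and x
  have [measurable]: "e h \<in> borel_measurable borel" for h unfolding e_def by measurable
  have norm_e [simp]: "cmod (e h x) = 1" for h x by (simp add: e_def)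
  define \<phi> where "\<phi> h = (\<integral>x. e h x * ?E x \<partial>lborel)" for h
  have int0: "integrable lborel (\<lambda>x. e h x * ?E x)" for h
    by (rule Bochner_Integration.integrable_bound[OF integrable_complex_gaussian[OF s]]) (auto simp: norm_mult)
  have bd: "\<bar>x \<bullet> \<xi>\<bar> \<le> norm \<xi> * (1 + norm x) ^ 1" for x
    using Cauchy_Schwarz_ineq2[of x \<xi>] by (simp add: algebra_simps) (smt (verit) norm_ge_zero)
  have intg: "integrable lborel (\<lambda>x::'a. norm \<xi> * ((1 + norm x) ^ 1 * rgauss (Re s) x))"
    using s by (intro integrable_mult_right integrable_power_mult_gaussian) auto
  have bd1: "cmod (complex_of_real (x \<bullet> \<xi>) * (e h x * ?E x)) \<le> norm \<xi> * ((1 + norm x) ^ 1 * rgauss (Re s) x)" for h x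
    unfolding norm_mult norm_exp_neg_mult using mult_right_mono[OF bd, of "rgauss (Re s) x" x] by simp
  have int1: "integrable lborel (\<lambda>x. complex_of_real (x \<bullet> \<xi>) * (e h x * ?E x))" for h
    using bd1 by (intro Bochner_Integration.integrable_bound[OF intg] AE_I2) (auto intro: order_trans)
  have der: "(\<phi> has_vector_derivative (- \<i> * (\<integral>x. complex_of_real (x \<bullet> \<xi>) * (e h x * ?E x) \<partial>lborel))) (at h)" for h
  proof -
    have "(\<phi> has_vector_derivative (\<integral>x. - \<i> * (complex_of_real (x \<bullet> \<xi>) * (e h x * ?E x)) \<partial>lborel)) (at h)"
      unfolding \<phi>_def
    proof (rule has_vector_derivative_lebesgue_integral[where \<delta> = 1, OF _ int0 _ _ intg])
      show "((\<lambda>h. e h x * ?E x) has_vector_derivative - \<i> * (complex_of_real (x \<bullet> \<xi>) * (e h x * ?E x))) (at h)" for h x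
        unfolding e_def by (auto intro!: derivative_eq_intros has_vector_derivative_real_field)
      show "cmod (- \<i> * (complex_of_real (x \<bullet> \<xi>) * (e h x * ?E x))) \<le> norm \<xi> * ((1 + norm x) ^ 1 * rgauss (Re s) x)" for h x
        using bd1[of x h] by (simp add: norm_mult)
    qed auto
    then show ?thesis using int1 by simp
  qed
  have ibp: "2 * s * (\<integral>x. complex_of_real (x \<bullet> \<xi>) * (e h x * ?E x) \<partial>lborel) = - \<i> * complex_of_real (h * (norm \<xi>)\<^sup>2) * \<phi> h" for h
  proof -
    have "(\<integral>x. (- \<i> * complex_of_real (h * (norm \<xi>)\<^sup>2) * e h x - 2 * s * complex_of_real (x \<bullet> \<xi>) * e h x) * ?E x \<partial>lborel) = 0"
    proof (rule integral_directional_derivative_gaussian[OF s, where B = "1 + \<bar>h\<bar> * (norm \<xi>)\<^sup>2" and k = 0])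
      fix x
      show "((\<lambda>k. e h (x + k *\<^sub>R \<xi>)) has_vector_derivative - \<i> * complex_of_real (h * (norm \<xi>)\<^sup>2) * e h x) (at 0)"
        unfolding e_def by (auto intro!: derivative_eq_intros has_vector_derivative_real_field simp: inner_simps power2_norm_eq_inner)
    qed (auto simp: norm_mult norm_power)
    moreover have "(- \<i> * complex_of_real (h * (norm \<xi>)\<^sup>2) * e h x - 2 * s * complex_of_real (x \<bullet> \<xi>) * e h x) * ?E x
      = (- \<i> * complex_of_real (h * (norm \<xi>)\<^sup>2)) * (e h x * ?E x) - 2 * s * (complex_of_real (x \<bullet> \<xi>) * (e h x * ?E x))" for x
      by (simp only: left_diff_distrib mult.assoc)
    ultimately show ?thesis using int0 int1 by (simp add: \<phi>_def del: of_real_mult)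
  qed
  have "((\<lambda>h. \<phi> h * exp (complex_of_real (h\<^sup>2 * (norm \<xi>)\<^sup>2) / (4 * s))) has_vector_derivative 0) (at h)" for h
  proof -
    let ?X = "exp (complex_of_real (h\<^sup>2 * (norm \<xi>)\<^sup>2) / (4 * s))"
    have "(\<integral>x. complex_of_real (x \<bullet> \<xi>) * (e h x * ?E x) \<partial>lborel) = - \<i> * complex_of_real (h * (norm \<xi>)\<^sup>2) * \<phi> h / (2 * s)"
      using ibp[of h] s0 by (simp add: field_simps)
    then have d1: "(\<phi> has_vector_derivative - (complex_of_real (h * (norm \<xi>)\<^sup>2) * \<phi> h / (2 * s))) (at h)"
      using der[of h] by (simp add: field_simps)
    have d2: "((\<lambda>h. exp (complex_of_real (h\<^sup>2 * (norm \<xi>)\<^sup>2) / (4 * s))) has_vector_derivative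
        complex_of_real (h * (norm \<xi>)\<^sup>2) / (2 * s) * ?X) (at h)"
      using s0 by (auto intro!: derivative_eq_intros has_vector_derivative_real_field simp: field_simps)
    from has_vector_derivative_mult[OF d1 d2] show ?thesis by (simp add: field_simps)
  qed
  then obtain c where c: "\<And>h. \<phi> h * exp (complex_of_real (h\<^sup>2 * (norm \<xi>)\<^sup>2) / (4 * s)) = c"
    using has_vector_derivative_zero_constant[of UNIV "\<lambda>h. \<phi> h * exp (complex_of_real (h\<^sup>2 * (norm \<xi>)\<^sup>2) / (4 * s))"] by auto
  have "\<phi> 1 * exp (complex_of_real (1\<^sup>2 * (norm \<xi>)\<^sup>2) / (4 * s)) = \<phi> 0 * exp (complex_of_real (0\<^sup>2 * (norm \<xi>)\<^sup>2) / (4 * s))"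
    unfolding c ..
  then have "\<phi> 1 = exp (- (complex_of_real ((norm \<xi>)\<^sup>2) / (4 * s))) * \<phi> 0"
    by (simp add: exp_minus field_simps)
  then show ?thesis by (simp add: \<phi>_def e_def mult.commute)
qed

lemma real_gaussian_integral_power:
  assumes "0 < \<sigma>"
  shows "(\<integral>(x::'a::euclidean_space). rgauss \<sigma> x \<partial>lborel)\<^sup>2 * \<sigma> ^ DIM('a) = (\<integral>(x::'a). exp (- (norm x)\<^sup>2) \<partial>lborel)\<^sup>2"
proof -
  have "(\<integral>(x::'a). exp (- (norm x)\<^sup>2) \<partial>lborel) = sqrt \<sigma> ^ DIM('a) * (\<integral>(x::'a). rgauss \<sigma> x \<partial>lborel)"
    using integral_lborel_affine[of "\<lambda>x::'a. exp (- (norm x)\<^sup>2)" "sqrt \<sigma>" 0] assms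
    by (simp add: power_mult_distrib)
  moreover have "(sqrt \<sigma> ^ DIM('a))\<^sup>2 = \<sigma> ^ DIM('a)"
    using assms by (subst power_mult[symmetric], subst mult.commute, subst power_mult) simp
  ultimately show ?thesis by (simp add: power_mult_distrib)
qed

text \<open>Squaring avoids the choice of a branch of \<open>s^(n/2)\<close>, n the dimension. Along
  the vertical line through s the moment identity of order 0 gives
  \<open>J' = - \<i> n J / (2 \<sigma>)\<close>, so \<open>J^2 \<sigma>^n\<close> is constant there;
  at the real point of the line it is evaluated by scaling.\<close>

lemma gaussian_integral_power:
  assumes s: "0 < Re s"
  shows "(\<integral>(x::'a::euclidean_space). cgauss s x \<partial>lborel)\<^sup>2 * s ^ DIM('a)
    = complex_of_real ((\<integral>(x::'a). exp (- (norm x)\<^sup>2) \<partial>lborel)\<^sup>2)"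
proof -
  define \<sigma> where "\<sigma> t = Complex (Re s) t" for t
  have \<sigma>: "Re (\<sigma> t) = Re s" "\<sigma> t \<noteq> 0" "0 < Re (\<sigma> t)" for t using s by (auto simp: \<sigma>_def complex_eq_iff)
  define J where "J t = (\<integral>(x::'a). cgauss (\<sigma> t) x \<partial>lborel)" for t
  have d\<sigma>: "(\<sigma> has_vector_derivative \<i>) (at t)" for t
    unfolding \<sigma>_def Complex_eq by (auto intro!: derivative_eq_intros)
  have dJ: "(J has_vector_derivative - \<i> * (complex_of_real (real DIM('a)) * J t / (2 * \<sigma> t))) (at t)" for t
  proof -
    have int: "integrable lborel (\<lambda>x::'a. complex_of_real (norm x ^ 2) * cgauss (\<sigma> t) x)" for t
      by (rule Bochner_Integration.integrable_bound[OF integrable_norm_power_gaussian[OF s, of 2]])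
        (auto simp: norm_mult norm_power \<sigma>)
    have "(J has_vector_derivative (\<integral>(x::'a). - \<i> * (complex_of_real (norm x ^ 2) * cgauss (\<sigma> t) x) \<partial>lborel)) (at t)"
      unfolding J_def
    proof (rule has_vector_derivative_lebesgue_integral[where \<delta> = 1, OF _ integrable_complex_gaussian[OF \<sigma>(3)]
          _ _ integrable_norm_power_gaussian[OF s, of 2]])
      show "((\<lambda>t. cgauss (\<sigma> t) x) has_vector_derivative
          - \<i> * (complex_of_real (norm x ^ 2) * cgauss (\<sigma> t) x)) (at t)" for t and x :: 'a
        unfolding \<sigma>_def Complex_eq
        by (auto intro!: derivative_eq_intros has_vector_derivative_real_field)
    qed (auto simp: norm_mult norm_power \<sigma>)
    also have "(\<integral>(x::'a). - \<i> * (complex_of_real (norm x ^ 2) * cgauss (\<sigma> t) x) \<partial>lborel)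
        = - \<i> * (\<integral>(x::'a). complex_of_real (norm x ^ 2) * cgauss (\<sigma> t) x \<partial>lborel)"
      using int by simp
    also have "(\<integral>(x::'a). complex_of_real (norm x ^ 2) * cgauss (\<sigma> t) x \<partial>lborel)
        = complex_of_real (real DIM('a)) * J t / (2 * \<sigma> t)"
      using gaussian_norm_moment[OF \<sigma>(3)[of t], of 0, where 'a = 'a] \<sigma>(2)[of t] by (simp add: J_def field_simps)
    finally show ?thesis .
  qed
  have "((\<lambda>t. (J t)\<^sup>2 * \<sigma> t ^ DIM('a)) has_vector_derivative 0) (at t)" for t
  proof -
    obtain m where m: "DIM('a) = Suc m" using DIM_positive[where 'a='a] gr0_implies_Suc by blast
    have dpow: "((\<lambda>t. \<sigma> t ^ Suc m) has_vector_derivative (\<i> * (complex_of_real (real (Suc m)) * \<sigma> t ^ m))) (at t)"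
    proof -
      have "((\<lambda>z. z ^ Suc m) has_field_derivative complex_of_real (real (Suc m)) * \<sigma> t ^ m) (at (\<sigma> t))"
        by (auto intro!: derivative_eq_intros simp del: power_Suc)
      from field_vector_diff_chain_at[OF d\<sigma>[of t] this] show ?thesis by (simp add: o_def)
    qed
    have "((\<lambda>t. J t * J t * \<sigma> t ^ Suc m) has_vector_derivative
        J t * J t * (\<i> * (complex_of_real (real (Suc m)) * \<sigma> t ^ m))
        + (J t * (- \<i> * (complex_of_real (real DIM('a)) * J t / (2 * \<sigma> t)))
          + (- \<i> * (complex_of_real (real DIM('a)) * J t / (2 * \<sigma> t))) * J t) * \<sigma> t ^ Suc m) (at t)"
      by (intro has_vector_derivative_mult dJ dpow)
    also have "J t * J t * (\<i> * (complex_of_real (real (Suc m)) * \<sigma> t ^ m))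
        + (J t * (- \<i> * (complex_of_real (real DIM('a)) * J t / (2 * \<sigma> t)))
          + (- \<i> * (complex_of_real (real DIM('a)) * J t / (2 * \<sigma> t))) * J t) * \<sigma> t ^ Suc m = 0"
      using \<sigma>(2)[of t] unfolding m by (simp add: field_simps)
    finally show ?thesis by (simp add: m power2_eq_square)
  qed
  then obtain c where c: "\<And>t. (J t)\<^sup>2 * \<sigma> t ^ DIM('a) = c"
    using has_vector_derivative_zero_constant[of UNIV "\<lambda>t. (J t)\<^sup>2 * \<sigma> t ^ DIM('a)"] by auto
  have "(J (Im s))\<^sup>2 * \<sigma> (Im s) ^ DIM('a) = (J 0)\<^sup>2 * \<sigma> 0 ^ DIM('a)"
    unfolding c ..
  also have s0: "\<sigma> 0 = complex_of_real (Re s)" by (simp add: \<sigma>_def complex_eq_iff)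
  also have "J 0 = complex_of_real (\<integral>(x::'a). rgauss (Re s) x \<partial>lborel)"
    unfolding J_def s0 by (subst integral_complex_of_real[symmetric]) (simp flip: exp_of_real)
  finally show ?thesis
    using real_gaussian_integral_power[OF s, where 'a = 'a] by (simp add: J_def \<sigma>_def flip: of_real_power of_real_mult)
qed

section \<open>Continuity of translations and the space \<open>L\<^sup>2\<close>\<close>

lemma integral_norm_translation_le:
  fixes f :: "'a::euclidean_space \<Rightarrow> 'b::{banach, second_countable_topology}"
  assumes f: "integrable lborel f"
  shows "(\<integral>x. norm (f (x - w) - f x) \<partial>lborel) \<le> 2 * (\<integral>x. norm (f x) \<partial>lborel)"
    and "integrable lborel (\<lambda>x. f (x - w))"
proof -
  show int: "integrable lborel (\<lambda>x. f (x - w))"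
    using integrable_lborel_affine[OF f, of 1 "- w"] by simp
  have eq: "(\<integral>x. norm (f (x - w)) \<partial>lborel) = (\<integral>x. norm (f x) \<partial>lborel)"
    using integral_lborel_affine[of "\<lambda>x. norm (f x)" 1 "- w"] f by simp
  have "(\<integral>x. norm (f (x - w) - f x) \<partial>lborel) \<le> (\<integral>x. norm (f (x - w)) + norm (f x) \<partial>lborel)"
    using f int by (intro integral_mono) (auto intro: norm_triangle_ineq4)
  then show "(\<integral>x. norm (f (x - w) - f x) \<partial>lborel) \<le> 2 * (\<integral>x. norm (f x) \<partial>lborel)"
    using f int eq by simp
qed

text \<open>Translations preserve the \<open>L^1\<close> norm, so replacing f by g costs at most
  twice their distance, uniformly in w.\<close>

lemma tendsto_L1_translation_approx:
  fixes f :: "'a::euclidean_space \<Rightarrow> 'b::{banach, second_countable_topology}"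
  assumes f: "integrable lborel f"
    and approx: "\<And>e. 0 < e \<Longrightarrow> \<exists>g. integrable lborel g \<and> (\<integral>x. norm (f x - g x) \<partial>lborel) < e \<and>
      ((\<lambda>w. \<integral>x. norm (g (x - w) - g x) \<partial>lborel) \<longlongrightarrow> 0) (at 0)"
  shows "((\<lambda>w. \<integral>x. norm (f (x - w) - f x) \<partial>lborel) \<longlongrightarrow> 0) (at 0)"
proof (rule tendstoI)
  fix e :: real assume "0 < e"
  then obtain g where g: "integrable lborel g" "(\<integral>x. norm (f x - g x) \<partial>lborel) < e / 4"
    "((\<lambda>w. \<integral>x. norm (g (x - w) - g x) \<partial>lborel) \<longlongrightarrow> 0) (at 0)"
    using approx[of "e / 4"] by auto
  have "\<forall>\<^sub>F w in at 0. (\<integral>x. norm (g (x - w) - g x) \<partial>lborel) < e / 2"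
    using order_tendstoD(2)[OF g(3), of "e / 2"] \<open>0 < e\<close> by simp
  then show "\<forall>\<^sub>F w in at 0. dist (\<integral>x. norm (f (x - w) - f x) \<partial>lborel) 0 < e"
  proof eventually_elim
    case (elim w)
    let ?d = "\<lambda>x. f x - g x"
    have d: "integrable lborel ?d" using f g by simp
    note int = integral_norm_translation_le(2)[OF f, of w] integral_norm_translation_le(2)[OF g(1), of w]
    have "(\<integral>x. norm (f (x - w) - f x) \<partial>lborel) \<le> (\<integral>x. norm (?d (x - w) - ?d x) + norm (g (x - w) - g x) \<partial>lborel)"
    proof (rule integral_mono)
      show "norm (f (x - w) - f x) \<le> norm (?d (x - w) - ?d x) + norm (g (x - w) - g x)" for x
        using norm_triangle_ineq[of "?d (x - w) - ?d x" "g (x - w) - g x"] by (simp add: algebra_simps)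
    qed (use f g(1) int in auto)
    also have "\<dots> = (\<integral>x. norm (?d (x - w) - ?d x) \<partial>lborel) + (\<integral>x. norm (g (x - w) - g x) \<partial>lborel)"
      using f g(1) int by (intro Bochner_Integration.integral_add) auto
    also have "\<dots> < e"
      using integral_norm_translation_le(1)[OF d, of w] g(2) elim by linarith
    finally show ?case by simp
  qed
qed

text \<open>For values in {0, 1} one has \<open>|a - b| = a + b - 2 a b\<close>, which reduces the
  claim to the measure of the intersection of U with its translate. There openness enters: a point
  of U stays in U under small shifts, so dominated convergence applies.\<close>

lemma tendsto_L1_translation_open:
  fixes U :: "'a::euclidean_space set" and c :: "'b::{banach, second_countable_topology}"
  assumes U: "open U" "emeasure lborel U < \<infinity>"
  shows "((\<lambda>w. \<integral>x. norm (indicator U (x - w) *\<^sub>R c - indicator U x *\<^sub>R c) \<partial>lborel) \<longlongrightarrow> 0) (at 0)"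
proof -
  have [measurable]: "U \<in> sets borel" using U by simp
  have intU: "integrable lborel (indicat_real U)" using U(2) by (intro integrable_real_indicator) auto
  have intUw: "integrable lborel (\<lambda>x. indicat_real U (x - w))" for w
    by (rule integral_norm_translation_le(2)[OF intU])
  have intUUw: "integrable lborel (\<lambda>x. indicat_real U x * indicat_real U (x - w))" for w
    by (rule Bochner_Integration.integrable_bound[OF intU]) (auto simp: indicator_def)
  have "norm (indicator U (x - w) *\<^sub>R c - indicator U x *\<^sub>R c)
      = norm c * (indicat_real U (x - w) + indicat_real U x - 2 * (indicat_real U x * indicat_real U (x - w)))" for x w
    by (simp add: indicator_def)
  moreover have "(\<integral>x. indicat_real U (x - w) \<partial>lborel) = (\<integral>x. indicat_real U x \<partial>lborel)" for w
    using integral_lborel_affine[of "indicat_real U" 1 "- w"] by simp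
  ultimately have eq: "(\<integral>x. norm (indicator U (x - w) *\<^sub>R c - indicator U x *\<^sub>R c) \<partial>lborel)
      = norm c * (2 * (\<integral>x. indicat_real U x \<partial>lborel) - 2 * (\<integral>x. indicat_real U x * indicat_real U (x - w) \<partial>lborel))" for w
    using intU intUw intUUw by simp
  have "((\<lambda>w. \<integral>x. indicat_real U x * indicat_real U (x - w) \<partial>lborel) \<longlongrightarrow> (\<integral>x. indicat_real U x \<partial>lborel)) (at 0)"
    unfolding tendsto_at_iff_sequentially o_def
  proof (intro allI impI)
    fix X :: "nat \<Rightarrow> 'a" assume X: "X \<longlonglongrightarrow> 0"
    show "(\<lambda>n. \<integral>x. indicat_real U x * indicat_real U (x - X n) \<partial>lborel) \<longlonglongrightarrow> (\<integral>x. indicat_real U x \<partial>lborel)"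
    proof (rule integral_dominated_convergence[where w = "indicat_real U"])
      show "AE x in lborel. (\<lambda>n. indicat_real U x * indicat_real U (x - X n)) \<longlonglongrightarrow> indicat_real U x" (is "AE x in _. ?B x")
      proof (rule AE_I2)
        fix x
        show "?B x"
        proof (cases "x \<in> U")
          case True
          have "(\<lambda>n. x - X n) \<longlonglongrightarrow> x" using tendsto_diff[OF tendsto_const X, of x] by simp
          then have "\<forall>\<^sub>F n in sequentially. x - X n \<in> U" using U(1) True topological_tendstoD by blast
          then show ?thesis using True by (intro tendsto_eventually) (auto elim!: eventually_mono)
        qed auto
      qed
      show "AE x in lborel. norm (indicat_real U x * indicat_real U (x - X n)) \<le> indicat_real U x" for n
        by (auto simp: indicator_def)
    qed (use intU in auto)
  qed
  from tendsto_mult[OF tendsto_const[of "norm c"] tendsto_diff[OF tendsto_const tendsto_mult[OF tendsto_const this]],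
      of "2 * (\<integral>x. indicat_real U x \<partial>lborel)" 2]
  show ?thesis unfolding eq by simp
qed

lemma tendsto_L1_translation:
  fixes f :: "'a::euclidean_space \<Rightarrow> 'b::{banach, second_countable_topology}"
  assumes "integrable lborel f"
  shows "((\<lambda>w. \<integral>x. norm (f (x - w) - f x) \<partial>lborel) \<longlongrightarrow> 0) (at 0)"
  using assms
proof (induction rule: integrable_induct)
  case (base A c)
  then have A: "A \<in> sets borel" "emeasure lborel A < \<infinity>" by auto
  show ?case
  proof (rule tendsto_L1_translation_approx)
    show "integrable lborel (\<lambda>x. indicator A x *\<^sub>R c)"
      using A by (intro integrable_scaleR_left integrable_real_indicator) auto
    fix e :: real assume "0 < e"
    \<comment> \<open>The 1 in the denominator covers c = 0. Outer regularity then replaces A by an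
      open set, for which the claim is known.\<close>
    define e' where "e' = e / (1 + norm c)"
    have e': "0 < e'" using \<open>0 < e\<close> by (simp add: e'_def add_pos_nonneg)
    obtain U where U: "open U" "A \<subseteq> U" "emeasure lborel (U - A) < e'"
      using outer_regular_lborel[OF A(1) e'] .
    have [measurable]: "U \<in> sets borel" "A \<in> sets borel" using U A by auto
    have "emeasure lborel U = emeasure lborel A + emeasure lborel (U - A)"
      using U A by (subst plus_emeasure) (auto simp: Un_absorb1)
    also have "\<dots> < \<infinity>" using A U(3) by (auto simp: less_top intro: less_trans)
    finally have fin: "emeasure lborel U < \<infinity>" .
    have "(\<integral>x. norm (indicator A x *\<^sub>R c - indicator U x *\<^sub>R c) \<partial>lborel) = (\<integral>x. norm c * indicat_real (U - A) x \<partial>lborel)"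
      using U(2) by (intro Bochner_Integration.integral_cong) (auto simp: indicator_def)
    also have "\<dots> = norm c * measure lborel (U - A)" by simp
    also have "\<dots> \<le> norm c * e'"
    proof (rule mult_left_mono)
      have "ennreal (measure lborel (U - A)) = emeasure lborel (U - A)"
        using order.strict_trans[OF U(3) ennreal_less_top]
        by (intro emeasure_eq_ennreal_measure[symmetric]) simp
      then have "ennreal (measure lborel (U - A)) \<le> ennreal e'" using U(3) by simp
      then show "measure lborel (U - A) \<le> e'" using e' by (simp add: ennreal_le_iff)
    qed simp
    also have "\<dots> < e"
      using \<open>0 < e\<close> unfolding e'_def times_divide_eq_right
      by (subst pos_divide_less_eq) (auto simp: add_pos_nonneg algebra_simps)
    finally show "\<exists>g. integrable lborel g \<and> (\<integral>x. norm (indicator A x *\<^sub>R c - g x) \<partial>lborel) < e \<and>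
        ((\<lambda>w. \<integral>x. norm (g (x - w) - g x) \<partial>lborel) \<longlongrightarrow> 0) (at 0)"
      using tendsto_L1_translation_open[OF U(1) fin, of c] fin
      by (intro exI[of _ "\<lambda>x. indicator U x *\<^sub>R c"] conjI integrable_scaleR_left integrable_real_indicator) auto
  qed
next
  case (add f g)
  note int = add.hyps integral_norm_translation_le(2)[OF add.hyps(1)] integral_norm_translation_le(2)[OF add.hyps(2)]
  have "(\<integral>x. norm (f (x - w) + g (x - w) - (f x + g x)) \<partial>lborel)
      \<le> (\<integral>x. norm (f (x - w) - f x) \<partial>lborel) + (\<integral>x. norm (g (x - w) - g x) \<partial>lborel)" for w
  proof -
    have "(\<integral>x. norm (f (x - w) + g (x - w) - (f x + g x)) \<partial>lborel)
        \<le> (\<integral>x. norm (f (x - w) - f x) + norm (g (x - w) - g x) \<partial>lborel)"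
    proof (rule integral_mono)
      show "norm (f (x - w) + g (x - w) - (f x + g x)) \<le> norm (f (x - w) - f x) + norm (g (x - w) - g x)" for x
        using norm_triangle_ineq[of "f (x - w) - f x" "g (x - w) - g x"] by (simp add: algebra_simps)
    qed (use int in auto)
    then show ?thesis using int by simp
  qed
  then show ?case
    by (intro tendsto_sandwich[OF _ _ tendsto_const tendsto_add_zero[OF add.IH]] always_eventually allI) auto
next
  case (lim f s)
  show ?case
  proof (rule tendsto_L1_translation_approx[OF lim.hyps(4)])
    fix e :: real assume "0 < e"
    have [measurable]: "f \<in> borel_measurable borel" "s i \<in> borel_measurable borel" for i
      using lim.hyps(1)[of i] lim.hyps(4) by auto
    have "(\<lambda>i. \<integral>x. norm (f x - s i x) \<partial>lborel) \<longlonglongrightarrow> (\<integral>x. norm (f x - f x) \<partial>lborel)"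
    proof (rule integral_dominated_convergence[where w = "\<lambda>x. 3 * norm (f x)"])
      show "AE x in lborel. norm (norm (f x - s i x)) \<le> 3 * norm (f x)" (is "AE x in _. ?B x") for i
      proof (rule AE_I2)
        fix x show "?B x"
          using lim.hyps(3)[of x i] norm_triangle_ineq4[of "f x" "s i x"] by simp
      qed
      show "AE x in lborel. (\<lambda>i. norm (f x - s i x)) \<longlonglongrightarrow> norm (f x - f x)"
        using lim.hyps(2) by (intro AE_I2 tendsto_intros) simp
    qed (use lim.hyps in auto)
    then have "(\<lambda>i. \<integral>x. norm (f x - s i x) \<partial>lborel) \<longlonglongrightarrow> 0" by simp
    from order_tendstoD(2)[OF this \<open>0 < e\<close>]
    have "\<forall>\<^sub>F i in sequentially. (\<integral>x. norm (f x - s i x) \<partial>lborel) < e" .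
    then obtain i where "(\<integral>x. norm (f x - s i x) \<partial>lborel) < e"
      by (auto simp: eventually_sequentially)
    then show "\<exists>g. integrable lborel g \<and> (\<integral>x. norm (f x - g x) \<partial>lborel) < e \<and>
        ((\<lambda>w. \<integral>x. norm (g (x - w) - g x) \<partial>lborel) \<longlongrightarrow> 0) (at 0)"
      using lim.hyps(1) lim.IH by blast
  qed
qed

section \<open>Norm and truncation of square-integrable functions\<close>

lemma L2_D: "f \<in> L2 \<Longrightarrow> f \<in> borel_measurable borel" "f \<in> L2 \<Longrightarrow> integrable lborel (\<lambda>x. (cmod (f x))\<^sup>2)"
  by (auto simp: L2_def)

lemma L2_bound:
  assumes "f \<in> borel_measurable borel" "integrable lborel g" "\<And>x. (cmod (f x))\<^sup>2 \<le> g x"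
  shows "f \<in> L2"
  unfolding L2_def using assms
  by (auto intro!: Bochner_Integration.integrable_bound[OF assms(2)] AE_I2 order_trans[OF assms(3)])

lemma cmod_add_sq_le:
  assumes "0 < \<eta>"
  shows "(cmod (a + b))\<^sup>2 \<le> (1 + \<eta>) * (cmod a)\<^sup>2 + (1 + 1 / \<eta>) * (cmod b)\<^sup>2"
proof -
  have "0 \<le> (sqrt \<eta> * cmod a - cmod b / sqrt \<eta>)\<^sup>2" by simp
  then have "2 * cmod a * cmod b \<le> \<eta> * (cmod a)\<^sup>2 + (cmod b)\<^sup>2 / \<eta>"
    using assms by (simp add: power2_diff power_mult_distrib power_divide)
  moreover have "(cmod (a + b))\<^sup>2 \<le> (cmod a + cmod b)\<^sup>2"
    by (intro power_mono norm_triangle_ineq) simp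
  ultimately show ?thesis by (simp add: power2_sum algebra_simps)
qed

lemma L2_add: "f \<in> L2 \<Longrightarrow> g \<in> L2 \<Longrightarrow> (\<lambda>x. f x + g x) \<in> L2"
  by (rule L2_bound[where g = "\<lambda>x. 2 * (cmod (f x))\<^sup>2 + 2 * (cmod (g x))\<^sup>2"])
    (use cmod_add_sq_le[of 1] in \<open>auto simp: L2_def\<close>)

lemma L2_mult: "f \<in> L2 \<Longrightarrow> (\<lambda>x. c * f x) \<in> L2"
  by (auto simp: L2_def norm_mult power_mult_distrib)

lemma L2_diff: "f \<in> L2 \<Longrightarrow> g \<in> L2 \<Longrightarrow> (\<lambda>x. f x - g x) \<in> L2"
  using L2_add[of f "\<lambda>x. (-1) * g x"] L2_mult[of g "-1"] by simp

lemma L2norm_nonneg [simp]: "0 \<le> L2norm f"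
  by (simp add: L2norm_def)

lemma L2norm_sq: "(L2norm f)\<^sup>2 = (\<integral>x. (cmod (f x))\<^sup>2 \<partial>lborel)"
  by (simp add: L2norm_def)

lemma L2norm_mult: "L2norm (\<lambda>x. c * f x) = cmod c * L2norm f"
  by (simp add: L2norm_def norm_mult power_mult_distrib real_sqrt_mult)

lemma L2norm_minus_commute: "L2norm (\<lambda>x. f x - g x) = L2norm (\<lambda>x. g x - f x)"
  unfolding L2norm_def by (subst norm_minus_commute) (rule refl)

lemma nn_integral_L2: "f \<in> L2 \<Longrightarrow> (\<integral>\<^sup>+x. ennreal ((cmod (f x))\<^sup>2) \<partial>lborel) = ennreal ((L2norm f)\<^sup>2)"
  unfolding L2norm_sq by (rule nn_integral_eq_integral[OF L2_D(2)]) auto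

text \<open>Minkowski's inequality from the parametric bound \<open>cmod_add_sq_le\<close>: the
  optimal parameter is the quotient of the two norms, for which the right side becomes the square of
  their sum. Both norms are first enlarged by e so that the quotient is defined and
  positive.\<close>

lemma L2norm_add_le:
  assumes f: "f \<in> L2" and g: "g \<in> L2"
  shows "L2norm (\<lambda>x. f x + g x) \<le> L2norm f + L2norm g"
proof -
  have *: "(L2norm (\<lambda>x. f x + g x))\<^sup>2 \<le> (1 + \<eta>) * (L2norm f)\<^sup>2 + (1 + 1 / \<eta>) * (L2norm g)\<^sup>2" if "0 < \<eta>" for \<eta>
  proof -
    have "(\<integral>x. (cmod (f x + g x))\<^sup>2 \<partial>lborel) \<le> (\<integral>x. (1 + \<eta>) * (cmod (f x))\<^sup>2 + (1 + 1 / \<eta>) * (cmod (g x))\<^sup>2 \<partial>lborel)"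
      using L2_D[OF L2_add[OF f g]] L2_D[OF f] L2_D[OF g] cmod_add_sq_le[OF that]
      by (intro integral_mono) auto
    then show ?thesis using L2_D[OF f] L2_D[OF g] by (simp add: L2norm_sq)
  qed
  have "(L2norm (\<lambda>x. f x + g x))\<^sup>2 \<le> (L2norm f + L2norm g + 2 * e)\<^sup>2" if "0 < e" for e
  proof -
    let ?a = "L2norm f + e" and ?b = "L2norm g + e"
    have ab: "0 < ?a" "0 < ?b" using that by (simp_all add: add_nonneg_pos)
    have "(L2norm (\<lambda>x. f x + g x))\<^sup>2 \<le> (1 + ?b / ?a) * (L2norm f)\<^sup>2 + (1 + 1 / (?b / ?a)) * (L2norm g)\<^sup>2"
      using ab by (intro *) simp
    also have "\<dots> \<le> (1 + ?b / ?a) * ?a\<^sup>2 + (1 + 1 / (?b / ?a)) * ?b\<^sup>2"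
      using ab that by (intro add_mono mult_left_mono power_mono add_nonneg_nonneg) auto
    also have "\<dots> = (?a + ?b)\<^sup>2"
    proof -
      have "(1 + b / a) * a\<^sup>2 + (1 + 1 / (b / a)) * b\<^sup>2 = (a + b)\<^sup>2" if "0 < a" "0 < b" for a b :: real
        using that by (simp add: field_simps power2_eq_square)
      from this[OF ab] show ?thesis .
    qed
    finally show ?thesis by (simp add: algebra_simps)
  qed
  then have le: "L2norm (\<lambda>x. f x + g x) \<le> L2norm f + L2norm g + 2 * e" if "0 < e" for e
    by (rule power2_le_imp_le) (use that in auto)
  show ?thesis
  proof (rule field_le_epsilon)
    show "L2norm (\<lambda>x. f x + g x) \<le> L2norm f + L2norm g + e" if "0 < e" for e
      using le[of "e / 2"] that by simp
  qed
qed

lemma L2norm_diff_abs_le: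
  assumes "f \<in> L2" "g \<in> L2"
  shows "\<bar>L2norm f - L2norm g\<bar> \<le> L2norm (\<lambda>x. f x - g x)"
  using L2norm_add_le[OF L2_diff[OF assms] assms(2)] L2norm_add_le[OF L2_diff[OF assms(2,1)] assms(1)]
  unfolding L2norm_minus_commute[of g f] by (simp add: abs_le_iff)

lemma tendsto_L2norm:
  assumes "\<And>n. F n \<in> L2" "G \<in> L2" "((\<lambda>n. L2norm (\<lambda>x. F n x - G x)) \<longlongrightarrow> 0) \<A>"
  shows "((\<lambda>n. L2norm (F n)) \<longlongrightarrow> L2norm G) \<A>"
proof -
  have "((\<lambda>n. L2norm (F n) - L2norm G) \<longlongrightarrow> 0) \<A>"
    by (rule Lim_null_comparison[OF _ assms(3)]) (use L2norm_diff_abs_le[OF assms(1,2)] in auto)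
  then show ?thesis by (rule LIM_zero_cancel)
qed

lemma L2norm_eq_0_imp_AE:
  assumes "f \<in> L2" "L2norm f = 0"
  shows "AE x in lborel. f x = 0"
proof -
  have "(\<integral>x. (cmod (f x))\<^sup>2 \<partial>lborel) = 0" using assms(2) L2norm_sq[of f] by simp
  then show ?thesis using L2_D[OF assms(1)] by (subst (asm) integral_nonneg_eq_0_iff_AE) auto
qed

lemma L2norm_cong_AE:
  assumes "f \<in> borel_measurable borel" "g \<in> borel_measurable borel" "AE x in lborel. f x = g x"
  shows "L2norm f = L2norm g"
  unfolding L2norm_def using assms by (intro arg_cong[where f = sqrt] integral_cong_AE) auto

lemma L2_cong_AE:
  assumes "f \<in> L2" "g \<in> borel_measurable borel" "AE x in lborel. f x = g x"
  shows "g \<in> L2"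
proof -
  have "AE x in lborel. (cmod (f x))\<^sup>2 = (cmod (g x))\<^sup>2" using assms(3) by eventually_elim simp
  then have "integrable lborel (\<lambda>x. (cmod (f x))\<^sup>2) \<longleftrightarrow> integrable lborel (\<lambda>x. (cmod (g x))\<^sup>2)"
    using L2_D(1)[OF assms(1)] assms(2) by (intro integrable_cong_AE) auto
  then show ?thesis using assms by (simp add: L2_def)
qed

text \<open>The index is real so that one statement serves truncation to balls as well as truncation
  by the size of the values.\<close>

lemma tendsto_L2_truncation:
  assumes f: "f \<in> L2" and [measurable]: "\<And>n. A n \<in> sets borel"
    and A: "\<And>x. \<forall>\<^sub>F n::real in at_top. x \<in> A n"
  shows "((\<lambda>n. L2norm (\<lambda>x. indicator (A n) x * f x - f x)) \<longlongrightarrow> 0) at_top"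
proof -
  have [measurable]: "f \<in> borel_measurable borel" using f by (rule L2_D)
  have "((\<lambda>n. \<integral>x. (cmod (indicator (A n) x * f x - f x))\<^sup>2 \<partial>lborel) \<longlongrightarrow> (\<integral>(x::'a). 0 \<partial>lborel)) at_top"
  proof (rule integral_dominated_convergence_at_top[where w = "\<lambda>x. (cmod (f x))\<^sup>2"])
    show "AE x in lborel. ((\<lambda>n. (cmod (indicator (A n) x * f x - f x))\<^sup>2) \<longlongrightarrow> 0) at_top" (is "AE x in _. ?B x")
    proof (rule AE_I2)
      fix x show "?B x"
        by (intro tendsto_eventually eventually_mono[OF A[of x]]) simp
    qed
    show "\<forall>\<^sub>F n in at_top. AE x in lborel. norm ((cmod (indicator (A n) x * f x - f x))\<^sup>2) \<le> (cmod (f x))\<^sup>2"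
      by (auto simp: indicator_def)
  qed (use L2_D[OF f] in auto)
  from tendsto_real_sqrt[OF this] show ?thesis by (simp add: L2norm_def)
qed

section \<open>The Plancherel theorem\<close>

lemma borel_measurable_cnj [measurable (raw)]:
  assumes "f \<in> borel_measurable M"
  shows "(\<lambda>x. cnj (f x)) \<in> borel_measurable M"
  by (rule borel_measurable_continuous_on[OF _ assms]) (intro continuous_intros)

lemma integrable_pair_mult:
  fixes f :: "'a::euclidean_space \<Rightarrow> complex" and g :: "'b::euclidean_space \<Rightarrow> complex"
  assumes f: "integrable lborel f" and g: "integrable lborel g"
  shows "integrable (lborel \<Otimes>\<^sub>M lborel) (\<lambda>(x, y). f x * g y)"
proof (rule lborel_pair.Fubini_integrable)
  have [measurable]: "f \<in> borel_measurable borel" "g \<in> borel_measurable borel" using f g by auto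
  show "(\<lambda>(x, y). f x * g y) \<in> borel_measurable (lborel \<Otimes>\<^sub>M lborel)" by measurable
  show "integrable lborel (\<lambda>x. \<integral>y. norm (case (x, y) of (x, y) \<Rightarrow> f x * g y) \<partial>lborel)"
    using f by (simp add: norm_mult)
  show "AE x in lborel. integrable lborel (\<lambda>y. case (x, y) of (x, y) \<Rightarrow> f x * g y)"
    using g by simp
qed

lemma borel_measurable_fourier [measurable]:
  assumes [measurable]: "f \<in> borel_measurable borel"
  shows "fourier f \<in> borel_measurable borel"
  unfolding fourier_def[abs_def] by measurable

lemma norm_exp_imag [simp]: "cmod (exp (- (\<i> * complex_of_real r))) = 1" "cmod (exp (\<i> * complex_of_real r)) = 1"
  by simp_all

lemma integrable_fourier_integrand:
  assumes "integrable lborel f"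
  shows "integrable lborel (\<lambda>x. f x * exp (- \<i> * complex_of_real (x \<bullet> \<xi>)))"
proof -
  have [measurable]: "f \<in> borel_measurable borel" using assms by auto
  show ?thesis
    by (rule Bochner_Integration.integrable_bound[OF assms]) (auto simp: norm_mult)
qed

lemma norm_fourier_le: "cmod (fourier f \<xi>) \<le> (\<integral>x. cmod (f x) \<partial>lborel)"
  unfolding fourier_def
  by (rule order_trans[OF integral_norm_bound]) (simp add: norm_mult)

lemma fourier_add:
  assumes "integrable lborel f" "integrable lborel g"
  shows "fourier (\<lambda>x. f x + g x) \<xi> = fourier f \<xi> + fourier g \<xi>"
  unfolding fourier_def distrib_right using assms by (intro Bochner_Integration.integral_add integrable_fourier_integrand)

lemma fourier_mult_left: "fourier (\<lambda>x. c * f x) \<xi> = c * fourier f \<xi>"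
  unfolding fourier_def by (simp add: mult.assoc)

lemma fourier_diff:
  assumes "integrable lborel f" "integrable lborel g"
  shows "fourier (\<lambda>x. f x - g x) \<xi> = fourier f \<xi> - fourier g \<xi>"
  using fourier_add[of f "\<lambda>x. - g x" \<xi>] fourier_mult_left[of "-1" g \<xi>] assms by simp

lemma fourier_multiplication_formula:
  fixes f g :: "real ^ 'n \<Rightarrow> complex"
  assumes f: "integrable lborel f" and g: "integrable lborel g"
  shows "(\<integral>\<xi>. fourier f \<xi> * g \<xi> \<partial>lborel) = (\<integral>x. f x * fourier g x \<partial>lborel)"
proof -
  have [measurable]: "f \<in> borel_measurable borel" "g \<in> borel_measurable borel" using f g by auto
  have "integrable (lborel \<Otimes>\<^sub>M lborel) (\<lambda>(x, \<xi>). f x * g \<xi> * exp (- \<i> * complex_of_real (x \<bullet> \<xi>)))"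
    by (rule Bochner_Integration.integrable_bound[OF integrable_pair_mult[OF f g]]) (auto simp: norm_mult)
  from lborel_pair.Fubini_integral[OF this]
  have "(\<integral>\<xi>. (\<integral>x. f x * g \<xi> * exp (- \<i> * complex_of_real (x \<bullet> \<xi>)) \<partial>lborel) \<partial>lborel)
      = (\<integral>x. (\<integral>\<xi>. f x * g \<xi> * exp (- \<i> * complex_of_real (x \<bullet> \<xi>)) \<partial>lborel) \<partial>lborel)" .
  moreover have "(\<integral>x. f x * g \<xi> * exp (- \<i> * complex_of_real (x \<bullet> \<xi>)) \<partial>lborel) = fourier f \<xi> * g \<xi>" for \<xi>
  proof -
    have "(\<integral>x. f x * g \<xi> * exp (- \<i> * complex_of_real (x \<bullet> \<xi>)) \<partial>lborel)
        = (\<integral>x. (f x * exp (- \<i> * complex_of_real (x \<bullet> \<xi>))) * g \<xi> \<partial>lborel)"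
      by (intro Bochner_Integration.integral_cong) auto
    then show ?thesis by (simp add: fourier_def)
  qed
  moreover have "(\<integral>\<xi>. f x * g \<xi> * exp (- \<i> * complex_of_real (x \<bullet> \<xi>)) \<partial>lborel) = f x * fourier g x" for x
    unfolding fourier_def mult.assoc by (simp add: inner_commute)
  ultimately show ?thesis by simp
qed

text \<open>This is \<open>(2\<pi>)\<^sup>d\<close>, but only its positivity is needed.\<close>

definition plancherel_const :: "'a::euclidean_space itself \<Rightarrow> real" where
  "plancherel_const _ = 2 ^ DIM('a) * (\<integral>(x::'a). exp (- (norm x)\<^sup>2) \<partial>lborel)\<^sup>2"

lemma gaussian_integral_pos: "0 < (\<integral>(x::'a::euclidean_space). exp (- (norm x)\<^sup>2) \<partial>lborel)"
proof -
  have int: "integrable lborel (\<lambda>x::'a. exp (- (norm x)\<^sup>2))"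
    using integrable_gaussian[of 1, where 'a = 'a] by simp
  have "(\<integral>(x::'a). exp (- (norm x)\<^sup>2) \<partial>lborel) \<noteq> 0"
    using integral_nonneg_eq_0_iff_AE[OF int] by (simp add: trivial_limit_def[symmetric] ae_filter_eq_bot_iff)
  moreover have "0 \<le> (\<integral>(x::'a). exp (- (norm x)\<^sup>2) \<partial>lborel)" by simp
  ultimately show ?thesis by linarith
qed

lemma plancherel_const_pos: "0 < plancherel_const TYPE('a::euclidean_space)"
  unfolding plancherel_const_def using gaussian_integral_pos[where 'a = 'a] by simp

text \<open>A Gaussian weight makes the squared transform integrable and accessible to the
  multiplication formula. The rate \<open>\<delta>^2 / 4\<close> is chosen because the transform of
  the weight is then a multiple of \<open>exp (-|y|^2 / \<delta>^2)\<close>; rescaling by \<delta>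
  turns the right side into an average of the autocorrelation of f at displacements
  \<open>\<delta> y\<close> against a fixed Gaussian.\<close>

lemma fourier_gaussian_regularization:
  fixes f :: "real ^ 'n \<Rightarrow> complex"
  assumes f: "integrable lborel f" and f_bound: "\<And>x. cmod (f x) \<le> B" and \<delta>: "0 < \<delta>"
  shows "complex_of_real (\<integral>\<xi>. (cmod (fourier f \<xi>))\<^sup>2 * rgauss (\<delta>\<^sup>2 / 4) \<xi> \<partial>lborel)
    = complex_of_real (2 ^ CARD('n) * (\<integral>(x::real^'n). exp (- (norm x)\<^sup>2) \<partial>lborel))
      * (\<integral>y. (\<integral>x. f x * cnj (f (x - \<delta> *\<^sub>R y)) \<partial>lborel) * complex_of_real (exp (- (norm y)\<^sup>2)) \<partial>lborel)"
    (is "?L = complex_of_real ?M2 * ?R")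
proof -
  have [measurable]: "f \<in> borel_measurable borel" using f by auto
  define s where "s = complex_of_real (\<delta>\<^sup>2 / 4)"
  have s: "0 < Re s" using \<delta> by (simp add: s_def)
  define w where "w \<xi> = cgauss s \<xi>" for \<xi> :: "real ^ 'n"
  have w_real: "w \<xi> = complex_of_real (rgauss (\<delta>\<^sup>2 / 4) \<xi>)" for \<xi>
    by (simp add: w_def s_def flip: exp_of_real)
  have [measurable]: "w \<in> borel_measurable borel" unfolding w_def by measurable
  have int_w: "integrable lborel w" unfolding w_def by (rule integrable_complex_gaussian[OF s])
  let ?K = "\<integral>x. cmod (f x) \<partial>lborel"
  have int_fw: "integrable lborel (\<lambda>\<xi>. cnj (fourier f \<xi>) * w \<xi>)"
  proof (rule Bochner_Integration.integrable_bound)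
    show "integrable lborel (\<lambda>\<xi>. complex_of_real ?K * w \<xi>)" using int_w by simp
    show "AE \<xi> in lborel. cmod (cnj (fourier f \<xi>) * w \<xi>) \<le> cmod (complex_of_real ?K * w \<xi>)"
      using norm_fourier_le[of f] by (intro AE_I2) (auto simp: norm_mult intro!: mult_right_mono)
  qed measurable
  have M: "(\<integral>x. w x \<partial>lborel) * complex_of_real (\<delta> ^ CARD('n)) = complex_of_real ?M2"
  proof -
    have "(\<integral>(x::real^'n). exp (- (norm x)\<^sup>2) \<partial>lborel) = (\<delta> / 2) ^ CARD('n) * (\<integral>(x::real^'n). rgauss (\<delta>\<^sup>2 / 4) x \<partial>lborel)"
      using integral_lborel_affine[of "\<lambda>x::real^'n. exp (- (norm x)\<^sup>2)" "\<delta> / 2" 0] \<delta>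
      by (simp add: power_mult_distrib power_divide)
    then show ?thesis unfolding w_real integral_complex_of_real
      by (simp add: power_divide flip: of_real_mult of_real_power)
  qed
  have inner: "fourier (\<lambda>\<xi>. cnj (fourier f \<xi>) * w \<xi>) x
      = complex_of_real ?M2 * (\<integral>y. cnj (f (x - \<delta> *\<^sub>R y)) * complex_of_real (exp (- (norm y)\<^sup>2)) \<partial>lborel)" for x
  proof -
    \<comment> \<open>Modulation by this character moves the transform of the weight to the centre
      x, so the multiplication formula produces an average of f around x.\<close>
    define h where "h \<xi> = w \<xi> * exp (\<i> * complex_of_real (\<xi> \<bullet> x))" for \<xi>
    have [measurable]: "h \<in> borel_measurable borel" unfolding h_def by measurable
    have int_h: "integrable lborel h"
      by (rule Bochner_Integration.integrable_bound[OF int_w]) (auto simp: h_def norm_mult)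
    have fh: "fourier h y = exp (- (complex_of_real ((norm (y - x))\<^sup>2) / (4 * s))) * (\<integral>x. w x \<partial>lborel)" for y
    proof -
      have "fourier h y = (\<integral>\<xi>. w \<xi> * exp (- \<i> * complex_of_real (\<xi> \<bullet> (y - x))) \<partial>lborel)"
        unfolding fourier_def h_def mult.assoc exp_add[symmetric]
        by (simp add: inner_simps algebra_simps)
      then show ?thesis unfolding w_def using gaussian_fourier_integral[OF s, of "y - x"] by simp
    qed
    have "fourier (\<lambda>\<xi>. cnj (fourier f \<xi>) * w \<xi>) x = cnj (\<integral>\<xi>. fourier f \<xi> * h \<xi> \<partial>lborel)"
      unfolding Bochner_Integration.integral_cnj[symmetric] unfolding fourier_def[of "\<lambda>\<xi>. cnj (fourier f \<xi>) * w \<xi>"]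
      by (intro Bochner_Integration.integral_cong) (auto simp: h_def w_real exp_cnj)
    also have "(\<integral>\<xi>. fourier f \<xi> * h \<xi> \<partial>lborel) = (\<integral>y. f y * fourier h y \<partial>lborel)"
      by (rule fourier_multiplication_formula[OF f int_h])
    also have "\<dots> = complex_of_real (\<delta> ^ CARD('n)) * (\<integral>y. f (x + (- \<delta>) *\<^sub>R y) * fourier h (x + (- \<delta>) *\<^sub>R y) \<partial>lborel)"
      using integral_lborel_affine[of "\<lambda>y. f y * fourier h y" "- \<delta>" x] \<delta> by (simp add: scaleR_conv_of_real)
    also have "\<dots> = complex_of_real (\<delta> ^ CARD('n)) * (\<integral>y. (f (x - \<delta> *\<^sub>R y) * complex_of_real (exp (- (norm y)\<^sup>2))) * (\<integral>x. w x \<partial>lborel) \<partial>lborel)"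
      using \<delta> unfolding fh
      by (simp add: s_def power_mult_distrib mult_ac flip: exp_of_real)
    also have "\<dots> = complex_of_real ?M2 * (\<integral>y. f (x - \<delta> *\<^sub>R y) * complex_of_real (exp (- (norm y)\<^sup>2)) \<partial>lborel)"
      unfolding M[symmetric] by simp
    finally show ?thesis by (simp flip: Bochner_Integration.integral_cnj)
  qed
  have "?L = (\<integral>\<xi>. fourier f \<xi> * (cnj (fourier f \<xi>) * w \<xi>) \<partial>lborel)"
    unfolding integral_complex_of_real[symmetric]
    by (intro Bochner_Integration.integral_cong) (simp_all add: w_real complex_norm_square mult.assoc del: of_real_power)
  also have "\<dots> = (\<integral>x. f x * fourier (\<lambda>\<xi>. cnj (fourier f \<xi>) * w \<xi>) x \<partial>lborel)"
    by (rule fourier_multiplication_formula[OF f int_fw])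
  also have "\<dots> = complex_of_real ?M2 * (\<integral>x. (\<integral>y. f x * cnj (f (x - \<delta> *\<^sub>R y)) * complex_of_real (exp (- (norm y)\<^sup>2)) \<partial>lborel) \<partial>lborel)"
  proof -
    have eq: "f x * (complex_of_real ?M2 * (\<integral>y. cnj (f (x - \<delta> *\<^sub>R y)) * complex_of_real (exp (- (norm y)\<^sup>2)) \<partial>lborel))
        = complex_of_real ?M2 * (\<integral>y. f x * cnj (f (x - \<delta> *\<^sub>R y)) * complex_of_real (exp (- (norm y)\<^sup>2)) \<partial>lborel)" for x
      unfolding mult.assoc[of "f x"] integral_mult_right_zero by (rule mult.left_commute)
    show ?thesis unfolding inner eq integral_mult_right_zero ..
  qed
  also have "(\<integral>x. (\<integral>y. f x * cnj (f (x - \<delta> *\<^sub>R y)) * complex_of_real (exp (- (norm y)\<^sup>2)) \<partial>lborel) \<partial>lborel)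
      = (\<integral>y. (\<integral>x. f x * cnj (f (x - \<delta> *\<^sub>R y)) * complex_of_real (exp (- (norm y)\<^sup>2)) \<partial>lborel) \<partial>lborel)"
  proof (rule lborel_pair.Fubini_integral[symmetric])
    have "integrable lborel (\<lambda>y::real^'n. complex_of_real (B * exp (- (norm y)\<^sup>2)))"
      using integrable_gaussian[of 1, where 'a = "real^'n"] by (intro integrable_of_real integrable_mult_right) simp
    from integrable_pair_mult[OF f this]
    show "integrable (lborel \<Otimes>\<^sub>M lborel) (\<lambda>(x, y). f x * cnj (f (x - \<delta> *\<^sub>R y)) * complex_of_real (exp (- (norm y)\<^sup>2)))"
    proof (rule Bochner_Integration.integrable_bound)
      show "AE z in lborel \<Otimes>\<^sub>M lborel. norm (case z of (x, y) \<Rightarrow> f x * cnj (f (x - \<delta> *\<^sub>R y)) * complex_of_real (exp (- (norm y)\<^sup>2)))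
          \<le> norm (case z of (x, y) \<Rightarrow> f x * complex_of_real (B * exp (- (norm y)\<^sup>2)))"
      proof (rule AE_I2, clarify)
        fix x y :: "real ^ 'n"
        have "cmod (f (x - \<delta> *\<^sub>R y)) \<le> \<bar>B\<bar>" using f_bound[of "x - \<delta> *\<^sub>R y"] by linarith
        then show "norm (f x * cnj (f (x - \<delta> *\<^sub>R y)) * complex_of_real (exp (- (norm y)\<^sup>2)))
            \<le> norm (f x * complex_of_real (B * exp (- (norm y)\<^sup>2)))"
          unfolding norm_mult norm_of_real complex_mod_cnj abs_mult mult.assoc
          by (intro mult_left_mono mult_right_mono) auto
      qed
    qed measurable
  qed
  also have "\<dots> = ?R" by simp
  finally show ?thesis .
qed

lemma L2_if_bounded_integrable:
  assumes f: "integrable lborel f" and f_bound: "\<And>x. cmod (f x) \<le> B"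
  shows "f \<in> L2"
proof (rule L2_bound)
  show "integrable lborel (\<lambda>x. B * cmod (f x))" using f by simp
  show "(cmod (f x))\<^sup>2 \<le> B * cmod (f x)" for x
    unfolding power2_eq_square using f_bound by (intro mult_right_mono) auto
qed (use f in auto)

text \<open>The regularisation is removed by \<delta> \<rightarrow> 0. On the frequency side the
  weights increase to 1, and monotone convergence yields square integrability and the value of the
  norm at once. On the other side the autocorrelation R is continuous at 0; boundedness of f is what
  turns continuity of translation in \<open>L^1\<close> into continuity of R.\<close>

lemma plancherel_bounded:
  fixes f :: "real ^ 'n \<Rightarrow> complex"
  assumes f: "integrable lborel f" and f_bound: "\<And>x. cmod (f x) \<le> B"
  shows "fourier f \<in> L2" and "(L2norm (fourier f))\<^sup>2 = plancherel_const TYPE(real^'n) * (L2norm f)\<^sup>2"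
proof -
  have [measurable]: "f \<in> borel_measurable borel" using f by auto
  let ?M1 = "\<integral>(x::real^'n). exp (- (norm x)\<^sup>2) \<partial>lborel"
  define R where "R z = (\<integral>x. f x * cnj (f (x - z)) \<partial>lborel)" for z
  have [measurable]: "R \<in> borel_measurable borel" unfolding R_def by measurable
  have B: "0 \<le> B" using f_bound[of 0] norm_ge_zero order_trans by blast
  have int: "integrable lborel (\<lambda>x. f x * cnj (f (x - z)))" for z
  proof (rule Bochner_Integration.integrable_bound)
    show "integrable lborel (\<lambda>x. complex_of_real B * f x)" using f by simp
    show "AE x in lborel. norm (f x * cnj (f (x - z))) \<le> norm (complex_of_real B * f x)"
      unfolding norm_mult norm_of_real complex_mod_cnj abs_of_nonneg[OF B] mult.commute[of B]
      by (intro AE_I2 mult_left_mono f_bound norm_ge_zero)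
  qed measurable
  have R0: "R 0 = complex_of_real ((L2norm f)\<^sup>2)"
    unfolding R_def L2norm_sq integral_complex_of_real[symmetric] by (simp add: complex_norm_square del: of_real_power)
  have R_cont: "(R \<longlongrightarrow> R 0) (at 0)"
  proof (rule LIM_zero_cancel, rule Lim_null_comparison)
    show "((\<lambda>w. B * (\<integral>x. cmod (f (x - w) - f x) \<partial>lborel)) \<longlongrightarrow> 0) (at 0)"
      using tendsto_mult_right_zero[OF tendsto_L1_translation[OF f]] .
    show "\<forall>\<^sub>F w in at 0. norm (R w - R 0) \<le> B * (\<integral>x. cmod (f (x - w) - f x) \<partial>lborel)"
    proof (intro always_eventually allI)
      fix w
      have "R w - R 0 = (\<integral>x. f x * cnj (f (x - w)) - f x * cnj (f (x - 0)) \<partial>lborel)"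
        unfolding R_def using int by (intro Bochner_Integration.integral_diff[symmetric])
      also have "norm \<dots> \<le> (\<integral>x. B * cmod (f (x - w) - f x) \<partial>lborel)"
      proof (rule order_trans[OF integral_norm_bound], rule integral_mono)
        show "integrable lborel (\<lambda>x. norm (f x * cnj (f (x - w)) - f x * cnj (f (x - 0))))"
          using int by (intro integrable_norm Bochner_Integration.integrable_diff)
        show "integrable lborel (\<lambda>x. B * cmod (f (x - w) - f x))"
          using f integral_norm_translation_le(2)[OF f] by simp
        fix x
        have "norm (f x * cnj (f (x - w)) - f x * cnj (f (x - 0))) = cmod (f x) * cmod (f (x - w) - f x)"
          unfolding right_diff_distrib[symmetric] complex_cnj_diff[symmetric] norm_mult complex_mod_cnj diff_zero ..
        also have "\<dots> \<le> B * cmod (f (x - w) - f x)" by (intro mult_right_mono f_bound) simp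
        finally show "norm (f x * cnj (f (x - w)) - f x * cnj (f (x - 0))) \<le> B * cmod (f (x - w) - f x)" .
      qed
      finally show "norm (R w - R 0) \<le> B * (\<integral>x. cmod (f (x - w) - f x) \<partial>lborel)" by simp
    qed
  qed
  have R_bound: "cmod (R z) \<le> B * (\<integral>x. cmod (f x) \<partial>lborel)" for z
  proof -
    have "cmod (R z) \<le> (\<integral>x. B * cmod (f x) \<partial>lborel)"
      unfolding R_def
    proof (rule order_trans[OF integral_norm_bound], rule integral_mono)
      show "norm (f x * cnj (f (x - z))) \<le> B * cmod (f x)" for x
        using mult_right_mono[OF f_bound[of "x - z"], of "cmod (f x)"] by (simp add: norm_mult mult.commute)
    qed (use f int in auto)
    then show ?thesis by simp
  qed
  define \<delta> where "\<delta> n = 1 / real (Suc n)" for n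
  have \<delta>: "\<delta> n > 0" "\<delta> \<longlonglongrightarrow> 0" for n
    using LIMSEQ_inverse_real_of_nat by (auto simp: \<delta>_def[abs_def] inverse_eq_divide)
  have lim1: "(\<lambda>n. \<integral>y. R (\<delta> n *\<^sub>R y) * complex_of_real (exp (- (norm y)\<^sup>2)) \<partial>lborel)
      \<longlonglongrightarrow> (\<integral>(y::real^'n). R 0 * complex_of_real (exp (- (norm y)\<^sup>2)) \<partial>lborel)"
  proof (rule integral_dominated_convergence[where w = "\<lambda>y::real^'n. B * (\<integral>x. cmod (f x) \<partial>lborel) * exp (- (norm y)\<^sup>2)"])
    show "integrable lborel (\<lambda>y::real^'n. B * (\<integral>x. cmod (f x) \<partial>lborel) * exp (- (norm y)\<^sup>2))"
      using integrable_gaussian[of 1, where 'a = "real^'n"] by (intro integrable_mult_right) simp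
    show "AE y in lborel. (\<lambda>n. R (\<delta> n *\<^sub>R y) * complex_of_real (exp (- (norm y)\<^sup>2))) \<longlonglongrightarrow> R 0 * complex_of_real (exp (- (norm y)\<^sup>2))" (is "AE y in _. ?B y")
    proof (rule AE_I2)
      fix y :: "real ^ 'n"
      have "(\<lambda>n. \<delta> n *\<^sub>R y) \<longlonglongrightarrow> 0" using tendsto_scaleR[OF \<delta>(2) tendsto_const[of y]] by simp
      moreover have "isCont R 0" using R_cont by (simp add: isCont_def)
      ultimately have "(\<lambda>n. R (\<delta> n *\<^sub>R y)) \<longlonglongrightarrow> R 0" by (metis isCont_tendsto_compose)
      then show "?B y"
        by (intro tendsto_intros)
    qed
    show "AE y in lborel. norm (R (\<delta> n *\<^sub>R y) * complex_of_real (exp (- (norm y)\<^sup>2))) \<le> B * (\<integral>x. cmod (f x) \<partial>lborel) * exp (- (norm y)\<^sup>2)" for n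
      using R_bound by (intro AE_I2) (simp add: norm_mult mult_right_mono)
  qed measurable
  let ?A = "\<lambda>n. \<integral>\<xi>. (cmod (fourier f \<xi>))\<^sup>2 * rgauss ((\<delta> n)\<^sup>2 / 4) \<xi> \<partial>lborel"
  have "(\<lambda>n. complex_of_real (?A n)) \<longlonglongrightarrow> complex_of_real (2 ^ CARD('n) * ?M1) * (\<integral>(y::real^'n). R 0 * complex_of_real (exp (- (norm y)\<^sup>2)) \<partial>lborel)"
    unfolding fourier_gaussian_regularization[OF f f_bound \<delta>(1)] R_def[symmetric]
    by (intro tendsto_mult_left lim1)
  moreover have "complex_of_real (2 ^ CARD('n) * ?M1) * (\<integral>(y::real^'n). R 0 * complex_of_real (exp (- (norm y)\<^sup>2)) \<partial>lborel)
      = complex_of_real (plancherel_const TYPE(real^'n) * (L2norm f)\<^sup>2)"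
    by (simp add: R0 plancherel_const_def power2_eq_square)
  ultimately have lim: "?A \<longlonglongrightarrow> plancherel_const TYPE(real^'n) * (L2norm f)\<^sup>2"
    by (simp only: tendsto_of_real_iff)
  have intA: "integrable lborel (\<lambda>\<xi>. (cmod (fourier f \<xi>))\<^sup>2 * rgauss ((\<delta> n)\<^sup>2 / 4) \<xi>)" for n
  proof (rule Bochner_Integration.integrable_bound)
    show "integrable lborel (\<lambda>\<xi>::real^'n. (\<integral>x. cmod (f x) \<partial>lborel)\<^sup>2 * rgauss ((\<delta> n)\<^sup>2 / 4) \<xi>)"
      using \<delta>(1)[of n] by (intro integrable_mult_right integrable_gaussian) simp
    show "AE \<xi> in lborel. norm ((cmod (fourier f \<xi>))\<^sup>2 * rgauss ((\<delta> n)\<^sup>2 / 4) \<xi>)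
        \<le> norm ((\<integral>x. cmod (f x) \<partial>lborel)\<^sup>2 * rgauss ((\<delta> n)\<^sup>2 / 4) \<xi>)"
      using norm_fourier_le[of f] by (intro AE_I2) (auto simp: abs_mult intro!: mult_right_mono power_mono)
  qed measurable
  have mono: "AE \<xi> in lborel. mono (\<lambda>n. (cmod (fourier f \<xi>))\<^sup>2 * rgauss ((\<delta> n)\<^sup>2 / 4) \<xi>)"
  proof (intro AE_I2 monoI mult_left_mono)
    fix \<xi> :: "real ^ 'n" and m n :: nat assume "m \<le> n"
    then have "\<delta> n \<le> \<delta> m" by (simp add: \<delta>_def frac_le)
    then have "(\<delta> n)\<^sup>2 / 4 * (norm \<xi>)\<^sup>2 \<le> (\<delta> m)\<^sup>2 / 4 * (norm \<xi>)\<^sup>2"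
      using \<delta>(1)[of n] by (intro mult_right_mono divide_right_mono power_mono) auto
    then show "rgauss ((\<delta> m)\<^sup>2 / 4) \<xi> \<le> rgauss ((\<delta> n)\<^sup>2 / 4) \<xi>" by simp
  qed simp
  have ptw: "AE \<xi> in lborel. (\<lambda>n. (cmod (fourier f \<xi>))\<^sup>2 * rgauss ((\<delta> n)\<^sup>2 / 4) \<xi>) \<longlonglongrightarrow> (cmod (fourier f \<xi>))\<^sup>2"
  proof (rule AE_I2)
    fix \<xi> :: "real ^ 'n"
    have "(\<lambda>n. (cmod (fourier f \<xi>))\<^sup>2 * rgauss ((\<delta> n)\<^sup>2 / 4) \<xi>) \<longlonglongrightarrow> (cmod (fourier f \<xi>))\<^sup>2 * rgauss (0\<^sup>2 / 4) \<xi>"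
      by (intro tendsto_intros \<delta>(2)) auto
    then show "(\<lambda>n. (cmod (fourier f \<xi>))\<^sup>2 * rgauss ((\<delta> n)\<^sup>2 / 4) \<xi>) \<longlonglongrightarrow> (cmod (fourier f \<xi>))\<^sup>2" by simp
  qed
  have m: "(\<lambda>\<xi>. (cmod (fourier f \<xi>))\<^sup>2) \<in> borel_measurable lborel" by measurable
  show "fourier f \<in> L2"
    using integrable_monotone_convergence[OF intA mono ptw lim m] by (simp add: L2_def)
  show "(L2norm (fourier f))\<^sup>2 = plancherel_const TYPE(real^'n) * (L2norm f)\<^sup>2"
    unfolding L2norm_sq[of "fourier f"] by (rule integral_monotone_convergence[OF intA mono ptw lim m])
qed

text \<open>Cutting off large values of f gives bounded functions whose transforms converge
  pointwise; Fatou's lemma passes the isometry to the limit as an inequality. Applied to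
  differences, this inequality later yields the equality.\<close>

lemma plancherel_bessel:
  fixes f :: "real ^ 'n \<Rightarrow> complex"
  assumes f: "integrable lborel f" "f \<in> L2"
  shows "fourier f \<in> L2" and "L2norm (fourier f) \<le> sqrt (plancherel_const TYPE(real^'n)) * L2norm f"
proof -
  have [measurable]: "f \<in> borel_measurable borel" using f by auto
  let ?C = "plancherel_const TYPE(real^'n)"
  have C: "0 \<le> ?C" using plancherel_const_pos[where 'a = "real^'n"] by simp
  define g where "g n x = indicator {x. cmod (f x) \<le> real n} x * f x" for n :: nat and x
  have [measurable]: "g n \<in> borel_measurable borel" for n unfolding g_def by measurable
  have g_le: "cmod (g n x) \<le> cmod (f x)" "cmod (g n x) \<le> real n" for n x
    by (auto simp: g_def indicator_def)
  have int_g: "integrable lborel (g n)" for n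
    by (rule Bochner_Integration.integrable_bound[OF f(1)]) (use g_le in auto)
  have norm_g: "L2norm (g n) \<le> L2norm f" for n
    unfolding L2norm_def using L2_D[OF f(2)] L2_D(2)[OF L2_if_bounded_integrable[OF int_g g_le(2)]] g_le(1)
    by (intro real_sqrt_le_mono integral_mono) (auto intro!: power_mono)
  have ev: "\<forall>\<^sub>F n in sequentially. g n x = f x" for x
    using eventually_ge_at_top[of "nat \<lceil>cmod (f x)\<rceil>"] by eventually_elim (auto simp: g_def indicator_def nat_le_iff ceiling_le_iff)
  have lim: "(\<lambda>n. fourier (g n) \<xi>) \<longlonglongrightarrow> fourier f \<xi>" for \<xi>
    unfolding fourier_def
  proof (rule integral_dominated_convergence[where w = "\<lambda>x. cmod (f x)"])
    show "AE x in lborel. (\<lambda>n. g n x * exp (- \<i> * complex_of_real (x \<bullet> \<xi>))) \<longlonglongrightarrow> f x * exp (- \<i> * complex_of_real (x \<bullet> \<xi>))"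
      by (intro AE_I2 tendsto_eventually eventually_mono[OF ev]) simp
    show "AE x in lborel. norm (g n x * exp (- \<i> * complex_of_real (x \<bullet> \<xi>))) \<le> cmod (f x)" for n
      using g_le(1) by (intro AE_I2) (simp add: norm_mult)
  qed (use f in auto)
  have "(\<integral>\<^sup>+\<xi>. ennreal ((cmod (fourier f \<xi>))\<^sup>2) \<partial>lborel) = (\<integral>\<^sup>+\<xi>. liminf (\<lambda>n. ennreal ((cmod (fourier (g n) \<xi>))\<^sup>2)) \<partial>lborel)"
    by (intro nn_integral_cong lim_imp_Liminf[symmetric] tendsto_intros lim) auto
  also have "\<dots> \<le> liminf (\<lambda>n. \<integral>\<^sup>+\<xi>. ennreal ((cmod (fourier (g n) \<xi>))\<^sup>2) \<partial>lborel)"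
    by (rule nn_integral_liminf) measurable
  also have "\<dots> \<le> liminf (\<lambda>n::nat. ennreal (?C * (L2norm f)\<^sup>2))"
  proof (intro Liminf_mono always_eventually allI)
    fix n
    have "(\<integral>\<^sup>+\<xi>. ennreal ((cmod (fourier (g n) \<xi>))\<^sup>2) \<partial>lborel) = ennreal (?C * (L2norm (g n))\<^sup>2)"
      using nn_integral_L2 plancherel_bounded[OF int_g g_le(2)] by metis
    also have "\<dots> \<le> ennreal (?C * (L2norm f)\<^sup>2)"
      using norm_g C by (intro ennreal_leI mult_left_mono power_mono) auto
    finally show "(\<integral>\<^sup>+\<xi>. ennreal ((cmod (fourier (g n) \<xi>))\<^sup>2) \<partial>lborel) \<le> ennreal (?C * (L2norm f)\<^sup>2)" .
  qed
  finally have le: "(\<integral>\<^sup>+\<xi>. ennreal ((cmod (fourier f \<xi>))\<^sup>2) \<partial>lborel) \<le> ennreal (?C * (L2norm f)\<^sup>2)"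
    by (simp add: Liminf_const)
  then have "(\<integral>\<^sup>+\<xi>. ennreal ((cmod (fourier f \<xi>))\<^sup>2) \<partial>lborel) < \<infinity>"
    by (rule le_less_trans) simp
  then show L2: "fourier f \<in> L2" by (simp add: L2_def integrable_iff_bounded)
  have "(L2norm (fourier f))\<^sup>2 \<le> ?C * (L2norm f)\<^sup>2"
    using le C unfolding nn_integral_L2[OF L2] by (simp add: ennreal_le_iff)
  then have "(L2norm (fourier f))\<^sup>2 \<le> (sqrt ?C * L2norm f)\<^sup>2" using C by (simp add: power_mult_distrib)
  then show "L2norm (fourier f) \<le> sqrt ?C * L2norm f"
    by (rule power2_le_imp_le) (use C in auto)
qed

text \<open>Bessel's inequality for the difference between f and its truncations shows that the
  transforms converge in norm, so the isometry on bounded functions survives in the limit.\<close>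

lemma plancherel:
  fixes f :: "real ^ 'n \<Rightarrow> complex"
  assumes f: "integrable lborel f" "f \<in> L2"
  shows "L2norm (fourier f) = sqrt (plancherel_const TYPE(real^'n)) * L2norm f"
proof -
  have [measurable]: "f \<in> borel_measurable borel" using f by auto
  let ?C = "plancherel_const TYPE(real^'n)"
  have C: "0 \<le> ?C" using plancherel_const_pos[where 'a = "real^'n"] by simp
  define g where "g n x = indicator {x. cmod (f x) \<le> n} x * f x" for n :: real and x
  have [measurable]: "g n \<in> borel_measurable borel" for n unfolding g_def by measurable
  have g_le: "cmod (g n x) \<le> cmod (f x)" "cmod (g n x) \<le> \<bar>n\<bar>" for n x
    by (auto simp: g_def indicator_def)
  have int_g: "integrable lborel (g n)" for n
    by (rule Bochner_Integration.integrable_bound[OF f(1)]) (use g_le in auto)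
  note gL2 = L2_if_bounded_integrable[OF int_g g_le(2)]
  have lim: "((\<lambda>n. L2norm (\<lambda>x. g n x - f x)) \<longlongrightarrow> 0) at_top"
    unfolding g_def by (rule tendsto_L2_truncation[OF f(2)]) (auto simp: eventually_ge_at_top)
  have "((\<lambda>n. L2norm (\<lambda>\<xi>. fourier (g n) \<xi> - fourier f \<xi>)) \<longlongrightarrow> 0) at_top"
  proof (rule Lim_null_comparison[OF _ tendsto_mult_right_zero[OF lim]], intro always_eventually allI)
    fix n
    show "norm (L2norm (\<lambda>\<xi>. fourier (g n) \<xi> - fourier f \<xi>)) \<le> sqrt ?C * L2norm (\<lambda>x. g n x - f x)"
      using plancherel_bessel(2)[OF Bochner_Integration.integrable_diff[OF int_g f(1)] L2_diff[OF gL2 f(2)], of n]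
      unfolding ext[OF fourier_diff[OF int_g f(1)]] by simp
  qed
  from tendsto_L2norm[OF plancherel_bessel(1)[OF int_g gL2] plancherel_bessel(1)[OF f] this]
  have "((\<lambda>n. L2norm (fourier (g n))) \<longlongrightarrow> L2norm (fourier f)) at_top" .
  moreover have "L2norm (fourier (g n)) = sqrt ?C * L2norm (g n)" for n
    by (rule power2_eq_imp_eq)
      (use plancherel_bounded(2)[OF int_g g_le(2), of n] C in \<open>auto simp: power_mult_distrib\<close>)
  ultimately have "((\<lambda>n. sqrt ?C * L2norm (g n)) \<longlongrightarrow> L2norm (fourier f)) at_top" by simp
  moreover have "((\<lambda>n. sqrt ?C * L2norm (g n)) \<longlongrightarrow> sqrt ?C * L2norm f) at_top"
    by (intro tendsto_mult_left tendsto_L2norm[OF gL2 f(2) lim])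
  ultimately show ?thesis by (rule tendsto_unique[rotated]) simp
qed

section \<open>The Fourier transform of square-integrable functions\<close>

lemma truncation_cball:
  fixes f :: "'a::euclidean_space \<Rightarrow> complex"
  assumes f: "f \<in> L2"
  shows "integrable lborel (\<lambda>x. indicator (cball 0 R) x * f x)"
    and "(\<lambda>x. indicator (cball 0 R) x * f x) \<in> L2"
    and "((\<lambda>R. L2norm (\<lambda>x. indicator (cball 0 R) x * f x - f x)) \<longlongrightarrow> 0) at_top"
proof -
  have [measurable]: "f \<in> borel_measurable borel" "(cball 0 R :: 'a set) \<in> sets borel" for R using f by (auto simp: L2_def)
  show "integrable lborel (\<lambda>x. indicator (cball 0 R) x * f x)"
  proof (rule Bochner_Integration.integrable_bound)
    show "integrable lborel (\<lambda>x. indicat_real (cball 0 R) x + (cmod (f x))\<^sup>2)"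
      using L2_D[OF f] emeasure_lborel_cball_finite[of "0::'a" R]
      by (intro Bochner_Integration.integrable_add integrable_real_indicator) (auto simp: less_top)
    show "AE x in lborel. norm (indicator (cball 0 R) x * f x) \<le> norm (indicat_real (cball 0 R) x + (cmod (f x))\<^sup>2)" (is "AE x in _. ?B x")
    proof (rule AE_I2)
      fix x
      have "cmod (f x) \<le> 1 + (cmod (f x))\<^sup>2"
        using sum_squares_bound[of 1 "cmod (f x)"] zero_le_power2[of "cmod (f x)"] by (simp add: power2_eq_square) (smt (verit) norm_ge_zero mult_nonneg_nonneg)
      then show "?B x"
        by (simp add: indicator_def)
    qed
  qed measurable
  show "(\<lambda>x. indicator (cball 0 R) x * f x) \<in> L2"
    by (rule L2_bound[OF _ L2_D(2)[OF f]]) (auto simp: indicator_def)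
  show "((\<lambda>R. L2norm (\<lambda>x. indicator (cball 0 R) x * f x - f x)) \<longlongrightarrow> 0) at_top"
    by (rule tendsto_L2_truncation[OF f]) (auto simp: eventually_ge_at_top)
qed

text \<open>The extended integral of the definition may be replaced by a real norm because
  truncations to balls are integrable and square integrable, so that their transforms differ from F
  by elements of \<open>L2\<close>.\<close>

lemma is_fourier_L2_iff:
  fixes f :: "real ^ 'n \<Rightarrow> complex"
  shows "is_fourier_L2 f F \<longleftrightarrow> f \<in> L2 \<and> F \<in> L2 \<and>
    ((\<lambda>R. L2norm (\<lambda>\<xi>. fourier (\<lambda>x. indicator (cball 0 R) x * f x) \<xi> - F \<xi>)) \<longlongrightarrow> 0) at_top"
proof (cases "f \<in> L2 \<and> F \<in> L2")
  case True
  let ?D = "\<lambda>R \<xi>. fourier (\<lambda>x. indicator (cball 0 R) x * f x) \<xi> - F \<xi>"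
  have "?D R \<in> L2" for R
    using True by (intro L2_diff plancherel_bessel(1) truncation_cball) auto
  then have "(\<integral>\<^sup>+ \<xi>. ennreal ((cmod (?D R \<xi>))\<^sup>2) \<partial>lborel) = ennreal ((L2norm (?D R))\<^sup>2)" for R
    by (rule nn_integral_L2)
  moreover have "((\<lambda>R. ennreal ((L2norm (?D R))\<^sup>2)) \<longlongrightarrow> ennreal 0) at_top \<longleftrightarrow> ((\<lambda>R. (L2norm (?D R))\<^sup>2) \<longlongrightarrow> 0) at_top"
    by (rule tendsto_ennreal_iff) auto
  moreover have "((\<lambda>R. (L2norm (?D R))\<^sup>2) \<longlongrightarrow> 0) at_top \<longleftrightarrow> ((\<lambda>R. L2norm (?D R)) \<longlongrightarrow> 0) at_top"
  proof
    assume "((\<lambda>R. (L2norm (?D R))\<^sup>2) \<longlongrightarrow> 0) at_top"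
    from tendsto_real_sqrt[OF this] show "((\<lambda>R. L2norm (?D R)) \<longlongrightarrow> 0) at_top" by simp
  next
    assume "((\<lambda>R. L2norm (?D R)) \<longlongrightarrow> 0) at_top"
    from tendsto_power[OF this, of 2] show "((\<lambda>R. (L2norm (?D R))\<^sup>2) \<longlongrightarrow> 0) at_top" by simp
  qed
  ultimately show ?thesis using True unfolding is_fourier_L2_def by simp
qed (auto simp: is_fourier_L2_def)

lemma is_fourier_L2_norm:
  fixes f :: "real ^ 'n \<Rightarrow> complex"
  assumes fF: "is_fourier_L2 f F"
  shows "L2norm F = sqrt (plancherel_const TYPE(real^'n)) * L2norm f"
proof -
  have f: "f \<in> L2" and F: "F \<in> L2" using fF by (auto simp: is_fourier_L2_def)
  let ?f = "\<lambda>R x. indicator (cball 0 R) x * f x"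
  have "((\<lambda>R. L2norm (fourier (?f R))) \<longlongrightarrow> L2norm F) at_top"
    using fF F unfolding is_fourier_L2_iff by (intro tendsto_L2norm plancherel_bessel(1) truncation_cball[OF f]) auto
  moreover have "L2norm (fourier (?f R)) = sqrt (plancherel_const TYPE(real^'n)) * L2norm (?f R)" for R
    by (intro plancherel truncation_cball[OF f])
  ultimately have lim: "((\<lambda>R. sqrt (plancherel_const TYPE(real^'n)) * L2norm (?f R)) \<longlongrightarrow> L2norm F) at_top"
    by simp
  have "((\<lambda>R. sqrt (plancherel_const TYPE(real^'n)) * L2norm (?f R)) \<longlongrightarrow> sqrt (plancherel_const TYPE(real^'n)) * L2norm f) at_top"
    by (intro tendsto_mult_left tendsto_L2norm truncation_cball[OF f] f)
  from tendsto_unique[OF _ lim this] show ?thesis by simp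
qed

lemma is_fourier_L2_add_mult:
  fixes f :: "real ^ 'n \<Rightarrow> complex"
  assumes fF: "is_fourier_L2 f F" and gG: "is_fourier_L2 g G"
  shows "is_fourier_L2 (\<lambda>x. f x + c * g x) (\<lambda>\<xi>. F \<xi> + c * G \<xi>)"
proof -
  have f: "f \<in> L2" and F: "F \<in> L2" and g: "g \<in> L2" and G: "G \<in> L2" using assms by (auto simp: is_fourier_L2_def)
  let ?f = "\<lambda>R x. indicator (cball 0 R) x * f x" and ?g = "\<lambda>R x. indicator (cball 0 R) x * g x"
  let ?h = "\<lambda>R x. indicator (cball 0 R) x * (f x + c * g x)"
  have four: "fourier (?h R) \<xi> = fourier (?f R) \<xi> + c * fourier (?g R) \<xi>" for R \<xi>
  proof -
    have "?h R = (\<lambda>x. ?f R x + c * ?g R x)" by (auto simp: algebra_simps)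
    then show ?thesis
      using truncation_cball(1)[OF f, of R] truncation_cball(1)[OF g, of R] by (simp add: fourier_add fourier_mult_left)
  qed
  let ?DF = "\<lambda>R \<xi>. fourier (?f R) \<xi> - F \<xi>" and ?DG = "\<lambda>R \<xi>. fourier (?g R) \<xi> - G \<xi>"
  have DL2: "?DF R \<in> L2" "?DG R \<in> L2" for R
    using F G by (auto intro!: L2_diff plancherel_bessel(1) truncation_cball f g)
  have lim: "((\<lambda>R. L2norm (?DF R) + cmod c * L2norm (?DG R)) \<longlongrightarrow> 0) at_top"
    using fF gG unfolding is_fourier_L2_iff by (auto intro!: tendsto_add_zero tendsto_mult_right_zero)
  have "((\<lambda>R. L2norm (\<lambda>\<xi>. fourier (?h R) \<xi> - (F \<xi> + c * G \<xi>))) \<longlongrightarrow> 0) at_top"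
  proof (rule Lim_null_comparison[OF _ lim], intro always_eventually allI)
    fix R
    have "(\<lambda>\<xi>. fourier (?h R) \<xi> - (F \<xi> + c * G \<xi>)) = (\<lambda>\<xi>. ?DF R \<xi> + c * ?DG R \<xi>)"
      unfolding four by (auto simp: algebra_simps)
    then show "norm (L2norm (\<lambda>\<xi>. fourier (?h R) \<xi> - (F \<xi> + c * G \<xi>))) \<le> L2norm (?DF R) + cmod c * L2norm (?DG R)"
      using L2norm_add_le[OF DL2(1) L2_mult[OF DL2(2)], of R c R] by (simp add: L2norm_mult)
  qed
  then show ?thesis unfolding is_fourier_L2_iff using f F g G by (auto intro!: L2_add L2_mult)
qed

lemma is_fourier_L2_diff:
  assumes "is_fourier_L2 f F" "is_fourier_L2 g G"
  shows "is_fourier_L2 (\<lambda>x. f x - g x) (\<lambda>\<xi>. F \<xi> - G \<xi>)"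
  using is_fourier_L2_add_mult[OF assms, of "-1"] by simp

text \<open>Well-definedness and injectivity together, from the isometry applied to the difference.
  This is what makes objects selected by \<open>SOME\<close> computable: candidates whose transforms
  agree almost everywhere agree almost everywhere.\<close>

lemma is_fourier_L2_AE_eq_iff:
  fixes f :: "real ^ 'n \<Rightarrow> complex"
  assumes "is_fourier_L2 f F" "is_fourier_L2 g G"
  shows "(AE x in lborel. f x = g x) \<longleftrightarrow> (AE \<xi> in lborel. F \<xi> = G \<xi>)"
proof -
  note d = is_fourier_L2_diff[OF assms]
  have L2: "(\<lambda>x. f x - g x) \<in> L2" "(\<lambda>\<xi>. F \<xi> - G \<xi>) \<in> L2" using d by (auto simp: is_fourier_L2_def)
  have *: "(AE x in lborel. h x = 0) \<longleftrightarrow> L2norm h = 0" if "h \<in> L2" for h :: "real ^ 'n \<Rightarrow> complex"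
  proof
    assume "AE x in lborel. h x = 0"
    then have "L2norm h = L2norm (\<lambda>_::real^'n. 0)" using L2_D[OF that] by (intro L2norm_cong_AE) auto
    then show "L2norm h = 0" by (simp add: L2norm_def)
  qed (rule L2norm_eq_0_imp_AE[OF that])
  have "(AE x in lborel. f x = g x) \<longleftrightarrow> (AE x in lborel. f x - g x = 0)" by simp
  also have "\<dots> \<longleftrightarrow> L2norm (\<lambda>x. f x - g x) = 0" by (rule *[OF L2(1)])
  also have "\<dots> \<longleftrightarrow> L2norm (\<lambda>\<xi>. F \<xi> - G \<xi>) = 0"
    using is_fourier_L2_norm[OF d] plancherel_const_pos[where 'a = "real^'n"] by simp
  also have "\<dots> \<longleftrightarrow> (AE \<xi> in lborel. F \<xi> - G \<xi> = 0)" by (rule *[OF L2(2), symmetric])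
  finally show ?thesis by simp
qed

text \<open>Serves the datum v, which is a multiple of u only up to a null set. Changing f on a null
  set leaves every truncated Fourier integral unchanged.\<close>

lemma is_fourier_L2_cong_AE:
  fixes f :: "real ^ 'n \<Rightarrow> complex"
  assumes fF: "is_fourier_L2 f F" and [measurable]: "g \<in> borel_measurable borel" "G \<in> borel_measurable borel"
    and eq: "AE x in lborel. f x = g x" "AE \<xi> in lborel. F \<xi> = G \<xi>"
  shows "is_fourier_L2 g G"
proof -
  have f: "f \<in> L2" and F: "F \<in> L2" using fF by (auto simp: is_fourier_L2_def)
  note [measurable] = L2_D(1)[OF f] L2_D(1)[OF F]
  have "fourier (\<lambda>x. indicator (cball 0 R) x * f x) \<xi> = fourier (\<lambda>x. indicator (cball 0 R) x * g x) \<xi>" for R \<xi>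
    unfolding fourier_def
  proof (rule integral_cong_AE)
    have [measurable]: "(cball 0 R :: (real^'n) set) \<in> sets borel" by simp
    show "(\<lambda>x. indicator (cball 0 R) x * f x * exp (- \<i> * complex_of_real (x \<bullet> \<xi>))) \<in> borel_measurable lborel"
      "(\<lambda>x. indicator (cball 0 R) x * g x * exp (- \<i> * complex_of_real (x \<bullet> \<xi>))) \<in> borel_measurable lborel"
      by measurable
  qed (use eq(1) in auto)
  moreover have "(\<integral>\<^sup>+ \<xi>. ennreal ((cmod (K \<xi> - F \<xi>))\<^sup>2) \<partial>lborel) = (\<integral>\<^sup>+ \<xi>. ennreal ((cmod (K \<xi> - G \<xi>))\<^sup>2) \<partial>lborel)" for K :: "real^'n \<Rightarrow> complex"
    by (rule nn_integral_cong_AE) (use eq(2) in auto)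
  moreover have "g \<in> L2" "G \<in> L2" using L2_cong_AE[OF f _ eq(1)] L2_cong_AE[OF F _ eq(2)] by auto
  ultimately show ?thesis using fF unfolding is_fourier_L2_def by simp
qed

lemma L2_mult_integrable:
  assumes f: "f \<in> L2" and g: "g \<in> L2"
  shows "integrable lborel (\<lambda>x. f x * cnj (g x))"
proof (rule Bochner_Integration.integrable_bound)
  show "integrable lborel (\<lambda>x. (cmod (f x))\<^sup>2 + (cmod (g x))\<^sup>2)" using L2_D[OF f] L2_D[OF g] by simp
  have "cmod (f x) * cmod (g x) \<le> (cmod (f x))\<^sup>2 + (cmod (g x))\<^sup>2" for x
    using sum_squares_bound[of "cmod (f x)" "cmod (g x)"] mult_nonneg_nonneg[OF norm_ge_zero[of "f x"] norm_ge_zero[of "g x"]]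
    by linarith
  then show "AE x in lborel. norm (f x * cnj (g x)) \<le> norm ((cmod (f x))\<^sup>2 + (cmod (g x))\<^sup>2)"
    by (intro AE_I2) (simp add: norm_mult)
  have [measurable]: "f \<in> borel_measurable borel" "g \<in> borel_measurable borel" using f g by (auto simp: L2_def)
  show "(\<lambda>x. f x * cnj (g x)) \<in> borel_measurable lborel" by measurable
qed

lemma L2norm_add_sq:
  assumes f: "f \<in> L2" and g: "g \<in> L2"
  shows "(L2norm (\<lambda>x. f x + g x))\<^sup>2 = (L2norm f)\<^sup>2 + (L2norm g)\<^sup>2 + 2 * Re (\<integral>x. f x * cnj (g x) \<partial>lborel)"
proof -
  note int = L2_mult_integrable[OF f g]
  have "(cmod (f x + g x))\<^sup>2 = (cmod (f x))\<^sup>2 + (cmod (g x))\<^sup>2 + 2 * Re (f x * cnj (g x))" for x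
    by (simp add: cmod_power2 power2_sum)
  then have "(L2norm (\<lambda>x. f x + g x))\<^sup>2 = (\<integral>x. (cmod (f x))\<^sup>2 + (cmod (g x))\<^sup>2 + 2 * Re (f x * cnj (g x)) \<partial>lborel)"
    by (simp add: L2norm_sq)
  also have "\<dots> = (\<integral>x. (cmod (f x))\<^sup>2 \<partial>lborel) + (\<integral>x. (cmod (g x))\<^sup>2 \<partial>lborel) + 2 * (\<integral>x. Re (f x * cnj (g x)) \<partial>lborel)"
    using L2_D[OF f] L2_D[OF g] int by (subst Bochner_Integration.integral_add) (auto simp del: times_complex.sel)
  finally show ?thesis using int by (simp only: L2norm_sq integral_Re)
qed

text \<open>Polarisation: comparing the norms of \<open>f + c g\<close> and \<open>F + c G\<close>
  for c = 1 gives the real part, for c = \<i> the imaginary part.\<close>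

lemma is_fourier_L2_inner:
  fixes f g :: "real ^ 'n \<Rightarrow> complex"
  assumes fF: "is_fourier_L2 f F" and gG: "is_fourier_L2 g G"
  shows "(\<integral>\<xi>. F \<xi> * cnj (G \<xi>) \<partial>lborel) = complex_of_real (plancherel_const TYPE(real^'n)) * (\<integral>x. f x * cnj (g x) \<partial>lborel)"
proof -
  let ?C = "plancherel_const TYPE(real^'n)"
  have C: "0 \<le> ?C" using plancherel_const_pos[where 'a = "real^'n"] by simp
  have L2: "f \<in> L2" "F \<in> L2" "g \<in> L2" "G \<in> L2" using assms by (auto simp: is_fourier_L2_def)
  have sq: "(L2norm H)\<^sup>2 = ?C * (L2norm h)\<^sup>2" if "is_fourier_L2 h H" for h H :: "real ^ 'n \<Rightarrow> complex"
    using is_fourier_L2_norm[OF that] C by (simp add: power_mult_distrib)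
  have re: "Re (\<integral>\<xi>. F \<xi> * cnj (c * G \<xi>) \<partial>lborel) = ?C * Re (\<integral>x. f x * cnj (c * g x) \<partial>lborel)" for c
    using sq[OF is_fourier_L2_add_mult[OF fF gG, of c]] sq[OF fF] sq[OF gG]
      L2norm_add_sq[OF L2(1) L2_mult[OF L2(3)], of c] L2norm_add_sq[OF L2(2) L2_mult[OF L2(4)], of c]
    by (simp only: L2norm_mult power_mult_distrib) (simp add: algebra_simps)
  have cc: "(\<integral>x. p x * cnj (\<i> * q x) \<partial>lborel) = - \<i> * (\<integral>x. p x * cnj (q x) \<partial>lborel)" for p q :: "real ^ 'n \<Rightarrow> complex"
    unfolding integral_mult_right_zero[symmetric] by (intro Bochner_Integration.integral_cong) auto
  show ?thesis
    using re[of 1] re[of \<i>] unfolding cc by (intro complex_eqI) simp_all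
qed

section \<open>Fourier inversion and the transform of a product\<close>

definition inverse_fourier :: "(real ^ 'n \<Rightarrow> complex) \<Rightarrow> real ^ 'n \<Rightarrow> complex" where
  "inverse_fourier H x = fourier H (- x) / complex_of_real (plancherel_const TYPE(real^'n))"

lemma borel_measurable_inverse_fourier [measurable]:
  assumes [measurable]: "H \<in> borel_measurable borel"
  shows "inverse_fourier H \<in> borel_measurable borel"
proof -
  have [measurable]: "(uminus :: real ^ 'n \<Rightarrow> real ^ 'n) \<in> borel_measurable borel"
    by (intro borel_measurable_continuous_onI continuous_intros)
  show ?thesis unfolding inverse_fourier_def[abs_def] by measurable
qed

text \<open>Inversion in norm. Let h be the inverse transform and h_R its truncation to a ball. The
  cross term in \<open>||fourier h_R - H||^2\<close> is evaluated by the multiplication formula,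
  because the transform of \<open>cnj H\<close> is a multiple of \<open>cnj h\<close>. With C the
  Plancherel constant and \<open>C ||h||^2 = ||H||^2\<close>, the whole square equals
  \<open>C (||h||^2 - ||h_R||^2)\<close>, which tends to 0.\<close>

lemma is_fourier_L2_inverse_fourier:
  fixes H :: "real ^ 'n \<Rightarrow> complex"
  assumes H: "integrable lborel H" "H \<in> L2"
  shows "is_fourier_L2 (inverse_fourier H) H"
proof -
  let ?C = "plancherel_const TYPE(real^'n)" and ?h = "inverse_fourier H"
  have C: "0 < ?C" by (rule plancherel_const_pos)
  have [measurable]: "H \<in> borel_measurable borel" using H by auto
  note HL2 = plancherel_bessel(1)[OF H]
  have sq: "(cmod (?h x))\<^sup>2 = (cmod (fourier H (- x)))\<^sup>2 / ?C\<^sup>2" for x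
    using C by (auto simp: inverse_fourier_def norm_divide power_divide)
  have hL2: "?h \<in> L2"
    using integrable_lborel_affine[OF L2_D(2)[OF HL2], of "-1" 0] by (simp add: L2_def sq)
  have "(L2norm ?h)\<^sup>2 = (L2norm (fourier H))\<^sup>2 / ?C\<^sup>2"
    unfolding L2norm_sq sq using integral_lborel_affine[of "\<lambda>x. (cmod (fourier H x))\<^sup>2" "-1" 0] by simp
  also have "\<dots> = (L2norm H)\<^sup>2 / ?C"
    using C by (simp add: plancherel[OF H] power_mult_distrib field_simps power2_eq_square[of ?C])
  finally have norm_h: "?C * (L2norm ?h)\<^sup>2 = (L2norm H)\<^sup>2" using C by simp
  let ?hR = "\<lambda>R x. indicator (cball 0 R) x * ?h x"
  have [measurable]: "(cball 0 R :: (real^'n) set) \<in> sets borel" for R by simp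
  note tr = truncation_cball[OF hL2]
  have cH: "fourier (\<lambda>\<xi>. cnj (H \<xi>)) x = complex_of_real ?C * cnj (?h x)" for x
  proof -
    have "fourier (\<lambda>\<xi>. cnj (H \<xi>)) x = cnj (fourier H (- x))"
      unfolding fourier_def Bochner_Integration.integral_cnj[symmetric]
      by (intro Bochner_Integration.integral_cong) (auto simp: exp_cnj)
    then show ?thesis using C by (simp add: inverse_fourier_def)
  qed
  have ip: "(\<integral>\<xi>. fourier (?hR R) \<xi> * cnj (- H \<xi>) \<partial>lborel) = complex_of_real (- (?C * (L2norm (?hR R))\<^sup>2))" for R
  proof -
    have "(\<integral>\<xi>. fourier (?hR R) \<xi> * cnj (H \<xi>) \<partial>lborel) = (\<integral>x. ?hR R x * fourier (\<lambda>\<xi>. cnj (H \<xi>)) x \<partial>lborel)"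
      using H by (intro fourier_multiplication_formula tr) auto
    also have "\<dots> = (\<integral>x. complex_of_real ?C * complex_of_real ((cmod (?hR R x))\<^sup>2) \<partial>lborel)"
      unfolding cH by (intro Bochner_Integration.integral_cong) (auto simp: indicator_def complex_norm_square simp del: of_real_power)
    also have "\<dots> = complex_of_real (?C * (L2norm (?hR R))\<^sup>2)"
      unfolding integral_mult_right_zero integral_complex_of_real L2norm_sq by simp
    finally show ?thesis by simp
  qed
  have "(L2norm (\<lambda>\<xi>. fourier (?hR R) \<xi> - H \<xi>))\<^sup>2 = ?C * ((L2norm ?h)\<^sup>2 - (L2norm (?hR R))\<^sup>2)" for R
  proof -
    have "(L2norm (\<lambda>\<xi>. fourier (?hR R) \<xi> + - H \<xi>))\<^sup>2
        = (L2norm (fourier (?hR R)))\<^sup>2 + (L2norm (\<lambda>\<xi>. - H \<xi>))\<^sup>2 + 2 * Re (\<integral>\<xi>. fourier (?hR R) \<xi> * cnj (- H \<xi>) \<partial>lborel)"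
      using L2_mult[OF H(2), of "-1"] by (intro L2norm_add_sq plancherel_bessel(1) tr) simp
    also have "(L2norm (fourier (?hR R)))\<^sup>2 = ?C * (L2norm (?hR R))\<^sup>2"
      using plancherel[OF tr(1,2)] C by (simp add: power_mult_distrib)
    also have "L2norm (\<lambda>\<xi>. - H \<xi>) = L2norm H" using L2norm_mult[of "-1" H] by simp
    finally show ?thesis unfolding ip norm_h[symmetric] by (simp add: algebra_simps)
  qed
  moreover have "((\<lambda>R. ?C * ((L2norm ?h)\<^sup>2 - (L2norm (?hR R))\<^sup>2)) \<longlongrightarrow> ?C * ((L2norm ?h)\<^sup>2 - (L2norm ?h)\<^sup>2)) at_top"
    by (intro tendsto_intros tendsto_L2norm tr hL2)
  ultimately have "((\<lambda>R. (L2norm (\<lambda>\<xi>. fourier (?hR R) \<xi> - H \<xi>))\<^sup>2) \<longlongrightarrow> 0) at_top" by simp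
  from tendsto_real_sqrt[OF this] show ?thesis
    unfolding is_fourier_L2_iff using hL2 H by simp
qed

text \<open>Parseval's identity for F and \<open>K \<eta> = cnj (G (\<xi> - \<eta>))\<close>: the
  inverse transform of K is the conjugate of that of G times a character, and the conjugate of this
  character is the kernel of the Fourier integral at \<xi>.\<close>

lemma fourier_mult_inverse_fourier:
  fixes F G :: "real ^ 'n \<Rightarrow> complex"
  assumes F: "integrable lborel F" "F \<in> L2" and G: "integrable lborel G" "G \<in> L2"
  shows "fourier (\<lambda>x. inverse_fourier F x * inverse_fourier G x) \<xi>
    = (\<integral>\<eta>. F \<eta> * G (\<xi> - \<eta>) \<partial>lborel) / complex_of_real (plancherel_const TYPE(real^'n))"
proof -
  let ?C = "plancherel_const TYPE(real^'n)"
  have C: "0 < ?C" by (rule plancherel_const_pos)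
  have [measurable]: "F \<in> borel_measurable borel" "G \<in> borel_measurable borel" using F G by auto
  define K where "K \<eta> = cnj (G (\<xi> - \<eta>))" for \<eta>
  have [measurable]: "K \<in> borel_measurable borel" unfolding K_def by measurable
  have K: "integrable lborel K" "K \<in> L2"
    using integrable_lborel_affine[OF G(1), of "-1" \<xi>] integrable_lborel_affine[OF L2_D(2)[OF G(2)], of "-1" \<xi>]
    by (auto simp: K_def[abs_def] L2_def)
  have invK: "inverse_fourier K x = cnj (inverse_fourier G x) * exp (\<i> * complex_of_real (x \<bullet> \<xi>))" for x
  proof -
    have "fourier K (- x) = (\<integral>\<eta>. K (\<xi> - \<eta>) * exp (- \<i> * complex_of_real ((\<xi> - \<eta>) \<bullet> (- x))) \<partial>lborel)"
      using integral_lborel_affine[of "\<lambda>\<eta>. K \<eta> * exp (- \<i> * complex_of_real (\<eta> \<bullet> (- x)))" "-1" \<xi>]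
      by (simp add: fourier_def)
    also have "\<dots> = (\<integral>\<eta>. cnj (G \<eta> * exp (- \<i> * complex_of_real (\<eta> \<bullet> (- x)))) * exp (\<i> * complex_of_real (x \<bullet> \<xi>)) \<partial>lborel)"
    proof (rule Bochner_Integration.integral_cong[OF refl])
      fix \<eta>
      have "exp (- \<i> * complex_of_real ((\<xi> - \<eta>) \<bullet> (- x)))
          = cnj (exp (- \<i> * complex_of_real (\<eta> \<bullet> (- x)))) * exp (\<i> * complex_of_real (x \<bullet> \<xi>))"
        unfolding exp_cnj exp_add[symmetric] by (simp add: inner_simps inner_commute algebra_simps)
      then show "K (\<xi> - \<eta>) * exp (- \<i> * complex_of_real ((\<xi> - \<eta>) \<bullet> (- x)))
          = cnj (G \<eta> * exp (- \<i> * complex_of_real (\<eta> \<bullet> (- x)))) * exp (\<i> * complex_of_real (x \<bullet> \<xi>))"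
        by (simp add: K_def)
    qed
    also have "\<dots> = cnj (fourier G (- x)) * exp (\<i> * complex_of_real (x \<bullet> \<xi>))"
      unfolding integral_mult_left_zero Bochner_Integration.integral_cnj fourier_def ..
    finally show ?thesis by (simp add: inverse_fourier_def)
  qed
  have "(\<integral>\<eta>. F \<eta> * cnj (K \<eta>) \<partial>lborel) = complex_of_real ?C * (\<integral>x. inverse_fourier F x * cnj (inverse_fourier K x) \<partial>lborel)"
    by (intro is_fourier_L2_inner is_fourier_L2_inverse_fourier F K)
  also have "(\<integral>x. inverse_fourier F x * cnj (inverse_fourier K x) \<partial>lborel) = fourier (\<lambda>x. inverse_fourier F x * inverse_fourier G x) \<xi>"
    unfolding invK fourier_def[of "\<lambda>x. inverse_fourier F x * inverse_fourier G x"]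
    by (intro Bochner_Integration.integral_cong) (auto simp: exp_cnj)
  finally show ?thesis using C by (simp add: K_def)
qed

section \<open>The functional in terms of Fourier transforms\<close>

definition schroedinger_evolution :: "(real ^ 'n \<Rightarrow> complex) \<Rightarrow> real \<Rightarrow> real ^ 'n \<Rightarrow> complex" where
  "schroedinger_evolution F t \<xi> = exp (- \<i> * complex_of_real (t * (norm \<xi>)\<^sup>2)) * F \<xi>"

lemma norm_schroedinger_evolution [simp]: "cmod (schroedinger_evolution F t \<xi>) = cmod (F \<xi>)"
  by (simp add: schroedinger_evolution_def norm_mult)

lemma schroedinger_evolution_measurable [measurable]:
  assumes [measurable]: "F \<in> borel_measurable borel"
  shows "schroedinger_evolution F t \<in> borel_measurable borel"
  unfolding schroedinger_evolution_def[abs_def] by measurable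

lemma schroedinger_evolution_integrable_L2:
  assumes "integrable lborel F" "F \<in> L2"
  shows "integrable lborel (schroedinger_evolution F t)" "schroedinger_evolution F t \<in> L2"
proof -
  have [measurable]: "F \<in> borel_measurable borel" using assms by auto
  show "integrable lborel (schroedinger_evolution F t)"
    by (rule Bochner_Integration.integrable_bound[OF assms(1)]) auto
  show "schroedinger_evolution F t \<in> L2"
    using assms by (simp add: L2_def)
qed

text \<open>Supplies the joint measurability in time and space that both choice-based definitions
  demand of their candidates.\<close>

lemma measurable_inverse_fourier_param:
  fixes H :: "real \<Rightarrow> real ^ 'n \<Rightarrow> complex"
  assumes [measurable]: "(\<lambda>(t, \<xi>). H t \<xi>) \<in> borel_measurable (borel \<Otimes>\<^sub>M borel)"
  shows "(\<lambda>(t, x). inverse_fourier (H t) x) \<in> borel_measurable borel"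
proof -
  have "(\<lambda>(p :: real \<times> (real ^ 'n)). (\<integral>\<xi>. H (fst p) \<xi> * exp (- \<i> * complex_of_real (- (\<xi> \<bullet> snd p))) \<partial>lborel)
      / complex_of_real (plancherel_const TYPE(real^'n))) \<in> borel_measurable (borel \<Otimes>\<^sub>M borel)"
    by measurable
  then show ?thesis
    by (simp add: inverse_fourier_def fourier_def case_prod_beta' borel_prod)
qed

text \<open>The inverse Fourier integral of the evolved transform is a legitimate candidate, so the
  choice in \<open>free_solution\<close> is not vacuous. The chosen solution may come with another
  version F' of the transform of w; uniqueness identifies first F' with F and then, for each t, the
  slice with the explicit integral.\<close>

lemma free_solution_AE:
  fixes w :: "real ^ 'n \<Rightarrow> complex"
  assumes wF: "is_fourier_L2 w F" and F: "integrable lborel F"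
  shows "free_solution w t \<in> borel_measurable borel"
    and "AE x in lborel. free_solution w t x = inverse_fourier (schroedinger_evolution F t) x"
proof -
  have FL2: "F \<in> L2" using wF by (simp add: is_fourier_L2_def)
  have [measurable]: "F \<in> borel_measurable borel" using F by auto
  have inv: "is_fourier_L2 (inverse_fourier (schroedinger_evolution F t)) (schroedinger_evolution F t)" for t
    by (intro is_fourier_L2_inverse_fourier schroedinger_evolution_integrable_L2 F FL2)
  have "is_free_solution w (\<lambda>t. inverse_fourier (schroedinger_evolution F t))"
    unfolding is_free_solution_def
  proof (intro conjI exI[of _ F] allI wF)
    have "(\<lambda>(t, \<xi>). schroedinger_evolution F t \<xi>) \<in> borel_measurable (borel \<Otimes>\<^sub>M borel)"
      unfolding schroedinger_evolution_def by measurable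
    then show "(\<lambda>(t, x). inverse_fourier (schroedinger_evolution F t) x) \<in> borel_measurable borel"
      by (rule measurable_inverse_fourier_param)
    show "is_fourier_L2 (inverse_fourier (schroedinger_evolution F t)) (\<lambda>\<xi>. exp (- \<i> * complex_of_real (t * (norm \<xi>)\<^sup>2)) * F \<xi>)" for t
      using inv[of t] by (simp add: schroedinger_evolution_def[abs_def])
  qed
  then have "is_free_solution w (free_solution w)"
    unfolding free_solution_def by (rule someI[of "is_free_solution w"])
  then obtain F' where F': "is_fourier_L2 w F'"
    "\<And>t. is_fourier_L2 (free_solution w t) (\<lambda>\<xi>. exp (- \<i> * complex_of_real (t * (norm \<xi>)\<^sup>2)) * F' \<xi>)"
    unfolding is_free_solution_def by blast
  show "free_solution w t \<in> borel_measurable borel"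
    using F'(2)[of t] by (simp add: is_fourier_L2_def L2_def)
  have "AE \<xi> in lborel. F' \<xi> = F \<xi>"
    using is_fourier_L2_AE_eq_iff[OF F'(1) wF] by simp
  then have "AE \<xi> in lborel. exp (- \<i> * complex_of_real (t * (norm \<xi>)\<^sup>2)) * F' \<xi> = schroedinger_evolution F t \<xi>"
    by eventually_elim (simp add: schroedinger_evolution_def)
  then show "AE x in lborel. free_solution w t x = inverse_fourier (schroedinger_evolution F t) x"
    using is_fourier_L2_AE_eq_iff[OF F'(2)[of t] inv[of t]] by simp
qed

definition fourier_product :: "(real ^ 'n \<Rightarrow> complex) \<Rightarrow> (real ^ 'n \<Rightarrow> complex) \<Rightarrow> real \<Rightarrow> real ^ 'n \<Rightarrow> complex" where
  "fourier_product F G t \<xi> = (\<integral>\<eta>. schroedinger_evolution F t \<eta> * schroedinger_evolution G t (\<xi> - \<eta>) \<partial>lborel)"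

lemma measurable_fourier_product [measurable]:
  assumes [measurable]: "F \<in> borel_measurable borel" "G \<in> borel_measurable borel"
  shows "(\<lambda>(t, \<xi>). fourier_product F G t \<xi>) \<in> borel_measurable (borel \<Otimes>\<^sub>M borel)"
  unfolding fourier_product_def schroedinger_evolution_def by measurable

lemma fourier_mult_free_solution:
  fixes w1 w2 :: "real ^ 'n \<Rightarrow> complex"
  assumes F: "is_fourier_L2 w1 F" "integrable lborel F" and G: "is_fourier_L2 w2 G" "integrable lborel G"
  shows "fourier (\<lambda>x. free_solution w1 t x * free_solution w2 t x) \<xi>
    = fourier_product F G t \<xi> / complex_of_real (plancherel_const TYPE(real^'n))"
proof -
  have L2: "F \<in> L2" "G \<in> L2" using F G by (auto simp: is_fourier_L2_def)
  have [measurable]: "F \<in> borel_measurable borel" "G \<in> borel_measurable borel" using F G by auto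
  note [measurable] = free_solution_AE(1)[OF F] free_solution_AE(1)[OF G]
  have "fourier (\<lambda>x. free_solution w1 t x * free_solution w2 t x) \<xi>
      = fourier (\<lambda>x. inverse_fourier (schroedinger_evolution F t) x * inverse_fourier (schroedinger_evolution G t) x) \<xi>"
    unfolding fourier_def
  proof (rule integral_cong_AE)
    show "AE x in lborel. free_solution w1 t x * free_solution w2 t x * exp (- \<i> * complex_of_real (x \<bullet> \<xi>)) =
        inverse_fourier (schroedinger_evolution F t) x * inverse_fourier (schroedinger_evolution G t) x * exp (- \<i> * complex_of_real (x \<bullet> \<xi>))"
      using free_solution_AE(2)[OF F, of t] free_solution_AE(2)[OF G, of t] by eventually_elim simp
  qed measurable
  also have "\<dots> = fourier_product F G t \<xi> / complex_of_real (plancherel_const TYPE(real^'n))"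
    unfolding fourier_product_def
    by (intro fourier_mult_inverse_fourier schroedinger_evolution_integrable_L2 F G L2)
  finally show ?thesis .
qed

text \<open>Plancherel on each time slice, then Tonelli. Of the three factors of the Plancherel
  constant, two come from squaring the transform of the product and one from the isometry. The
  conditions on the slices furnish a candidate for the fractional derivative; without a candidate
  the choice in \<open>frac_laplacian\<close> would carry no information.\<close>

lemma L2norm_frac_laplacian_mult:
  fixes w1 w2 :: "real ^ 'n \<Rightarrow> complex"
  assumes F: "is_fourier_L2 w1 F" "integrable lborel F" and G: "is_fourier_L2 w2 G" "integrable lborel G"
    and int: "\<And>t. integrable lborel (\<lambda>\<xi>. complex_of_real (norm \<xi> powr (2 * \<sigma>)) * fourier_product F G t \<xi>)"
    and L2: "\<And>t. (\<lambda>\<xi>. complex_of_real (norm \<xi> powr (2 * \<sigma>)) * fourier_product F G t \<xi>) \<in> L2"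
  shows "(L2norm (\<lambda>(t, x). frac_laplacian \<sigma> (\<lambda>t x. free_solution w1 t x * free_solution w2 t x) t x))\<^sup>2
    = (\<integral>p. norm (snd p) powr (4 * \<sigma>) * (cmod (fourier_product F G (fst p) (snd p)))\<^sup>2 \<partial>(lborel \<Otimes>\<^sub>M lborel))
      / plancherel_const TYPE(real^'n) ^ 3"
proof -
  let ?C = "plancherel_const TYPE(real^'n)" and ?w = "\<lambda>t x. free_solution w1 t x * free_solution w2 t x"
  have C: "0 < ?C" by (rule plancherel_const_pos)
  have [measurable]: "F \<in> borel_measurable borel" "G \<in> borel_measurable borel" using F G by auto
  define H where "H t \<xi> = complex_of_real (norm \<xi> powr (2 * \<sigma>)) * fourier_product F G t \<xi> / complex_of_real ?C" for t \<xi>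
  have H_eq: "(\<lambda>\<xi>. complex_of_real (norm \<xi> powr (2 * \<sigma>)) * fourier (?w t) \<xi>) = H t" for t
    unfolding fourier_mult_free_solution[OF F G] H_def by (simp add: fun_eq_iff)
  have H_meas [measurable]: "(\<lambda>(t, \<xi>). H t \<xi>) \<in> borel_measurable (borel \<Otimes>\<^sub>M borel)"
    unfolding H_def by measurable
  have H: "integrable lborel (H t)" "H t \<in> L2" for t
    using int[of t] L2_mult[OF L2[of t], of "1 / complex_of_real ?C"] by (auto simp: H_def[abs_def])
  have "is_frac_laplacian \<sigma> ?w (\<lambda>t. inverse_fourier (H t))"
    unfolding is_frac_laplacian_def H_eq
    using measurable_inverse_fourier_param[OF H_meas] is_fourier_L2_inverse_fourier[OF H] by simp
  then have W: "is_frac_laplacian \<sigma> ?w (frac_laplacian \<sigma> ?w)"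
    unfolding frac_laplacian_def by (rule someI[of "is_frac_laplacian \<sigma> ?w"])
  let ?W = "frac_laplacian \<sigma> ?w"
  have [measurable]: "(\<lambda>p. ?W (fst p) (snd p)) \<in> borel_measurable (borel \<Otimes>\<^sub>M borel)"
    using W by (simp add: is_frac_laplacian_def case_prod_beta' borel_prod)
  have slice: "AE t in lborel. is_fourier_L2 (?W t) (H t)"
    using W by (simp add: is_frac_laplacian_def H_eq)
  have "(\<integral>\<^sup>+p. ennreal ((cmod (?W (fst p) (snd p)))\<^sup>2) \<partial>(lborel \<Otimes>\<^sub>M lborel))
      = (\<integral>\<^sup>+t. (\<integral>\<^sup>+x. ennreal ((cmod (?W t x))\<^sup>2) \<partial>lborel) \<partial>lborel)"
    by (subst lborel.nn_integral_fst[symmetric]) auto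
  also have "\<dots> = (\<integral>\<^sup>+t. (\<integral>\<^sup>+\<xi>. ennreal ((cmod (H t \<xi>))\<^sup>2 / ?C) \<partial>lborel) \<partial>lborel)"
  proof (rule nn_integral_cong_AE, use slice in eventually_elim)
    fix t assume t: "is_fourier_L2 (?W t) (H t)"
    then have L2: "?W t \<in> L2" "H t \<in> L2" by (auto simp: is_fourier_L2_def)
    have "(L2norm (?W t))\<^sup>2 = (\<integral>\<xi>. (cmod (H t \<xi>))\<^sup>2 / ?C \<partial>lborel)"
      using is_fourier_L2_norm[OF t] L2norm_sq[of "H t"] C by (simp add: power_mult_distrib field_simps)
    then have "(\<integral>\<^sup>+x. ennreal ((cmod (?W t x))\<^sup>2) \<partial>lborel) = ennreal (\<integral>\<xi>. (cmod (H t \<xi>))\<^sup>2 / ?C \<partial>lborel)"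
      using nn_integral_L2[OF L2(1)] by simp
    also have "\<dots> = (\<integral>\<^sup>+\<xi>. ennreal ((cmod (H t \<xi>))\<^sup>2 / ?C) \<partial>lborel)"
      using L2_D[OF L2(2)] C by (intro nn_integral_eq_integral[symmetric]) auto
    finally show "(\<integral>\<^sup>+x. ennreal ((cmod (?W t x))\<^sup>2) \<partial>lborel) = (\<integral>\<^sup>+\<xi>. ennreal ((cmod (H t \<xi>))\<^sup>2 / ?C) \<partial>lborel)" .
  qed
  also have "\<dots> = (\<integral>\<^sup>+p. ennreal ((cmod (H (fst p) (snd p)))\<^sup>2 / ?C) \<partial>(lborel \<Otimes>\<^sub>M lborel))"
    by (subst lborel.nn_integral_fst[symmetric]) auto
  finally have "(\<integral>p. (cmod (?W (fst p) (snd p)))\<^sup>2 \<partial>(lborel \<Otimes>\<^sub>M lborel)) = (\<integral>p. (cmod (H (fst p) (snd p)))\<^sup>2 / ?C \<partial>(lborel \<Otimes>\<^sub>M lborel))"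
    \<comment> \<open>An infinite value would be read as 0 on both sides, so the identity holds
      whether or not the integrals are finite.\<close>
    by (subst (1 2) integral_eq_nn_integral) (use C in auto)
  moreover have "(L2norm (\<lambda>(t, x). ?W t x))\<^sup>2 = (\<integral>p. (cmod (?W (fst p) (snd p)))\<^sup>2 \<partial>(lborel \<Otimes>\<^sub>M lborel))"
    by (simp add: L2norm_sq lborel_prod case_prod_beta')
  moreover have "(cmod (H t \<xi>))\<^sup>2 / ?C = norm \<xi> powr (4 * \<sigma>) * (cmod (fourier_product F G t \<xi>))\<^sup>2 / ?C ^ 3" for t \<xi>
    using C by (simp add: H_def norm_mult norm_divide power_mult_distrib power_divide power2_eq_square[of "_ powr _"]
        power3_eq_cube power2_eq_square[of ?C] flip: powr_add)
  ultimately show ?thesis by simp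
qed

section \<open>First variations\<close>

lemma fourier_product_integrable:
  fixes F G :: "real ^ 'n \<Rightarrow> complex"
  assumes F: "F \<in> L2" and G: "G \<in> L2"
  shows "integrable lborel (\<lambda>\<eta>. schroedinger_evolution F t \<eta> * schroedinger_evolution G t (\<xi> - \<eta>))"
proof -
  have [measurable]: "F \<in> borel_measurable borel" "G \<in> borel_measurable borel" using F G by (auto simp: L2_def)
  have "schroedinger_evolution F t \<in> L2" using F by (simp add: L2_def)
  moreover have "(\<lambda>\<eta>. cnj (schroedinger_evolution G t (\<xi> - \<eta>))) \<in> L2"
    using integrable_lborel_affine[OF L2_D(2)[OF G], of "-1" \<xi>] by (simp add: L2_def)
  ultimately show ?thesis using L2_mult_integrable by fastforce
qed

lemma fourier_product_linear:
  fixes F F' G :: "real ^ 'n \<Rightarrow> complex"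
  assumes "F \<in> L2" "F' \<in> L2" "G \<in> L2"
  shows "fourier_product (\<lambda>\<eta>. F \<eta> + e * F' \<eta>) (\<lambda>\<eta>. c * G \<eta>) t \<xi> = c * (fourier_product F G t \<xi> + e * fourier_product F' G t \<xi>)"
proof -
  have "schroedinger_evolution (\<lambda>\<eta>. F \<eta> + e * F' \<eta>) t \<eta> * schroedinger_evolution (\<lambda>\<eta>. c * G \<eta>) t (\<xi> - \<eta>)
     = c * (schroedinger_evolution F t \<eta> * schroedinger_evolution G t (\<xi> - \<eta>)
       + e * (schroedinger_evolution F' t \<eta> * schroedinger_evolution G t (\<xi> - \<eta>)))" for \<eta>
    by (simp add: schroedinger_evolution_def algebra_simps)
  then show ?thesis
    using fourier_product_integrable[OF assms(1,3), of t \<xi>] fourier_product_integrable[OF assms(2,3), of t \<xi>]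
    by (simp add: fourier_product_def)
qed

text \<open>Let U be the inverse transform of Q. Along \<open>u + \<epsilon> U\<close>, with v
  fixed, numerator and denominator are, up to constants, square roots of quadratic polynomials in
  \<epsilon>. With the abbreviations of the proof, the logarithmic derivative of the quotient at 0
  is \<open>n1 / n0 - d1 / d0\<close>, and \<open>ne\<close> says that it is not 0. The scalar c
  enters only through an overall constant.\<close>

lemma not_critical_if_first_variation:
  fixes u v G Q :: "real ^ 'n \<Rightarrow> complex" and \<sigma> :: real
  defines "\<sigma> \<equiv> (2 - real CARD('n)) / 4"
  defines "A \<equiv> \<lambda>p. fourier_product G G (fst p) (snd p)"
    and "B \<equiv> \<lambda>p. fourier_product Q G (fst p) (snd p)"
    and "W \<equiv> \<lambda>p::real \<times> (real ^ 'n). norm (snd p) powr (4 * \<sigma>)"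
  assumes v: "v \<in> L2"
    and uG: "is_fourier_L2 u G" and c: "c \<noteq> 0" and vu: "AE x in lborel. v x = c * u x"
    and G: "integrable lborel G" and Q: "integrable lborel Q" "Q \<in> L2"
    and A: "\<And>t. integrable lborel (\<lambda>\<xi>. complex_of_real (norm \<xi> powr (2 * \<sigma>)) * fourier_product G G t \<xi>)"
      "\<And>t. (\<lambda>\<xi>. complex_of_real (norm \<xi> powr (2 * \<sigma>)) * fourier_product G G t \<xi>) \<in> L2"
    and B: "\<And>t. integrable lborel (\<lambda>\<xi>. complex_of_real (norm \<xi> powr (2 * \<sigma>)) * fourier_product Q G t \<xi>)"
      "\<And>t. (\<lambda>\<xi>. complex_of_real (norm \<xi> powr (2 * \<sigma>)) * fourier_product Q G t \<xi>) \<in> L2"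
    and int0: "integrable (lborel \<Otimes>\<^sub>M lborel) (\<lambda>p. W p * (cmod (A p))\<^sup>2)"
    and int1: "integrable (lborel \<Otimes>\<^sub>M lborel) (\<lambda>p. W p * Re (B p * cnj (A p)))"
    and int2: "integrable (lborel \<Otimes>\<^sub>M lborel) (\<lambda>p. W p * (cmod (B p))\<^sup>2)"
    and pos: "0 < (\<integral>p. W p * (cmod (A p))\<^sup>2 \<partial>(lborel \<Otimes>\<^sub>M lborel))" "0 < (\<integral>\<eta>. (cmod (G \<eta>))\<^sup>2 \<partial>lborel)"
    and ne: "(\<integral>p. W p * Re (B p * cnj (A p)) \<partial>(lborel \<Otimes>\<^sub>M lborel)) * (\<integral>\<eta>. (cmod (G \<eta>))\<^sup>2 \<partial>lborel)
      \<noteq> (\<integral>p. W p * (cmod (A p))\<^sup>2 \<partial>(lborel \<Otimes>\<^sub>M lborel)) * Re (\<integral>\<eta>. Q \<eta> * cnj (G \<eta>) \<partial>lborel)"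
  shows "\<not> is_critical_point bilinear_functional u v"
proof
  assume crit: "is_critical_point bilinear_functional u v"
  let ?C = "plancherel_const TYPE(real^'n)"
  have C: "0 < ?C" by (rule plancherel_const_pos)
  have u: "u \<in> L2" and GL2: "G \<in> L2" using uG by (auto simp: is_fourier_L2_def)
  have [measurable]: "u \<in> borel_measurable borel" "v \<in> borel_measurable borel" "G \<in> borel_measurable borel"
    using u v GL2 by (auto simp: L2_def)
  define U where "U = inverse_fourier Q"
  have UQ: "is_fourier_L2 U Q" unfolding U_def by (rule is_fourier_L2_inverse_fourier[OF Q])
  have UL2: "U \<in> L2" using UQ by (simp add: is_fourier_L2_def)
  define n0 where "n0 = (\<integral>p. W p * (cmod (A p))\<^sup>2 \<partial>(lborel \<Otimes>\<^sub>M lborel))"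
  define n1 where "n1 = (\<integral>p. W p * Re (B p * cnj (A p)) \<partial>(lborel \<Otimes>\<^sub>M lborel))"
  define n2 where "n2 = (\<integral>p. W p * (cmod (B p))\<^sup>2 \<partial>(lborel \<Otimes>\<^sub>M lborel))"
  define d0 where "d0 = (\<integral>\<eta>. (cmod (G \<eta>))\<^sup>2 \<partial>lborel)"
  define d1 where "d1 = Re (\<integral>\<eta>. Q \<eta> * cnj (G \<eta>) \<partial>lborel)"
  define d2 where "d2 = (L2norm Q)\<^sup>2"
  have n0: "0 < n0" and d0: "0 < d0" and ne': "n1 * d0 - n0 * d1 \<noteq> 0"
    using pos ne by (simp_all add: n0_def d0_def n1_def d1_def)
  define f where "f \<epsilon> = bilinear_functional (\<lambda>x. u x + complex_of_real \<epsilon> * U x) v" for \<epsilon>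
  \<comment> \<open>The numerator carries the Plancherel constant to the power -3/2 and the norm of
    the perturbed datum carries it to the power -1/2, so the quotient keeps the power -1.\<close>
  define K where "K = cmod c / (?C * L2norm v)"
  have uF: "is_fourier_L2 (\<lambda>x. u x + complex_of_real \<epsilon> * U x) (\<lambda>\<eta>. G \<eta> + complex_of_real \<epsilon> * Q \<eta>)" for \<epsilon>
    by (rule is_fourier_L2_add_mult[OF uG UQ])
  have cF: "is_fourier_L2 (\<lambda>x. c * u x) (\<lambda>\<eta>. c * G \<eta>)"
    using is_fourier_L2_add_mult[OF uG uG, of "c - 1"] by (simp add: algebra_simps)
  have vF: "is_fourier_L2 v (\<lambda>\<eta>. c * G \<eta>)"
    by (rule is_fourier_L2_cong_AE[OF cF]) (use vu in auto)
  have prod: "fourier_product (\<lambda>\<eta>. G \<eta> + complex_of_real \<epsilon> * Q \<eta>) (\<lambda>\<eta>. c * G \<eta>) t \<xi>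
      = c * (fourier_product G G t \<xi> + complex_of_real \<epsilon> * fourier_product Q G t \<xi>)" for \<epsilon> t \<xi>
    by (rule fourier_product_linear[OF GL2 Q(2) GL2])
  have num: "(L2norm (\<lambda>(t, x). frac_laplacian \<sigma> (\<lambda>t x. free_solution (\<lambda>x. u x + complex_of_real \<epsilon> * U x) t x * free_solution v t x) t x))\<^sup>2
      = (cmod c)\<^sup>2 * (n0 + 2 * \<epsilon> * n1 + \<epsilon>\<^sup>2 * n2) / ?C ^ 3" for \<epsilon>
  proof -
    have split: "complex_of_real (norm \<xi> powr (2 * \<sigma>)) * fourier_product (\<lambda>\<eta>. G \<eta> + complex_of_real \<epsilon> * Q \<eta>) (\<lambda>\<eta>. c * G \<eta>) t \<xi>
        = c * (complex_of_real (norm \<xi> powr (2 * \<sigma>)) * fourier_product G G t \<xi>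
          + complex_of_real \<epsilon> * (complex_of_real (norm \<xi> powr (2 * \<sigma>)) * fourier_product Q G t \<xi>))" for t \<xi>
      unfolding prod by (simp add: algebra_simps)
    have "(L2norm (\<lambda>(t, x). frac_laplacian \<sigma> (\<lambda>t x. free_solution (\<lambda>x. u x + complex_of_real \<epsilon> * U x) t x * free_solution v t x) t x))\<^sup>2
      = (\<integral>p. norm (snd p) powr (4 * \<sigma>) * (cmod (fourier_product (\<lambda>\<eta>. G \<eta> + complex_of_real \<epsilon> * Q \<eta>) (\<lambda>\<eta>. c * G \<eta>) (fst p) (snd p)))\<^sup>2
          \<partial>(lborel \<Otimes>\<^sub>M lborel)) / ?C ^ 3"
    proof (rule L2norm_frac_laplacian_mult[OF uF _ vF])
      show "integrable lborel (\<lambda>\<eta>. G \<eta> + complex_of_real \<epsilon> * Q \<eta>)" "integrable lborel (\<lambda>\<eta>. c * G \<eta>)"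
        using G Q by auto
      show "integrable lborel (\<lambda>\<xi>. complex_of_real (norm \<xi> powr (2 * \<sigma>)) * fourier_product (\<lambda>\<eta>. G \<eta> + complex_of_real \<epsilon> * Q \<eta>) (\<lambda>\<eta>. c * G \<eta>) t \<xi>)" for t
        unfolding split using A(1)[of t] B(1)[of t] by (intro integrable_mult_right Bochner_Integration.integrable_add) auto
      show "(\<lambda>\<xi>. complex_of_real (norm \<xi> powr (2 * \<sigma>)) * fourier_product (\<lambda>\<eta>. G \<eta> + complex_of_real \<epsilon> * Q \<eta>) (\<lambda>\<eta>. c * G \<eta>) t \<xi>) \<in> L2" for t
        unfolding split by (intro L2_mult L2_add A B)
    qed
    also have "(\<integral>p. norm (snd p) powr (4 * \<sigma>) * (cmod (fourier_product (\<lambda>\<eta>. G \<eta> + complex_of_real \<epsilon> * Q \<eta>) (\<lambda>\<eta>. c * G \<eta>) (fst p) (snd p)))\<^sup>2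
          \<partial>(lborel \<Otimes>\<^sub>M lborel))
        = (\<integral>p. (cmod c)\<^sup>2 * (W p * (cmod (A p))\<^sup>2 + 2 * \<epsilon> * (W p * Re (B p * cnj (A p))) + \<epsilon>\<^sup>2 * (W p * (cmod (B p))\<^sup>2)) \<partial>(lborel \<Otimes>\<^sub>M lborel))"
    proof (rule Bochner_Integration.integral_cong[OF refl])
      fix p :: "real \<times> (real ^ 'n)"
      have *: "(cmod (z + complex_of_real \<epsilon> * w))\<^sup>2 = (cmod z)\<^sup>2 + 2 * \<epsilon> * Re (w * cnj z) + \<epsilon>\<^sup>2 * (cmod w)\<^sup>2" for z w
        by (simp add: cmod_power2 power2_sum algebra_simps)
      show "norm (snd p) powr (4 * \<sigma>) * (cmod (fourier_product (\<lambda>\<eta>. G \<eta> + complex_of_real \<epsilon> * Q \<eta>) (\<lambda>\<eta>. c * G \<eta>) (fst p) (snd p)))\<^sup>2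
          = (cmod c)\<^sup>2 * (W p * (cmod (A p))\<^sup>2 + 2 * \<epsilon> * (W p * Re (B p * cnj (A p))) + \<epsilon>\<^sup>2 * (W p * (cmod (B p))\<^sup>2))"
        unfolding prod A_def B_def W_def norm_mult power_mult_distrib * by (simp only: algebra_simps)
    qed
    also have "\<dots> = (cmod c)\<^sup>2 * (n0 + 2 * \<epsilon> * n1 + \<epsilon>\<^sup>2 * n2)"
      unfolding n0_def n1_def n2_def using int0 int1 int2 by simp
    finally show ?thesis .
  qed
  have den: "(L2norm (\<lambda>x. u x + complex_of_real \<epsilon> * U x))\<^sup>2 = (d0 + 2 * \<epsilon> * d1 + \<epsilon>\<^sup>2 * d2) / ?C" for \<epsilon>
  proof -
    have "?C * (L2norm (\<lambda>x. u x + complex_of_real \<epsilon> * U x))\<^sup>2 = (L2norm (\<lambda>\<eta>. G \<eta> + complex_of_real \<epsilon> * Q \<eta>))\<^sup>2"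
      using is_fourier_L2_norm[OF uF[of \<epsilon>]] C by (simp add: power_mult_distrib)
    also have "\<dots> = (L2norm (\<lambda>\<eta>. complex_of_real \<epsilon> * Q \<eta> + G \<eta>))\<^sup>2" by (simp add: add.commute)
    also have "\<dots> = (L2norm (\<lambda>\<eta>. complex_of_real \<epsilon> * Q \<eta>))\<^sup>2 + (L2norm G)\<^sup>2
        + 2 * Re (\<integral>\<eta>. complex_of_real \<epsilon> * Q \<eta> * cnj (G \<eta>) \<partial>lborel)"
      by (intro L2norm_add_sq L2_mult Q GL2)
    also have "(\<integral>\<eta>. complex_of_real \<epsilon> * Q \<eta> * cnj (G \<eta>) \<partial>lborel) = complex_of_real \<epsilon> * (\<integral>\<eta>. Q \<eta> * cnj (G \<eta>) \<partial>lborel)"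
      by (simp add: mult.assoc)
    finally show ?thesis
      using C unfolding L2norm_mult power_mult_distrib
      by (simp add: d0_def d1_def d2_def L2norm_sq[of G] field_simps)
  qed
  have f_eq: "f \<epsilon> = K * sqrt (n0 + 2 * \<epsilon> * n1 + \<epsilon>\<^sup>2 * n2) / sqrt (d0 + 2 * \<epsilon> * d1 + \<epsilon>\<^sup>2 * d2)" for \<epsilon>
  proof -
    have "L2norm (\<lambda>(t, x). frac_laplacian \<sigma> (\<lambda>t x. free_solution (\<lambda>x. u x + complex_of_real \<epsilon> * U x) t x * free_solution v t x) t x)
        = sqrt ((cmod c)\<^sup>2 * (n0 + 2 * \<epsilon> * n1 + \<epsilon>\<^sup>2 * n2) / ?C ^ 3)"
      unfolding num[symmetric] by simp
    moreover have "L2norm (\<lambda>x. u x + complex_of_real \<epsilon> * U x) = sqrt ((d0 + 2 * \<epsilon> * d1 + \<epsilon>\<^sup>2 * d2) / ?C)"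
      unfolding den[symmetric] by simp
    moreover have "sqrt (?C ^ 3) = ?C * sqrt ?C"
      using C by (simp add: power3_eq_cube real_sqrt_mult)
    ultimately show ?thesis
      using C unfolding f_def bilinear_functional_def \<sigma>_def[symmetric] K_def
      by (simp add: real_sqrt_mult real_sqrt_divide)
  qed
  have K: "K \<noteq> 0"
  proof -
    have "L2norm v \<noteq> 0"
    proof
      assume "L2norm v = 0"
      then have "cmod c * L2norm G = 0"
        using is_fourier_L2_norm[OF vF] by (simp add: L2norm_mult)
      then show False using c d0 L2norm_sq[of G] by (simp add: d0_def)
    qed
    then show ?thesis using c C by (simp add: K_def)
  qed
  have "((\<lambda>\<epsilon>. K * sqrt (n0 + 2 * \<epsilon> * n1 + \<epsilon>\<^sup>2 * n2) / sqrt (d0 + 2 * \<epsilon> * d1 + \<epsilon>\<^sup>2 * d2))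
      has_real_derivative K * (n1 / sqrt n0 * sqrt d0 - sqrt n0 * (d1 / sqrt d0)) / d0) (at 0)"
    using n0 d0 by (auto intro!: derivative_eq_intros simp: field_simps)
  moreover have "((\<lambda>\<epsilon>. f \<epsilon>) has_real_derivative 0) (at 0)"
  proof -
    \<comment> \<open>Criticality is tested with the second perturbation equal to 0.\<close>
    have "((\<lambda>\<epsilon>. (bilinear_functional (\<lambda>x. u x + complex_of_real \<epsilon> * U x) (\<lambda>x. v x + complex_of_real \<epsilon> * 0)
        - bilinear_functional u v) / \<epsilon>) \<longlongrightarrow> 0) (at 0)"
    proof -
      have "(\<lambda>_. 0) \<in> L2" by (simp add: L2_def)
      from bspec[OF bspec[OF crit[unfolded is_critical_point_def] UL2] this] show ?thesis .
    qed
    then show ?thesis by (simp add: has_field_derivative_iff f_def)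
  qed
  ultimately have "K * (n1 / sqrt n0 * sqrt d0 - sqrt n0 * (d1 / sqrt d0)) / d0 = 0"
    unfolding f_eq by (rule DERIV_unique)
  then have "n1 / sqrt n0 * sqrt d0 = sqrt n0 * (d1 / sqrt d0)" using K d0 by simp
  then have "n1 * (sqrt d0 * sqrt d0) = (sqrt n0 * sqrt n0) * d1"
    using n0 d0 by (simp add: field_simps)
  then show False using n0 d0 ne' by simp
qed

section \<open>Gaussian initial data\<close>

lemma
  fixes f :: "'a::euclidean_space \<Rightarrow> real" and g :: "'b::euclidean_space \<Rightarrow> real"
  assumes f: "integrable lborel f" and g: "integrable lborel g"
  shows integrable_pair_product: "integrable (lborel \<Otimes>\<^sub>M lborel) (\<lambda>p. f (fst p) * g (snd p))"
    and integral_pair_product: "(\<integral>p. f (fst p) * g (snd p) \<partial>(lborel \<Otimes>\<^sub>M lborel)) = (\<integral>x. f x \<partial>lborel) * (\<integral>y. g y \<partial>lborel)"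
proof -
  have [measurable]: "f \<in> borel_measurable borel" "g \<in> borel_measurable borel" using f g by auto
  show int: "integrable (lborel \<Otimes>\<^sub>M lborel) (\<lambda>p. f (fst p) * g (snd p))"
  proof (rule lborel_pair.Fubini_integrable)
    show "integrable lborel (\<lambda>x. \<integral>y. norm (f (fst (x, y)) * g (snd (x, y))) \<partial>lborel)"
      using f by (simp add: abs_mult)
    show "AE x in lborel. integrable lborel (\<lambda>y. f (fst (x, y)) * g (snd (x, y)))"
      using g by simp
  qed measurable
  show "(\<integral>p. f (fst p) * g (snd p) \<partial>(lborel \<Otimes>\<^sub>M lborel)) = (\<integral>x. f x \<partial>lborel) * (\<integral>y. g y \<partial>lborel)"
    using lborel_pair.integral_fst'[OF int] by simp
qed

lemma exp_neg_norm_diff_sq_le: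
  fixes x v :: "'a::real_inner"
  assumes "0 \<le> \<delta>"
  shows "rgauss \<delta> (x - v) \<le> exp (\<delta> * (norm v)\<^sup>2) * rgauss (\<delta> / 2) x"
proof -
  have "\<delta> * ((norm x)\<^sup>2 / 2 - (norm v)\<^sup>2) \<le> \<delta> * (norm (x - v))\<^sup>2"
    using norm_add_sq_lower[of x "- v"] assms by (intro mult_left_mono) auto
  then show ?thesis by (simp add: algebra_simps flip: exp_add)
qed

lemma integrable_power_shifted_gaussian:
  fixes v :: "'a::euclidean_space"
  assumes "0 < \<delta>"
  shows "integrable lborel (\<lambda>x. (1 + norm x) ^ k * rgauss \<delta> (x - v))"
proof (rule Bochner_Integration.integrable_bound)
  show "integrable lborel (\<lambda>x::'a. exp (\<delta> * (norm v)\<^sup>2) * ((1 + norm x) ^ k * rgauss (\<delta> / 2) x))"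
    using assms by (intro integrable_mult_right integrable_power_mult_gaussian) simp
  show "AE x in lborel. norm ((1 + norm x) ^ k * rgauss \<delta> (x - v))
      \<le> norm (exp (\<delta> * (norm v)\<^sup>2) * ((1 + norm x) ^ k * rgauss (\<delta> / 2) x))" (is "AE x in _. ?B x")
  proof (rule AE_I2)
    fix x :: 'a
    show "?B x"
      using mult_left_mono[OF exp_neg_norm_diff_sq_le[of \<delta> x v], of "(1 + norm x) ^ k"] assms
      by (simp add: abs_mult power_abs mult.left_commute)
  qed
qed measurable

text \<open>Inside the unit ball the polynomial and the Gaussian are bounded and the power is
  integrable; outside, the power is at most 1 because p < 0.\<close>

lemma integrable_singular_shifted_gaussian:
  fixes v :: "'a::euclidean_space"
  assumes p: "1 - real DIM('a) \<le> p" "p < 0" and \<delta>: "0 < \<delta>"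
  shows "integrable lborel (\<lambda>x. norm x powr p * (1 + norm x) ^ k * rgauss \<delta> (x - v))"
proof (rule Bochner_Integration.integrable_bound)
  let ?g = "\<lambda>x. 2 ^ k * (indicator (cball 0 1) x * norm x powr p) + (1 + norm x) ^ k * rgauss \<delta> (x - v)"
  show "integrable lborel ?g"
    by (intro Bochner_Integration.integrable_add integrable_mult_right integrable_norm_powr_cball[OF p]
        integrable_power_shifted_gaussian[OF \<delta>])
  show "AE x in lborel. norm (norm x powr p * (1 + norm x) ^ k * rgauss \<delta> (x - v)) \<le> norm (?g x)"
  proof (rule AE_I2)
    fix x :: 'a
    let ?l = "norm x powr p * (1 + norm x) ^ k * rgauss \<delta> (x - v)"
    have "?l \<le> ?g x"
    proof (cases "norm x \<le> 1")
      case True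
      have "?l \<le> norm x powr p * 2 ^ k * 1"
        using True \<delta> by (intro mult_mono power_mono) auto
      also have "\<dots> \<le> ?g x" using True by simp
      finally show ?thesis .
    next
      case False
      then have "norm x powr p \<le> 1" using p by (simp add: powr_less_one less_imp_le)
      then have "norm x powr p * ((1 + norm x) ^ k * rgauss \<delta> (x - v)) \<le> 1 * ((1 + norm x) ^ k * rgauss \<delta> (x - v))"
        by (intro mult_right_mono) auto
      also have "\<dots> \<le> ?g x" by simp
      finally show ?thesis by (simp add: mult.assoc)
    qed
    moreover have "0 \<le> ?l" "0 \<le> ?g x" by auto
    ultimately show "norm ?l \<le> norm (?g x)" by simp
  qed
qed measurable

lemma integral_pos_if_AE_pos:
  fixes f :: "'a::euclidean_space \<Rightarrow> real"
  assumes f: "integrable lborel f" "AE x in lborel. 0 < f x"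
  shows "0 < (\<integral>x. f x \<partial>lborel)"
proof -
  have nonneg: "AE x in lborel. 0 \<le> f x" using f(2) by eventually_elim simp
  have "(\<integral>x. f x \<partial>lborel) \<noteq> 0"
  proof
    assume "(\<integral>x. f x \<partial>lborel) = 0"
    then have "AE x in lborel. f x = 0" using integral_nonneg_eq_0_iff_AE[OF f(1) nonneg] by simp
    with f(2) have "AE x::'a in lborel. False" by eventually_elim simp
    then show False by (simp add: trivial_limit_def[symmetric] ae_filter_eq_bot_iff)
  qed
  moreover have "0 \<le> (\<integral>x. f x \<partial>lborel)" by (rule integral_nonneg_AE[OF nonneg])
  ultimately show ?thesis by linarith
qed

section \<open>Integrals in time of powers of a quadratic\<close>

lemma integrable_powr_quadratic:
  fixes \<alpha> \<tau> q :: real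
  assumes \<alpha>: "0 < \<alpha>" and q: "1 \<le> q"
  shows "integrable lborel (\<lambda>t. (\<alpha>\<^sup>2 + (t - \<tau>)\<^sup>2) powr - q)"
proof -
  have "integrable lborel (\<lambda>t::real. inverse (1 + t\<^sup>2))"
    using integrable_inverse_1_plus_square by (simp add: set_integrable_def)
  then have "integrable lborel (\<lambda>t. (\<alpha>\<^sup>2) powr - q * inverse (1 + (- (\<tau> / \<alpha>) + 1 / \<alpha> * t)\<^sup>2))"
    using \<alpha> by (intro integrable_mult_right lborel_integrable_real_affine) auto
  then show ?thesis
  proof (rule Bochner_Integration.integrable_bound)
    show "AE t in lborel. norm ((\<alpha>\<^sup>2 + (t - \<tau>)\<^sup>2) powr - q)
        \<le> norm ((\<alpha>\<^sup>2) powr - q * inverse (1 + (- (\<tau> / \<alpha>) + 1 / \<alpha> * t)\<^sup>2))" (is "AE t in _. ?B t")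
    proof (rule AE_I2)
      fix t :: real
      define y where "y = 1 + (- (\<tau> / \<alpha>) + 1 / \<alpha> * t)\<^sup>2"
      have y: "1 \<le> y" by (simp add: y_def)
      have "\<alpha>\<^sup>2 + (t - \<tau>)\<^sup>2 = \<alpha>\<^sup>2 * y"
        using \<alpha> unfolding y_def by (simp add: power2_eq_square field_simps)
      then have "(\<alpha>\<^sup>2 + (t - \<tau>)\<^sup>2) powr - q = (\<alpha>\<^sup>2) powr - q * y powr - q"
        using y by (simp add: powr_mult)
      also have "\<dots> \<le> (\<alpha>\<^sup>2) powr - q * y powr - 1"
        using y q by (intro mult_left_mono powr_mono) auto
      also have "y powr - 1 = inverse y" using y by (simp add: powr_minus)
      finally show "?B t"
        using y by (simp add: y_def abs_mult)
    qed
  qed measurable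
qed

text \<open>With \<open>r = \<alpha>^2 + (t - \<tau>)^2\<close>, the function
  \<open>(t - \<tau>) r^(-q)\<close> has derivative
  \<open>(1 - 2 q) r^(-q) + 2 q \<alpha>^2 r^(-(q+1))\<close>, obtained from
  \<open>(t - \<tau>)^2 = r - \<alpha>^2\<close>, and the integral of this derivative vanishes. The
  function itself is bounded by \<open>r^(-(q - 1/2))\<close>, for which integrability is known once
  \<open>q - 1/2 \<ge> 1\<close>; for q = d/2 this reads d \<ge> 3.\<close>

lemma integral_powr_quadratic_recurrence:
  fixes \<alpha> \<tau> q :: real
  assumes \<alpha>: "0 < \<alpha>" and q: "3 / 2 \<le> q"
  shows "2 * q * \<alpha>\<^sup>2 * (\<integral>t. (\<alpha>\<^sup>2 + (t - \<tau>)\<^sup>2) powr - (q + 1) \<partial>lborel)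
    = (2 * q - 1) * (\<integral>t. (\<alpha>\<^sup>2 + (t - \<tau>)\<^sup>2) powr - q \<partial>lborel)"
proof -
  define r where "r t = \<alpha>\<^sup>2 + (t - \<tau>)\<^sup>2" for t
  have r: "0 < r t" "\<alpha>\<^sup>2 \<le> r t" "(t - \<tau>)\<^sup>2 \<le> r t" for t using \<alpha> by (auto simp: r_def add_pos_nonneg)
  have [measurable]: "r \<in> borel_measurable borel" unfolding r_def by measurable
  define f' where "f' t = (1 - 2 * q) * r t powr - q + 2 * q * \<alpha>\<^sup>2 * r t powr - (q + 1)" for t
  have bound: "\<bar>f' t\<bar> \<le> (4 * q) * r t powr - q" for t
  proof -
    have "\<alpha>\<^sup>2 * r t powr - (q + 1) \<le> r t * r t powr - (q + 1)"
      using r(2)[of t] by (intro mult_right_mono) auto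
    also have "\<dots> = r t powr - q" using r(1)[of t] by (simp add: powr_mult_base)
    finally have "2 * q * (\<alpha>\<^sup>2 * r t powr - (q + 1)) \<le> 2 * q * r t powr - q"
      using q by (intro mult_left_mono) auto
    moreover have "0 \<le> 2 * q * (\<alpha>\<^sup>2 * r t powr - (q + 1))" using q by simp
    moreover have "\<bar>(1 - 2 * q) * r t powr - q\<bar> \<le> 2 * q * r t powr - q"
      using q by (simp add: abs_mult mult_right_mono)
    ultimately show ?thesis unfolding f'_def by (simp add: mult.assoc)
  qed
  have int: "integrable lborel (\<lambda>t. r t powr - p)" if "1 \<le> p" for p
    unfolding r_def by (rule integrable_powr_quadratic[OF \<alpha> that])
  have "(\<integral>t. f' t \<partial>lborel) = 0"
  \<comment> \<open>For |h| < \<alpha>/2 one has \<open>r t / 2 \<le> r (t + h)\<close>, so a shift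
    costs at most the factor \<open>2 powr q\<close>.\<close>
  proof (rule has_vector_derivative_translation_imp_integral_eq_0[where \<delta> = "\<alpha> / 2" and v = "1::real"
        and f = "\<lambda>t. (t - \<tau>) * r t powr - q" and g = "\<lambda>t. (4 * q) * (2 powr q * r t powr - q)"])
    show "integrable lborel (\<lambda>t. (t - \<tau>) * r t powr - q)"
    proof (rule Bochner_Integration.integrable_bound[OF int[of "q - 1 / 2"]])
      show "AE t in lborel. norm ((t - \<tau>) * r t powr - q) \<le> norm (r t powr - (q - 1 / 2))" (is "AE t in _. ?B t")
      proof (rule AE_I2)
        fix t
        have "\<bar>t - \<tau>\<bar> \<le> sqrt (r t)" using r(3)[of t] by (metis real_sqrt_abs real_sqrt_le_iff)
        then have "\<bar>t - \<tau>\<bar> * r t powr - q \<le> r t powr (1 / 2) * r t powr - q"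
          using r(1)[of t] by (intro mult_right_mono) (auto simp: powr_half_sqrt)
        then show "?B t"
          by (simp add: abs_mult flip: powr_add)
      qed
    qed (use q in auto)
    show "((\<lambda>h. (t + h *\<^sub>R 1 - \<tau>) * r (t + h *\<^sub>R 1) powr - q) has_vector_derivative f' t) (at 0)" for t
    proof -
      have rq: "r t powr - q = r t * r t powr - (q + 1)" using r(1)[of t] by (simp add: powr_mult_base)
      have "((\<lambda>h. (t + h - \<tau>) * r (t + h) powr - q) has_real_derivative
          r t powr - q + (t - \<tau>) * (- q * r t powr (- q - 1) * (2 * (t - \<tau>)))) (at 0)"
        unfolding r_def using r(1)[of t, unfolded r_def]
        by (auto intro!: derivative_eq_intros simp: powr_diff)
      also have "r t powr - q + (t - \<tau>) * (- q * r t powr (- q - 1) * (2 * (t - \<tau>))) = f' t"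
      proof -
        have "- q - 1 = - (q + 1)" by simp
        then show ?thesis unfolding f'_def rq by (simp only:) (simp add: r_def power2_eq_square algebra_simps)
      qed
      finally show ?thesis by (simp add: has_real_derivative_iff_has_vector_derivative)
    qed
    show "norm (f' (t + h *\<^sub>R 1)) \<le> (4 * q) * (2 powr q * r t powr - q)" if "\<bar>h\<bar> < \<alpha> / 2" for h t
    proof -
      have "h\<^sup>2 \<le> (\<alpha> / 2)\<^sup>2" using that by (intro abs_le_square_iff[THEN iffD1]) auto
      then have "h\<^sup>2 \<le> \<alpha>\<^sup>2 / 2" by (simp add: power_divide) (smt (verit) zero_le_power2)
      then have "r t / 2 \<le> r (t + h)"
        using norm_add_sq_lower[of "t - \<tau>" h] by (simp add: r_def algebra_simps)
      then have "r (t + h) powr - q \<le> (r t / 2) powr - q"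
        using r(1)[of t] q by (intro powr_mono2') auto
      also have "\<dots> = 2 powr q * r t powr - q"
        using r(1)[of t] by (simp add: powr_divide powr_minus divide_simps)
      finally have "(4 * q) * r (t + h) powr - q \<le> (4 * q) * (2 powr q * r t powr - q)"
        using q by (intro mult_left_mono) auto
      then show ?thesis using bound[of "t + h"] by simp
    qed
    show "f' \<in> borel_measurable borel" unfolding f'_def by measurable
    show "integrable lborel (\<lambda>t. (4 * q) * (2 powr q * r t powr - q))"
      using q by (intro integrable_mult_right int) auto
  qed (use \<alpha> in auto)
  then have "(1 - 2 * q) * (\<integral>t. r t powr - q \<partial>lborel) + 2 * q * \<alpha>\<^sup>2 * (\<integral>t. r t powr - (q + 1) \<partial>lborel) = 0"
    unfolding f'_def using int[of q] int[of "q + 1"] q by simp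
  moreover have "(1 - 2 * q) * x + 2 * q * \<alpha>\<^sup>2 * y = 0 \<Longrightarrow> 2 * q * \<alpha>\<^sup>2 * y = (2 * q - 1) * x" for x y
    by (simp add: algebra_simps)
  ultimately show ?thesis by (simp only: r_def)
qed

section \<open>Convolutions of evolved Gaussians\<close>

definition gaussian :: "complex \<Rightarrow> complex ^ 'n \<Rightarrow> complex \<Rightarrow> real ^ 'n \<Rightarrow> complex" where
  "gaussian a b c \<eta> = exp (a * complex_of_real ((norm \<eta>)\<^sup>2) + (\<Sum>i\<in>UNIV. b $ i * complex_of_real (\<eta> $ i)) + c)"

lemma gaussian_measurable [measurable]: "gaussian a b c \<in> borel_measurable borel"
  unfolding gaussian_def[abs_def] by measurable

text \<open>The point where the modulus of \<open>gaussian a b c\<close> peaks, found by completing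
  the square in the real part of the exponent. The imaginary parts of a and b contribute phases
  only.\<close>

definition gaussian_center :: "complex \<Rightarrow> complex ^ 'n \<Rightarrow> real ^ 'n" where
  "gaussian_center a b = (\<chi> i. Re (b $ i) / (- 2 * Re a))"

lemma gaussian_linear_part:
  assumes "Re a < 0"
  shows "Re (\<Sum>i\<in>UNIV. b $ i * complex_of_real (\<eta> $ i)) = - 2 * Re a * (\<eta> \<bullet> gaussian_center a b)"
  using assms by (simp add: gaussian_center_def inner_vec_def sum_distrib_left mult.commute)

lemma norm_diff_sq: "(norm (x - y))\<^sup>2 = (norm x)\<^sup>2 - 2 * (x \<bullet> y) + (norm y)\<^sup>2" for x y :: "'a::real_inner"
  by (simp add: power2_norm_eq_inner inner_simps inner_commute)

lemma norm_gaussian: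
  assumes "Re a < 0"
  shows "cmod (gaussian a b c \<eta>) = exp (- Re a * (norm (gaussian_center a b))\<^sup>2 + Re c)
    * rgauss (- Re a) (\<eta> - gaussian_center a b)"
  unfolding gaussian_def norm_exp_eq_Re plus_complex.sel gaussian_linear_part[OF assms]
  by (simp add: norm_diff_sq algebra_simps flip: exp_add)

text \<open>By the parallelogram law \<open>|\<xi>/2 + \<zeta>|^2 + |\<xi>/2 - \<zeta>|^2 =
  |\<xi>|^2 / 2 + 2 |\<zeta>|^2\<close>, while the linear parts of the two exponents add up to the
  linear part at \<xi>. So the exponent splits, and the factor depending on \<xi> is again a
  Gaussian, with parameters \<open>(a - \<i> t) / 2\<close>, b and \<open>2 c\<close>.\<close>

lemma fourier_product_gaussian:
  fixes q :: "real ^ 'n \<Rightarrow> real"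
  assumes [measurable]: "q \<in> borel_measurable borel"
  shows "fourier_product (\<lambda>\<eta>. complex_of_real (q \<eta>) * gaussian a b c \<eta>) (gaussian a b c) t \<xi>
    = gaussian ((a - \<i> * complex_of_real t) / 2) b (2 * c) \<xi>
      * (\<integral>\<zeta>. complex_of_real (q (\<xi> /\<^sub>R 2 + \<zeta>)) * cgauss (2 * (\<i> * complex_of_real t - a)) \<zeta> \<partial>lborel)"
proof -
  let ?f = "\<lambda>\<eta>. schroedinger_evolution (\<lambda>\<eta>. complex_of_real (q \<eta>) * gaussian a b c \<eta>) t \<eta> * schroedinger_evolution (gaussian a b c) t (\<xi> - \<eta>)"
  have "?f (\<xi> /\<^sub>R 2 + \<zeta>) = gaussian ((a - \<i> * complex_of_real t) / 2) b (2 * c) \<xi>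
      * (complex_of_real (q (\<xi> /\<^sub>R 2 + \<zeta>)) * cgauss (2 * (\<i> * complex_of_real t - a)) \<zeta>)" for \<zeta>
  proof -
    let ?\<eta> = "\<xi> /\<^sub>R 2 + \<zeta>"
    define L where "L \<eta> = (\<Sum>i\<in>UNIV. b $ i * complex_of_real (\<eta> $ i))" for \<eta> :: "real ^ 'n"
    define X where "X = complex_of_real ((norm ?\<eta>)\<^sup>2)"
    define Y where "Y = complex_of_real ((norm (\<xi> - ?\<eta>))\<^sup>2)"
    have LL: "L ?\<eta> + L (\<xi> - ?\<eta>) = L \<xi>"
      unfolding L_def by (simp add: algebra_simps flip: sum.distrib)
    have "(norm ?\<eta>)\<^sup>2 + (norm (\<xi> - ?\<eta>))\<^sup>2 = (norm \<xi>)\<^sup>2 / 2 + 2 * (norm \<zeta>)\<^sup>2"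
      by (simp only: power2_norm_eq_inner) (simp add: inner_simps inner_commute field_simps)
    then have XY: "X + Y = complex_of_real ((norm \<xi>)\<^sup>2) / 2 + 2 * complex_of_real ((norm \<zeta>)\<^sup>2)"
      unfolding X_def Y_def of_real_add[symmetric] by simp
    have "?f ?\<eta> = complex_of_real (q ?\<eta>) * exp (- \<i> * complex_of_real t * X + (a * X + L ?\<eta> + c)
        + (- \<i> * complex_of_real t * Y + (a * Y + L (\<xi> - ?\<eta>) + c)))"
      unfolding schroedinger_evolution_def gaussian_def L_def[symmetric] X_def Y_def exp_add by (simp add: mult.assoc)
    also have "- \<i> * complex_of_real t * X + (a * X + L ?\<eta> + c) + (- \<i> * complex_of_real t * Y + (a * Y + L (\<xi> - ?\<eta>) + c))
        = (a - \<i> * complex_of_real t) * (X + Y) + (L ?\<eta> + L (\<xi> - ?\<eta>)) + 2 * c"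
      by (simp add: algebra_simps)
    also have "\<dots> = ((a - \<i> * complex_of_real t) / 2 * complex_of_real ((norm \<xi>)\<^sup>2) + L \<xi> + 2 * c)
        + - (2 * (\<i> * complex_of_real t - a) * complex_of_real ((norm \<zeta>)\<^sup>2))"
    proof -
      have "(A - T) * (N / 2 + 2 * M) + l + c' = ((A - T) / 2 * N + l + c') + - (2 * (T - A) * M)"
        for A T N M l c' :: complex by (simp add: field_simps)
      then show ?thesis unfolding LL XY .
    qed
    finally show ?thesis unfolding gaussian_def[of "(a - \<i> * complex_of_real t) / 2"] L_def[symmetric] exp_add by simp
  qed
  moreover have "fourier_product (\<lambda>\<eta>. complex_of_real (q \<eta>) * gaussian a b c \<eta>) (gaussian a b c) t \<xi> = (\<integral>\<zeta>. ?f (\<xi> /\<^sub>R 2 + \<zeta>) \<partial>lborel)"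
    unfolding fourier_product_def using integral_lborel_affine[of ?f 1 "\<xi> /\<^sub>R 2"] by simp
  ultimately show ?thesis by simp
qed

lemma integrable_poly_mult_gaussian:
  fixes p :: "'a::euclidean_space \<Rightarrow> complex"
  assumes s: "0 < Re s" and [measurable]: "p \<in> borel_measurable borel" and p: "\<And>x. cmod (p x) \<le> C * (1 + norm x) ^ k"
  shows "integrable lborel (\<lambda>x. p x * cgauss s x)"
proof (rule Bochner_Integration.integrable_bound)
  show "integrable lborel (\<lambda>x::'a. C * ((1 + norm x) ^ k * rgauss (Re s) x))"
    by (intro integrable_mult_right integrable_power_mult_gaussian s)
  show "AE x in lborel. norm (p x * cgauss s x) \<le> norm (C * ((1 + norm x) ^ k * rgauss (Re s) x))" (is "AE x in _. ?B x")
  proof (rule AE_I2)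
    fix x
    have "norm (p x * cgauss s x) \<le> C * (1 + norm x) ^ k * rgauss (Re s) x"
      unfolding norm_mult norm_exp_neg_mult by (intro mult_right_mono p) simp
    then show "?B x"
      by (simp add: mult.assoc)
  qed
qed measurable

text \<open>The centre doubles and does not move with t. Hence the frequency weight below is one
  fixed Gaussian around \<open>2 *\<^sub>R \<kappa>\<close>, and the dependence on time
  separates.\<close>

lemma gaussian_center_half:
  "gaussian_center ((a - \<i> * complex_of_real t) / 2) b = 2 *\<^sub>R gaussian_center a b"
  by (simp add: gaussian_center_def vec_eq_iff)

text \<open>Absolute values are taken in the identity for the squared complex integral. The factor
  \<open>|\<i> t - a|^2 = (Re a)^2 + (t - Im a)^2\<close> to the power - n/2, n the dimension, is
  the origin of the weight in time.\<close>

lemma norm_gaussian_integral_sq: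
  fixes a :: complex and t :: real
  assumes a: "Re a < 0"
  shows "(cmod (\<integral>(\<zeta>::'a::euclidean_space). cgauss (2 * (\<i> * complex_of_real t - a)) \<zeta> \<partial>lborel))\<^sup>2
    = (\<integral>(x::'a). exp (- (norm x)\<^sup>2) \<partial>lborel)\<^sup>2 / 2 ^ DIM('a) * ((Re a)\<^sup>2 + (t - Im a)\<^sup>2) powr - (real DIM('a) / 2)"
proof -
  let ?s = "\<i> * complex_of_real t - a" and ?R = "(Re a)\<^sup>2 + (t - Im a)\<^sup>2"
  let ?J = "\<integral>(\<zeta>::'a). cgauss (2 * ?s) \<zeta> \<partial>lborel"
  let ?M = "\<integral>(x::'a). exp (- (norm x)\<^sup>2) \<partial>lborel"
  have R: "0 < ?R" using a by (simp add: add_pos_nonneg)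
  have "cmod ?s = sqrt ?R" by (simp add: cmod_def)
  then have norm_s: "cmod ?s ^ DIM('a) = ?R powr (real DIM('a) / 2)"
    using R powr_power[OF less_imp_neq[OF R, symmetric], of "1 / 2" "DIM('a)"] by (simp add: powr_half_sqrt)
  have "?J\<^sup>2 * (2 * ?s) ^ DIM('a) = complex_of_real (?M\<^sup>2)"
    using a by (intro gaussian_integral_power) simp
  from arg_cong[OF this, of cmod] have "(cmod ?J)\<^sup>2 * (2 * cmod ?s) ^ DIM('a) = ?M\<^sup>2"
    unfolding norm_mult norm_power norm_of_real by simp
  then have eq: "(cmod ?J)\<^sup>2 * (2 ^ DIM('a) * ?R powr (real DIM('a) / 2)) = ?M\<^sup>2"
    unfolding power_mult_distrib norm_s .
  have pos: "0 < ?R powr (real DIM('a) / 2)" by (subst powr_gt_zero) (rule less_imp_neq[OF R, symmetric])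
  have div: "x * (p * y) = M \<Longrightarrow> 0 < p \<Longrightarrow> 0 < y \<Longrightarrow> x = M / p * inverse y" for x p y M :: real
    by (simp add: field_simps)
  show ?thesis unfolding powr_minus by (rule div[OF eq _ pos]) simp
qed

text \<open>Reduces both cases to a comparison of averages. Up to a constant, the weight
  \<open>|\<xi>|^(2-d) |K|^2\<close> factorises into the time weight \<tau> and the frequency weight
  \<rho>; the average P of q is supplied through \<open>qP\<close>. A common polynomial bound on q
  and P settles all integrability conditions of the variational lemma.\<close>

lemma gaussian_not_critical:
  fixes a :: complex and b :: "complex ^ 'n" and c c' :: complex and u v :: "real ^ 'n \<Rightarrow> complex"
    and q :: "real ^ 'n \<Rightarrow> real" and P :: "real \<Rightarrow> real ^ 'n \<Rightarrow> complex" and C :: real and m :: nat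
  defines "\<kappa> \<equiv> gaussian_center a b"
    and "\<tau> \<equiv> \<lambda>t. ((Re a)\<^sup>2 + (t - Im a)\<^sup>2) powr - (real CARD('n) / 2)"
  defines "\<rho> \<equiv> \<lambda>\<xi>. norm \<xi> powr (2 - real CARD('n)) * rgauss (- Re a) (\<xi> - 2 *\<^sub>R \<kappa>)"
  assumes d: "3 \<le> CARD('n)" and a: "Re a < 0"
    and v: "v \<in> L2" and u: "is_fourier_L2 u (gaussian a b c)" and c': "c' \<noteq> 0" and vu: "AE x in lborel. v x = c' * u x"
    and q_meas [measurable]: "q \<in> borel_measurable borel" and q: "\<And>\<eta>. \<bar>q \<eta>\<bar> \<le> C * (1 + norm \<eta>) ^ m"
    and P_meas [measurable]: "(\<lambda>(t, \<xi>). P t \<xi>) \<in> borel_measurable (borel \<Otimes>\<^sub>M borel)" and P: "\<And>t \<xi>. cmod (P t \<xi>) \<le> C * (1 + norm \<xi>) ^ m"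
    and qP: "\<And>t \<xi>. (\<integral>\<zeta>. complex_of_real (q (\<xi> /\<^sub>R 2 + \<zeta>)) * cgauss (2 * (\<i> * complex_of_real t - a)) \<zeta> \<partial>lborel)
      = P t \<xi> * (\<integral>(\<zeta>::real^'n). cgauss (2 * (\<i> * complex_of_real t - a)) \<zeta> \<partial>lborel)"
    and ne: "(\<integral>p. \<tau> (fst p) * \<rho> (snd p) * Re (P (fst p) (snd p)) \<partial>(lborel \<Otimes>\<^sub>M lborel)) * (\<integral>\<eta>. rgauss (- 2 * Re a) (\<eta> - \<kappa>) \<partial>lborel)
      \<noteq> (\<integral>t. \<tau> t \<partial>lborel) * (\<integral>\<xi>. \<rho> \<xi> \<partial>lborel) * (\<integral>\<eta>. q \<eta> * rgauss (- 2 * Re a) (\<eta> - \<kappa>) \<partial>lborel)"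
  shows "\<not> is_critical_point bilinear_functional u v"
proof -
  let ?G = "gaussian a b c" and ?Q = "\<lambda>\<eta>. complex_of_real (q \<eta>) * gaussian a b c \<eta>" and ?D = "real CARD('n)"
  define A where "A t \<xi> = fourier_product ?G ?G t \<xi>" for t \<xi>
  define e0 where "e0 = exp (- Re a * (norm \<kappa>)\<^sup>2 + Re c)"
  define e1 where "e1 = exp (- Re a / 2 * (norm (2 *\<^sub>R \<kappa>))\<^sup>2 + Re (2 * c))"
  \<comment> \<open>The constants \<open>e0\<close> and \<Lambda> come from the moduli of the
    Gaussian and of the convolution. They multiply both sides of the final comparison and cancel,
    being positive.\<close>
  define \<Lambda> where "\<Lambda> = e1\<^sup>2 * ((\<integral>(x::real^'n). exp (- (norm x)\<^sup>2) \<partial>lborel)\<^sup>2 / 2 ^ CARD('n))"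
  have ex4: "4 * ((2 - ?D) / 4) = 2 - ?D" and ex2: "2 * ((2 - ?D) / 4) = (2 - ?D) / 2" by simp_all
  have \<Lambda>: "0 < \<Lambda>" unfolding \<Lambda>_def e1_def using gaussian_integral_pos[where 'a = "real^'n"] by simp
  have nG: "cmod (?G \<eta>) = e0 * rgauss (- Re a) (\<eta> - \<kappa>)" for \<eta>
    unfolding norm_gaussian[OF a] e0_def \<kappa>_def ..
  have nG2: "(cmod (?G \<eta>))\<^sup>2 = e0\<^sup>2 * rgauss (- 2 * Re a) (\<eta> - \<kappa>)" for \<eta>
    unfolding nG power_mult_distrib by (simp flip: exp_double)
  have B_eq: "fourier_product ?Q ?G t \<xi> = P t \<xi> * A t \<xi>" for t \<xi>
    using fourier_product_gaussian[of q a b c t \<xi>] fourier_product_gaussian[of "\<lambda>_. 1" a b c t \<xi>]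
    unfolding qP by (simp add: A_def)
  have nA: "(cmod (A t \<xi>))\<^sup>2 = \<Lambda> * \<tau> t * rgauss (- Re a) (\<xi> - 2 *\<^sub>R \<kappa>)" for t \<xi>
  proof -
    have "Re ((a - \<i> * complex_of_real t) / 2) < 0" using a by simp
    from norm_gaussian[OF this, of b "2 * c" \<xi>]
    have "cmod (gaussian ((a - \<i> * complex_of_real t) / 2) b (2 * c) \<xi>) = e1 * rgauss (- Re a / 2) (\<xi> - 2 *\<^sub>R \<kappa>)"
      unfolding gaussian_center_half e1_def \<kappa>_def by simp
    then have "(cmod (gaussian ((a - \<i> * complex_of_real t) / 2) b (2 * c) \<xi>))\<^sup>2 = e1\<^sup>2 * rgauss (- Re a) (\<xi> - 2 *\<^sub>R \<kappa>)"
      by (simp add: power_mult_distrib flip: exp_double)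
    moreover have "A t \<xi> = gaussian ((a - \<i> * complex_of_real t) / 2) b (2 * c) \<xi>
        * (\<integral>(\<zeta>::real^'n). cgauss (2 * (\<i> * complex_of_real t - a)) \<zeta> \<partial>lborel)"
      using fourier_product_gaussian[of "\<lambda>_. 1" a b c t \<xi>] by (simp add: A_def)
    ultimately show ?thesis
      using norm_gaussian_integral_sq[OF a, of t, where 'a = "real^'n"]
      by (simp add: norm_mult power_mult_distrib \<Lambda>_def \<tau>_def)
  qed
  have nA1: "cmod (A t \<xi>) = sqrt (\<Lambda> * \<tau> t) * rgauss (- Re a / 2) (\<xi> - 2 *\<^sub>R \<kappa>)" for t \<xi>
  proof -
    have "cmod (A t \<xi>) = sqrt (\<Lambda> * \<tau> t * rgauss (- Re a) (\<xi> - 2 *\<^sub>R \<kappa>))"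
      using nA[of t \<xi>] by (metis norm_ge_zero real_sqrt_unique)
    also have "rgauss (- Re a) (\<xi> - 2 *\<^sub>R \<kappa>) = (rgauss (- Re a / 2) (\<xi> - 2 *\<^sub>R \<kappa>))\<^sup>2"
      by (simp flip: exp_double)
    finally show ?thesis by (simp add: real_sqrt_mult)
  qed
  have A_meas [measurable]: "(\<lambda>(t, \<xi>). A t \<xi>) \<in> borel_measurable (borel \<Otimes>\<^sub>M borel)"
    unfolding A_def by measurable
  have int_\<tau>: "integrable lborel \<tau>"
    unfolding \<tau>_def using integrable_powr_quadratic[of "- Re a" "?D / 2" "Im a"] a d by simp
  have int_sing: "integrable lborel (\<lambda>\<xi>. norm \<xi> powr p * (1 + norm \<xi>) ^ j * rgauss \<delta> (\<xi> - 2 *\<^sub>R \<kappa>))"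
    if "2 - ?D \<le> p" "p < 0" "0 < \<delta>" for p \<delta> j
    using that by (intro integrable_singular_shifted_gaussian) auto
  have int_\<rho>: "integrable lborel \<rho>"
    unfolding \<rho>_def using int_sing[of "2 - ?D" "- Re a" 0] a d by simp
  \<comment> \<open>Stated for an arbitrary multiplier R of polynomial growth: R = 1 gives the
    convolution of the Gaussian with itself, R = P the perturbed one.\<close>
  have key: "integrable lborel (\<lambda>\<xi>. complex_of_real (norm \<xi> powr (2 * ((2 - ?D) / 4))) * (R t \<xi> * A t \<xi>))"
      "(\<lambda>\<xi>. complex_of_real (norm \<xi> powr (2 * ((2 - ?D) / 4))) * (R t \<xi> * A t \<xi>)) \<in> L2"
      "integrable (lborel \<Otimes>\<^sub>M lborel) (\<lambda>p. norm (snd p) powr (4 * ((2 - ?D) / 4)) * (cmod (R (fst p) (snd p) * A (fst p) (snd p)))\<^sup>2)"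
    if [measurable]: "(\<lambda>(t, \<xi>). R t \<xi>) \<in> borel_measurable (borel \<Otimes>\<^sub>M borel)" and R: "\<And>t \<xi>. cmod (R t \<xi>) \<le> K * (1 + norm \<xi>) ^ m"
    for R :: "real \<Rightarrow> real ^ 'n \<Rightarrow> complex" and K t
  proof -
    have K: "0 \<le> K" using order_trans[OF norm_ge_zero R[of 0 0]] by simp
    have R2: "(cmod (R t \<xi>))\<^sup>2 \<le> K\<^sup>2 * (1 + norm \<xi>) ^ (2 * m)" for t \<xi>
      using power_mono[OF R[of t \<xi>] norm_ge_zero, of 2] by (simp add: power_mult_distrib power_mult mult.commute[of 2])
    have bound2: "norm \<xi> powr (4 * ((2 - ?D) / 4)) * (cmod (R t \<xi> * A t \<xi>))\<^sup>2
        \<le> \<tau> t * (\<Lambda> * K\<^sup>2 * (norm \<xi> powr (2 - ?D) * (1 + norm \<xi>) ^ (2 * m) * rgauss (- Re a) (\<xi> - 2 *\<^sub>R \<kappa>)))" for t \<xi>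
    proof -
      have "norm \<xi> powr (4 * ((2 - ?D) / 4)) * (cmod (R t \<xi> * A t \<xi>))\<^sup>2
        = (norm \<xi> powr (2 - ?D) * (\<Lambda> * \<tau> t * rgauss (- Re a) (\<xi> - 2 *\<^sub>R \<kappa>))) * (cmod (R t \<xi>))\<^sup>2"
        unfolding norm_mult power_mult_distrib nA ex4 by simp
      also have "\<dots> \<le> (norm \<xi> powr (2 - ?D) * (\<Lambda> * \<tau> t * rgauss (- Re a) (\<xi> - 2 *\<^sub>R \<kappa>))) * (K\<^sup>2 * (1 + norm \<xi>) ^ (2 * m))"
        using \<Lambda> by (intro mult_left_mono R2) (simp add: \<tau>_def)
      finally show ?thesis by (simp add: mult_ac)
    qed
    have int2: "integrable lborel (\<lambda>\<xi>. \<Lambda> * K\<^sup>2 * (norm \<xi> powr (2 - ?D) * (1 + norm \<xi>) ^ (2 * m) * rgauss (- Re a) (\<xi> - 2 *\<^sub>R \<kappa>)))"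
      using a d by (intro integrable_mult_right int_sing) auto
    show "integrable lborel (\<lambda>\<xi>. complex_of_real (norm \<xi> powr (2 * ((2 - ?D) / 4))) * (R t \<xi> * A t \<xi>))"
    proof (rule Bochner_Integration.integrable_bound)
      show "integrable lborel (\<lambda>\<xi>. K * sqrt (\<Lambda> * \<tau> t) * (norm \<xi> powr ((2 - ?D) / 2) * (1 + norm \<xi>) ^ m * rgauss (- Re a / 2) (\<xi> - 2 *\<^sub>R \<kappa>)))"
        using a d by (intro integrable_mult_right int_sing) auto
      show "AE \<xi> in lborel. norm (complex_of_real (norm \<xi> powr (2 * ((2 - ?D) / 4))) * (R t \<xi> * A t \<xi>))
          \<le> norm (K * sqrt (\<Lambda> * \<tau> t) * (norm \<xi> powr ((2 - ?D) / 2) * (1 + norm \<xi>) ^ m * rgauss (- Re a / 2) (\<xi> - 2 *\<^sub>R \<kappa>)))" (is "AE \<xi> in _. ?B \<xi>")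
      proof (rule AE_I2)
        fix \<xi> :: "real ^ 'n"
        have "norm (complex_of_real (norm \<xi> powr (2 * ((2 - ?D) / 4))) * (R t \<xi> * A t \<xi>))
            = (norm \<xi> powr ((2 - ?D) / 2) * cmod (A t \<xi>)) * cmod (R t \<xi>)"
          unfolding ex2 by (simp add: norm_mult)
        also have "\<dots> \<le> (norm \<xi> powr ((2 - ?D) / 2) * cmod (A t \<xi>)) * (K * (1 + norm \<xi>) ^ m)"
          by (intro mult_left_mono R) simp
        also have "\<dots> = K * sqrt (\<Lambda> * \<tau> t) * (norm \<xi> powr ((2 - ?D) / 2) * (1 + norm \<xi>) ^ m * rgauss (- Re a / 2) (\<xi> - 2 *\<^sub>R \<kappa>))"
          unfolding nA1 by (simp add: mult_ac)
        finally show "?B \<xi>"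
          by (rule order_trans) (simp only: real_norm_def abs_ge_self)
      qed
    qed measurable
    show "(\<lambda>\<xi>. complex_of_real (norm \<xi> powr (2 * ((2 - ?D) / 4))) * (R t \<xi> * A t \<xi>)) \<in> L2"
    proof (rule L2_bound)
      show "integrable lborel (\<lambda>\<xi>. \<tau> t * (\<Lambda> * K\<^sup>2 * (norm \<xi> powr (2 - ?D) * (1 + norm \<xi>) ^ (2 * m) * rgauss (- Re a) (\<xi> - 2 *\<^sub>R \<kappa>))))"
        by (intro integrable_mult_right int2)
      show "(cmod (complex_of_real (norm \<xi> powr (2 * ((2 - ?D) / 4))) * (R t \<xi> * A t \<xi>)))\<^sup>2
        \<le> \<tau> t * (\<Lambda> * K\<^sup>2 * (norm \<xi> powr (2 - ?D) * (1 + norm \<xi>) ^ (2 * m) * rgauss (- Re a) (\<xi> - 2 *\<^sub>R \<kappa>)))" for \<xi>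
      proof -
        have "(norm \<xi> powr (2 * ((2 - ?D) / 4)))\<^sup>2 = norm \<xi> powr (4 * ((2 - ?D) / 4))"
          unfolding ex2 ex4 power2_eq_square powr_add[symmetric] by simp
        then show ?thesis using bound2[of \<xi> t] by (simp add: norm_mult power_mult_distrib)
      qed
    qed measurable
    show "integrable (lborel \<Otimes>\<^sub>M lborel) (\<lambda>p. norm (snd p) powr (4 * ((2 - ?D) / 4)) * (cmod (R (fst p) (snd p) * A (fst p) (snd p)))\<^sup>2)"
    proof (rule Bochner_Integration.integrable_bound[OF integrable_pair_product[OF int_\<tau> int2]])
      show "AE p in lborel \<Otimes>\<^sub>M lborel. norm (norm (snd p) powr (4 * ((2 - ?D) / 4)) * (cmod (R (fst p) (snd p) * A (fst p) (snd p)))\<^sup>2)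
        \<le> norm (\<tau> (fst p) * (\<Lambda> * K\<^sup>2 * (norm (snd p) powr (2 - ?D) * (1 + norm (snd p)) ^ (2 * m) * rgauss (- Re a) (snd p - 2 *\<^sub>R \<kappa>))))" (is "AE p in _. ?B p")
      proof (rule AE_I2)
        fix p :: "real \<times> (real ^ 'n)"
        have "norm (norm (snd p) powr (4 * ((2 - ?D) / 4)) * (cmod (R (fst p) (snd p) * A (fst p) (snd p)))\<^sup>2)
            = norm (snd p) powr (4 * ((2 - ?D) / 4)) * (cmod (R (fst p) (snd p) * A (fst p) (snd p)))\<^sup>2" by simp
        also note bound2[of "snd p" "fst p"]
        finally show "?B p"
          by (rule order_trans) (simp only: real_norm_def abs_ge_self)
      qed
    qed measurable
  qed
  have one: "cmod 1 \<le> 1 * (1 + norm \<xi>) ^ m" for \<xi> :: "real ^ 'n" by simp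
  note key1 = key[of "\<lambda>t \<xi>. 1" 1, OF _ one, simplified mult_1] and keyP = key[of P C, OF P_meas P]
  have WA: "norm \<xi> powr (4 * ((2 - ?D) / 4)) * (cmod (A t \<xi>))\<^sup>2 = \<Lambda> * (\<tau> t * \<rho> \<xi>)" for t \<xi>
    unfolding nA \<rho>_def ex4 by simp
  have WB: "norm \<xi> powr (4 * ((2 - ?D) / 4)) * Re (P t \<xi> * A t \<xi> * cnj (A t \<xi>)) = \<Lambda> * (\<tau> t * \<rho> \<xi> * Re (P t \<xi>))" for t \<xi>
  proof -
    have "P t \<xi> * A t \<xi> * cnj (A t \<xi>) = P t \<xi> * complex_of_real ((cmod (A t \<xi>))\<^sup>2)"
      unfolding complex_norm_square by simp
    then have "Re (P t \<xi> * A t \<xi> * cnj (A t \<xi>)) = Re (P t \<xi>) * (cmod (A t \<xi>))\<^sup>2"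
      by (simp only: Re_complex_of_real Im_complex_of_real times_complex.sel)
    then show ?thesis using WA[of \<xi> t] by (simp add: mult_ac)
  qed
  have int_G: "integrable lborel (\<lambda>\<eta>. complex_of_real (p \<eta>) * ?G \<eta>)" "(\<lambda>\<eta>. complex_of_real (p \<eta>) * ?G \<eta>) \<in> L2"
    if [measurable]: "p \<in> borel_measurable borel" and p: "\<And>\<eta>. \<bar>p \<eta>\<bar> \<le> K * (1 + norm \<eta>) ^ m" for p :: "real ^ 'n \<Rightarrow> real" and K
  proof -
    show "integrable lborel (\<lambda>\<eta>. complex_of_real (p \<eta>) * ?G \<eta>)"
    proof (rule Bochner_Integration.integrable_bound)
      show "integrable lborel (\<lambda>\<eta>. K * e0 * ((1 + norm \<eta>) ^ m * rgauss (- Re a) (\<eta> - \<kappa>)))"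
        using a by (intro integrable_mult_right integrable_power_shifted_gaussian) simp
      show "AE \<eta> in lborel. norm (complex_of_real (p \<eta>) * ?G \<eta>) \<le> norm (K * e0 * ((1 + norm \<eta>) ^ m * rgauss (- Re a) (\<eta> - \<kappa>)))" (is "AE \<eta> in _. ?B \<eta>")
      proof (rule AE_I2)
        fix \<eta> :: "real ^ 'n"
        have "norm (complex_of_real (p \<eta>) * ?G \<eta>) \<le> K * (1 + norm \<eta>) ^ m * (e0 * rgauss (- Re a) (\<eta> - \<kappa>))"
          unfolding norm_mult norm_of_real nG by (intro mult_right_mono p) (simp add: e0_def)
        also have "\<dots> = K * e0 * ((1 + norm \<eta>) ^ m * rgauss (- Re a) (\<eta> - \<kappa>))" by simp
        finally show "?B \<eta>"
          by (rule order_trans) (simp only: real_norm_def abs_ge_self)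
      qed
    qed measurable
    show "(\<lambda>\<eta>. complex_of_real (p \<eta>) * ?G \<eta>) \<in> L2"
    proof (rule L2_bound)
      show "integrable lborel (\<lambda>\<eta>. K\<^sup>2 * e0\<^sup>2 * ((1 + norm \<eta>) ^ (2 * m) * rgauss (- 2 * Re a) (\<eta> - \<kappa>)))"
        using a by (intro integrable_mult_right integrable_power_shifted_gaussian) simp
      fix \<eta> :: "real ^ 'n"
      have "(p \<eta>)\<^sup>2 \<le> K\<^sup>2 * (1 + norm \<eta>) ^ (2 * m)"
        using power_mono[OF p[of \<eta>] abs_ge_zero, of 2] by (simp add: power_mult_distrib power_mult mult.commute[of 2])
      then have "(p \<eta>)\<^sup>2 * (cmod (?G \<eta>))\<^sup>2 \<le> K\<^sup>2 * (1 + norm \<eta>) ^ (2 * m) * (cmod (?G \<eta>))\<^sup>2"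
        by (rule mult_right_mono) simp
      then show "(cmod (complex_of_real (p \<eta>) * ?G \<eta>))\<^sup>2 \<le> K\<^sup>2 * e0\<^sup>2 * ((1 + norm \<eta>) ^ (2 * m) * rgauss (- 2 * Re a) (\<eta> - \<kappa>))"
        unfolding norm_mult power_mult_distrib nG2 by (simp add: mult_ac)
    qed measurable
  qed
  have one': "\<bar>1\<bar> \<le> 1 * (1 + norm \<eta>) ^ m" for \<eta> :: "real ^ 'n" by simp
  note int_G1 = int_G[of "\<lambda>_. 1" 1, OF borel_measurable_const one', simplified of_real_1 mult_1] and int_Q = int_G[OF q_meas q]
  have pos_\<tau>: "0 < (\<integral>t. \<tau> t \<partial>lborel)"
  proof (rule integral_pos_if_AE_pos[OF int_\<tau>])
    have "(Re a)\<^sup>2 + (t - Im a)\<^sup>2 > 0" for t using a by (simp add: add_pos_nonneg)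
    then show "AE t in lborel. 0 < \<tau> t" unfolding \<tau>_def by (intro AE_I2) (metis less_irrefl powr_gt_zero)
  qed
  have pos_\<rho>: "0 < (\<integral>\<xi>. \<rho> \<xi> \<partial>lborel)"
  proof (rule integral_pos_if_AE_pos[OF int_\<rho>])
    show "AE \<xi> in lborel. 0 < \<rho> \<xi>"
      using AE_lborel_singleton[of "0 :: real^'n"] by eventually_elim (simp add: \<rho>_def)
  qed
  have pos_e: "0 < (\<integral>\<eta>. rgauss (- 2 * Re a) (\<eta> - \<kappa>) \<partial>lborel)"
    using integrable_power_shifted_gaussian[of "- 2 * Re a" 0 \<kappa>] a by (intro integral_pos_if_AE_pos) auto
  have N0: "(\<integral>p. norm (snd p) powr (4 * ((2 - ?D) / 4)) * (cmod (A (fst p) (snd p)))\<^sup>2 \<partial>(lborel \<Otimes>\<^sub>M lborel))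
      = \<Lambda> * ((\<integral>t. \<tau> t \<partial>lborel) * (\<integral>\<xi>. \<rho> \<xi> \<partial>lborel))"
    unfolding WA by (simp add: integral_pair_product[OF int_\<tau> int_\<rho>])
  have N1: "(\<integral>p. norm (snd p) powr (4 * ((2 - ?D) / 4)) * Re (P (fst p) (snd p) * A (fst p) (snd p) * cnj (A (fst p) (snd p))) \<partial>(lborel \<Otimes>\<^sub>M lborel))
      = \<Lambda> * (\<integral>p. \<tau> (fst p) * \<rho> (snd p) * Re (P (fst p) (snd p)) \<partial>(lborel \<Otimes>\<^sub>M lborel))"
    unfolding WB by simp
  have D0: "(\<integral>\<eta>. (cmod (?G \<eta>))\<^sup>2 \<partial>lborel) = e0\<^sup>2 * (\<integral>\<eta>. rgauss (- 2 * Re a) (\<eta> - \<kappa>) \<partial>lborel)"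
    unfolding nG2 by simp
  have D1: "Re (\<integral>\<eta>. ?Q \<eta> * cnj (?G \<eta>) \<partial>lborel) = e0\<^sup>2 * (\<integral>\<eta>. q \<eta> * rgauss (- 2 * Re a) (\<eta> - \<kappa>) \<partial>lborel)"
  proof -
    have "(\<integral>\<eta>. ?Q \<eta> * cnj (?G \<eta>) \<partial>lborel) = (\<integral>\<eta>. complex_of_real (e0\<^sup>2 * (q \<eta> * rgauss (- 2 * Re a) (\<eta> - \<kappa>))) \<partial>lborel)"
    proof (rule Bochner_Integration.integral_cong[OF refl])
      fix \<eta> :: "real ^ 'n"
      have "?Q \<eta> * cnj (?G \<eta>) = complex_of_real (q \<eta> * (cmod (?G \<eta>))\<^sup>2)"
        unfolding of_real_mult complex_norm_square by simp
      then show "?Q \<eta> * cnj (?G \<eta>) = complex_of_real (e0\<^sup>2 * (q \<eta> * rgauss (- 2 * Re a) (\<eta> - \<kappa>)))"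
        unfolding nG2 by (simp only: mult_ac)
    qed
    then show ?thesis unfolding integral_complex_of_real by simp
  qed
  have e0: "e0\<^sup>2 > 0" by (simp add: e0_def)
  show ?thesis
  proof (rule not_critical_if_first_variation[OF v u c' vu int_G1(1) int_Q])
    show "integrable lborel (\<lambda>\<xi>. complex_of_real (norm \<xi> powr (2 * ((2 - ?D) / 4))) * fourier_product ?G ?G t \<xi>)"
      "(\<lambda>\<xi>. complex_of_real (norm \<xi> powr (2 * ((2 - ?D) / 4))) * fourier_product ?G ?G t \<xi>) \<in> L2" for t
      using key1(1,2)[of t] by (simp_all add: A_def)
    show "integrable lborel (\<lambda>\<xi>. complex_of_real (norm \<xi> powr (2 * ((2 - ?D) / 4))) * fourier_product ?Q ?G t \<xi>)"
      "(\<lambda>\<xi>. complex_of_real (norm \<xi> powr (2 * ((2 - ?D) / 4))) * fourier_product ?Q ?G t \<xi>) \<in> L2" for t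
      unfolding B_eq by (rule keyP(1,2)[of t])+
    show "integrable (lborel \<Otimes>\<^sub>M lborel) (\<lambda>p. norm (snd p) powr (4 * ((2 - ?D) / 4)) * (cmod (fourier_product ?G ?G (fst p) (snd p)))\<^sup>2)"
      unfolding A_def[symmetric] using key1(3) by simp
    show int2: "integrable (lborel \<Otimes>\<^sub>M lborel) (\<lambda>p. norm (snd p) powr (4 * ((2 - ?D) / 4)) * (cmod (fourier_product ?Q ?G (fst p) (snd p)))\<^sup>2)"
      unfolding B_eq by (rule keyP(3))
    show "integrable (lborel \<Otimes>\<^sub>M lborel) (\<lambda>p. norm (snd p) powr (4 * ((2 - ?D) / 4)) * Re (fourier_product ?Q ?G (fst p) (snd p) * cnj (fourier_product ?G ?G (fst p) (snd p))))"
      unfolding B_eq A_def[symmetric]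
    \<comment> \<open>The mixed term is dominated by the sum of the two squares, whose integrability
      is already known.\<close>
    proof (rule Bochner_Integration.integrable_bound)
      let ?W = "\<lambda>p::real \<times> (real ^ 'n). norm (snd p) powr (4 * ((2 - ?D) / 4))"
      let ?A = "\<lambda>p::real \<times> (real ^ 'n). A (fst p) (snd p)" and ?P = "\<lambda>p::real \<times> (real ^ 'n). P (fst p) (snd p)"
      show "integrable (lborel \<Otimes>\<^sub>M lborel) (\<lambda>p. ?W p * (cmod (?A p))\<^sup>2 + ?W p * (cmod (?P p * ?A p))\<^sup>2)"
        using key1(3) by (intro Bochner_Integration.integrable_add keyP(3)) simp
      show "AE p in lborel \<Otimes>\<^sub>M lborel. norm (?W p * Re (?P p * ?A p * cnj (?A p))) \<le> norm (?W p * (cmod (?A p))\<^sup>2 + ?W p * (cmod (?P p * ?A p))\<^sup>2)" (is "AE p in _. ?B p")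
      proof (rule AE_I2)
        fix p :: "real \<times> (real ^ 'n)"
        have "\<bar>Re (z * cnj w)\<bar> \<le> (cmod w)\<^sup>2 + (cmod z)\<^sup>2" for z w
          using abs_Re_le_cmod[of "z * cnj w"] sum_squares_bound[of "cmod w" "cmod z"] mult_nonneg_nonneg[OF norm_ge_zero[of z] norm_ge_zero[of w]]
          unfolding norm_mult complex_mod_cnj by (simp only: mult.assoc mult.commute[of "cmod z"])
        then have "?W p * \<bar>Re (?P p * ?A p * cnj (?A p))\<bar> \<le> ?W p * ((cmod (?A p))\<^sup>2 + (cmod (?P p * ?A p))\<^sup>2)"
          by (rule mult_left_mono) simp
        then show "?B p"
          unfolding real_norm_def abs_mult by (simp only: distrib_left[symmetric] abs_of_nonneg[OF powr_ge_zero])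
      qed
    qed measurable
    show "0 < (\<integral>p. norm (snd p) powr (4 * ((2 - ?D) / 4)) * (cmod (fourier_product ?G ?G (fst p) (snd p)))\<^sup>2 \<partial>(lborel \<Otimes>\<^sub>M lborel))"
      unfolding A_def[symmetric] N0 using \<Lambda> pos_\<tau> pos_\<rho> by simp
    show "0 < (\<integral>\<eta>. (cmod (?G \<eta>))\<^sup>2 \<partial>lborel)"
      unfolding D0 using e0 pos_e by simp
    show "(\<integral>p. norm (snd p) powr (4 * ((2 - ?D) / 4)) * Re (fourier_product ?Q ?G (fst p) (snd p) * cnj (fourier_product ?G ?G (fst p) (snd p))) \<partial>(lborel \<Otimes>\<^sub>M lborel))
        * (\<integral>\<eta>. (cmod (?G \<eta>))\<^sup>2 \<partial>lborel)
      \<noteq> (\<integral>p. norm (snd p) powr (4 * ((2 - ?D) / 4)) * (cmod (fourier_product ?G ?G (fst p) (snd p)))\<^sup>2 \<partial>(lborel \<Otimes>\<^sub>M lborel))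
        * Re (\<integral>\<eta>. ?Q \<eta> * cnj (?G \<eta>) \<partial>lborel)"
      unfolding B_eq A_def[symmetric] N0 N1 D0 D1
    proof -
      have "\<Lambda> * x * (e0\<^sup>2 * y) \<noteq> \<Lambda> * (z * w) * (e0\<^sup>2 * y')" if "x * y \<noteq> z * w * y'" for x y z w y'
      proof
        assume "\<Lambda> * x * (e0\<^sup>2 * y) = \<Lambda> * (z * w) * (e0\<^sup>2 * y')"
        then have "(\<Lambda> * e0\<^sup>2) * (x * y) = (\<Lambda> * e0\<^sup>2) * (z * w * y')" by (simp only: mult_ac)
        then show False using \<Lambda> e0 that by simp
      qed
      then show "\<Lambda> * (\<integral>p. \<tau> (fst p) * \<rho> (snd p) * Re (P (fst p) (snd p)) \<partial>(lborel \<Otimes>\<^sub>M lborel))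
          * (e0\<^sup>2 * (\<integral>\<eta>. rgauss (- 2 * Re a) (\<eta> - \<kappa>) \<partial>lborel))
        \<noteq> \<Lambda> * ((\<integral>t. \<tau> t \<partial>lborel) * (\<integral>\<xi>. \<rho> \<xi> \<partial>lborel))
          * (e0\<^sup>2 * (\<integral>\<eta>. q \<eta> * rgauss (- 2 * Re a) (\<eta> - \<kappa>) \<partial>lborel))"
        using ne by blast
    qed
  qed
qed

lemma homogeneous_gaussian_identity_real:
  fixes \<rho> :: "'a::euclidean_space \<Rightarrow> real"
  assumes "\<rho> \<in> borel_measurable borel" "\<And>c x. 0 < c \<Longrightarrow> \<rho> (c *\<^sub>R x) = c powr p * \<rho> x"
    "\<And>\<delta>. 0 < \<delta> \<Longrightarrow> integrable lborel (\<lambda>x. \<rho> x * rgauss \<delta> x)"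
    and \<delta>: "0 < \<delta>"
  shows "(real DIM('a) + p) * (\<integral>x. \<rho> x * rgauss \<delta> x \<partial>lborel)
    = 2 * \<delta> * (\<integral>x. \<rho> x * (norm x)\<^sup>2 * rgauss \<delta> x \<partial>lborel)"
proof -
  have e: "complex_of_real r * exp (- (complex_of_real \<delta> * complex_of_real s)) = complex_of_real (r * exp (- (\<delta> * s)))" for r s
    by (simp flip: exp_of_real)
  have H: "complex_of_real (real DIM('a) + p) * (\<integral>x. complex_of_real (\<rho> x) * cgauss (complex_of_real \<delta>) x \<partial>lborel)
    = 2 * complex_of_real \<delta> * (\<integral>x. complex_of_real (\<rho> x * (norm x)\<^sup>2) * cgauss (complex_of_real \<delta>) x \<partial>lborel)"
    by (rule homogeneous_gaussian_identity) (use assms in auto)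
  have "complex_of_real ((real DIM('a) + p) * (\<integral>x. \<rho> x * rgauss \<delta> x \<partial>lborel))
      = complex_of_real (2 * \<delta> * (\<integral>x. \<rho> x * (norm x)\<^sup>2 * rgauss \<delta> x \<partial>lborel))"
    using H[unfolded e integral_complex_of_real] by (simp only: of_real_mult of_real_numeral)
  then show ?thesis by (simp only: of_real_eq_iff)
qed

lemma inner_bound:
  fixes x k :: "'a::real_inner"
  shows "\<bar>x \<bullet> k\<bar> \<le> norm k * (1 + norm x)"
  using Cauchy_Schwarz_ineq2[of x k] by (simp add: algebra_simps add_increasing)

lemma one_plus_norm_diff_le: "1 + norm (x - y) \<le> (1 + norm y) * (1 + norm x)"
proof -
  have "(1 + norm y) * (1 + norm x) = 1 + norm x + norm y + norm y * norm x" by (simp add: algebra_simps)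
  then show ?thesis
    using norm_triangle_ineq4[of x y] mult_nonneg_nonneg[OF norm_ge_zero[of y] norm_ge_zero[of x]] by linarith
qed

section \<open>Gaussians centred away from the origin\<close>

lemma AE_hyperplane:
  fixes k :: "'a::euclidean_space"
  assumes "k \<noteq> 0"
  shows "AE x in lborel. x \<bullet> k \<noteq> 0"
proof -
  have "negligible {x. k \<bullet> x = 0}" using assms by (intro negligible_hyperplane) simp
  then have "{x. k \<bullet> x = 0} \<in> null_sets lebesgue" by (simp add: negligible_iff_null_sets)
  moreover have "{x. k \<bullet> x = 0} \<in> sets lborel" using closed_hyperplane[of k 0] by simp
  ultimately have "{x. k \<bullet> x = 0} \<in> null_sets lborel" by (simp add: null_sets_completion_iff)
  then show ?thesis by (rule AE_not_in[THEN AE_mp]) (simp add: inner_commute)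
qed

text \<open>Reflecting at the centre \<open>2 k\<close> of the Gaussian, the side of the origin has the larger singular factor.\<close>

lemma shifted_gaussian_drift:
  fixes k :: "'a::euclidean_space"
  assumes k: "k \<noteq> 0" and p: "1 - real DIM('a) \<le> p" "p < 0" and \<delta>: "0 < \<delta>"
  shows "(\<integral>\<xi>. norm \<xi> powr p * rgauss \<delta> (\<xi> - 2 *\<^sub>R k) * ((\<xi> - 2 *\<^sub>R k) \<bullet> k) \<partial>lborel) < 0"
proof -
  define h where "h \<xi> = norm \<xi> powr p * rgauss \<delta> (\<xi> - 2 *\<^sub>R k) * ((\<xi> - 2 *\<^sub>R k) \<bullet> k)" for \<xi>
  have [measurable]: "h \<in> borel_measurable borel" unfolding h_def by measurable
  have int: "integrable lborel h"
  proof (rule Bochner_Integration.integrable_bound)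
    let ?g = "\<lambda>\<xi>. norm k * (1 + 2 * norm k) * (norm \<xi> powr p * (1 + norm \<xi>) ^ 1 * rgauss \<delta> (\<xi> - 2 *\<^sub>R k))"
    show "integrable lborel ?g"
      by (intro integrable_mult_right integrable_singular_shifted_gaussian p \<delta>)
    show "AE \<xi> in lborel. norm (h \<xi>) \<le> norm (?g \<xi>)" (is "AE \<xi> in _. ?B \<xi>")
    proof (rule AE_I2)
      fix \<xi>
      have "\<bar>(\<xi> - 2 *\<^sub>R k) \<bullet> k\<bar> \<le> norm k * (1 + norm (\<xi> - 2 *\<^sub>R k))" by (rule inner_bound)
      also have "\<dots> \<le> norm k * ((1 + 2 * norm k) * (1 + norm \<xi>))"
        using one_plus_norm_diff_le[of \<xi> "2 *\<^sub>R k"] by (intro mult_left_mono) simp_all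
      finally have "norm (h \<xi>) \<le> norm \<xi> powr p * rgauss \<delta> (\<xi> - 2 *\<^sub>R k) * (norm k * ((1 + 2 * norm k) * (1 + norm \<xi>)))"
        unfolding h_def by (simp add: abs_mult mult_left_mono)
      also have "\<dots> = ?g \<xi>" by simp
      finally show "?B \<xi>" by (rule order_trans) (simp only: real_norm_def abs_ge_self)
    qed
  qed measurable
  have int': "integrable lborel (\<lambda>\<zeta>. h (2 *\<^sub>R k + \<zeta>))" "integrable lborel (\<lambda>\<zeta>. h (2 *\<^sub>R k - \<zeta>))"
    using integrable_lborel_affine[OF int, of 1 "2 *\<^sub>R k"] integrable_lborel_affine[OF int, of "-1" "2 *\<^sub>R k"] by simp_all
  have eq: "(\<integral>\<xi>. h \<xi> \<partial>lborel) = (\<integral>\<zeta>. h (2 *\<^sub>R k + \<zeta>) \<partial>lborel)" "(\<integral>\<xi>. h \<xi> \<partial>lborel) = (\<integral>\<zeta>. h (2 *\<^sub>R k - \<zeta>) \<partial>lborel)"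
    using integral_lborel_affine[of h 1 "2 *\<^sub>R k"] integral_lborel_affine[of h "-1" "2 *\<^sub>R k"] by simp_all
  \<comment> \<open>Both reflected integrals equal the original one, so the integrand may be summed
    over pairs of reflected points. The Gaussian is even about 2k and the inner product is odd, so
    only the difference of the two powers of the norm remains.\<close>
  have "0 < (\<integral>\<zeta>. - (h (2 *\<^sub>R k + \<zeta>) + h (2 *\<^sub>R k - \<zeta>)) \<partial>lborel)"
  proof (rule integral_pos_if_AE_pos)
    show "integrable lborel (\<lambda>\<zeta>. - (h (2 *\<^sub>R k + \<zeta>) + h (2 *\<^sub>R k - \<zeta>)))" using int' by simp
    show "AE \<zeta> in lborel. 0 < - (h (2 *\<^sub>R k + \<zeta>) + h (2 *\<^sub>R k - \<zeta>))"
      \<comment> \<open>Excluded are the hyperplane \<open>\<zeta> \<bullet> k = 0\<close>, where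
        the sum vanishes, and the points 2k and -2k, for which one of the reflected points is the
        origin and \<open>powr\<close> takes the default value 0.\<close>
      using AE_hyperplane[OF k] AE_lborel_singleton[of "2 *\<^sub>R k"] AE_lborel_singleton[of "- (2 *\<^sub>R k)"]
    proof eventually_elim
      case (elim \<zeta>)
      have n0: "0 < norm (2 *\<^sub>R k + \<zeta>)" "0 < norm (2 *\<^sub>R k - \<zeta>)"
        using elim by (auto simp: add_eq_0_iff)
      have "(norm (2 *\<^sub>R k + \<zeta>))\<^sup>2 - (norm (2 *\<^sub>R k - \<zeta>))\<^sup>2 = 8 * (\<zeta> \<bullet> k)"
        by (simp only: power2_norm_eq_inner) (simp add: inner_simps inner_commute)
      then have less: "norm (2 *\<^sub>R k - \<zeta>) < norm (2 *\<^sub>R k + \<zeta>) \<longleftrightarrow> 0 < \<zeta> \<bullet> k"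
        "norm (2 *\<^sub>R k + \<zeta>) < norm (2 *\<^sub>R k - \<zeta>) \<longleftrightarrow> \<zeta> \<bullet> k < 0"
        using power2_less_imp_less[of "norm (2 *\<^sub>R k - \<zeta>)" "norm (2 *\<^sub>R k + \<zeta>)"] power2_less_imp_less[of "norm (2 *\<^sub>R k + \<zeta>)" "norm (2 *\<^sub>R k - \<zeta>)"]
          power_strict_mono[of "norm (2 *\<^sub>R k - \<zeta>)" "norm (2 *\<^sub>R k + \<zeta>)" 2] power_strict_mono[of "norm (2 *\<^sub>R k + \<zeta>)" "norm (2 *\<^sub>R k - \<zeta>)" 2]
        by auto
      have "0 < (norm (2 *\<^sub>R k - \<zeta>) powr p - norm (2 *\<^sub>R k + \<zeta>) powr p) * (\<zeta> \<bullet> k)"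
      proof (cases "0 < \<zeta> \<bullet> k")
        case True
        then have "norm (2 *\<^sub>R k + \<zeta>) powr p < norm (2 *\<^sub>R k - \<zeta>) powr p"
          using less n0 p by (intro powr_less_mono2_neg) auto
        then show ?thesis using True by simp
      next
        case False
        then have "\<zeta> \<bullet> k < 0" using elim by simp
        moreover from this have "norm (2 *\<^sub>R k - \<zeta>) powr p < norm (2 *\<^sub>R k + \<zeta>) powr p"
          using less n0 p by (intro powr_less_mono2_neg) auto
        ultimately show ?thesis by (simp add: mult_neg_neg)
      qed
      then have "0 < rgauss \<delta> \<zeta> * ((norm (2 *\<^sub>R k - \<zeta>) powr p - norm (2 *\<^sub>R k + \<zeta>) powr p) * (\<zeta> \<bullet> k))"
        by simp
      then show ?case by (simp add: h_def algebra_simps)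
    qed
  qed
  then have "(\<integral>\<xi>. h \<xi> \<partial>lborel) < 0" using int' eq by simp
  then show ?thesis by (simp add: h_def)
qed

text \<open>The function \<open>(\<eta> - k) \<bullet> k\<close> measures displacement along the
  direction from the origin to the centre. Averaging over \<zeta> removes the part odd in \<zeta>
  and leaves half of \<open>(\<xi> - 2 k) \<bullet> k\<close>, whose integral against \<rho> is
  negative by the reflection argument.\<close>

lemma not_critical_off_center:
  fixes a :: complex and b :: "complex ^ 'n" and c c' :: complex and u v :: "real ^ 'n \<Rightarrow> complex"
  assumes d: "3 \<le> CARD('n)" and a: "Re a < 0" and v: "v \<in> L2" and u: "is_fourier_L2 u (gaussian a b c)"
    and c': "c' \<noteq> 0" and vu: "AE x in lborel. v x = c' * u x" and k: "gaussian_center a b \<noteq> 0"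
  shows "\<not> is_critical_point bilinear_functional u v"
proof -
  define k where "k = gaussian_center a b"
  have k0: "k \<noteq> 0" using assms(7) by (simp add: k_def)
  let ?\<tau> = "\<lambda>t. ((Re a)\<^sup>2 + (t - Im a)\<^sup>2) powr - (real CARD('n) / 2)"
  let ?\<rho> = "\<lambda>\<xi>::real^'n. norm \<xi> powr (2 - real CARD('n)) * rgauss (- Re a) (\<xi> - 2 *\<^sub>R k)"
  have bound: "\<bar>(s *\<^sub>R x - k) \<bullet> k\<bar> \<le> norm k * (1 + norm k) * (1 + norm x) ^ 1" if "0 \<le> s" "s \<le> 1" for s and x :: "real ^ 'n"
  proof -
    have "\<bar>(s *\<^sub>R x - k) \<bullet> k\<bar> \<le> norm k * (1 + norm (s *\<^sub>R x - k))" by (rule inner_bound)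
    also have "\<dots> \<le> norm k * ((1 + norm k) * (1 + norm x))"
    proof (rule mult_left_mono)
      have "norm (s *\<^sub>R x) \<le> norm x" using that by (simp add: mult_left_le_one_le)
      then show "1 + norm (s *\<^sub>R x - k) \<le> (1 + norm k) * (1 + norm x)"
        by (intro order_trans[OF one_plus_norm_diff_le] mult_left_mono) simp_all
    qed simp
    finally show ?thesis by simp
  qed
  show ?thesis
  proof (rule gaussian_not_critical[OF d a v u c' vu, where q = "\<lambda>\<eta>. (\<eta> - k) \<bullet> k" and P = "\<lambda>t \<xi>. complex_of_real ((\<xi> /\<^sub>R 2 - k) \<bullet> k)"
        and C = "norm k * (1 + norm k)" and m = 1, folded k_def])
    show "\<bar>(\<eta> - k) \<bullet> k\<bar> \<le> norm k * (1 + norm k) * (1 + norm \<eta>) ^ 1" for \<eta> :: "real ^ 'n"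
      using bound[of 1 \<eta>] by simp
    show "cmod (complex_of_real ((\<xi> /\<^sub>R 2 - k) \<bullet> k)) \<le> norm k * (1 + norm k) * (1 + norm \<xi>) ^ 1" for \<xi> :: "real ^ 'n"
      using bound[of "inverse 2" \<xi>] unfolding norm_of_real by simp
    fix t :: real and \<xi> :: "real ^ 'n"
    let ?s = "2 * (\<i> * complex_of_real t - a)"
    let ?E = "\<lambda>\<zeta>::real^'n. cgauss ?s \<zeta>"
    have s: "0 < Re ?s" using a by simp
    have int: "integrable lborel (\<lambda>\<zeta>. complex_of_real (\<zeta> \<bullet> k) * ?E \<zeta>)"
      by (rule integrable_poly_mult_gaussian[OF s, where C = "norm k" and k = 1]) (use inner_bound[of _ k] in auto)
    have "(\<integral>\<zeta>. complex_of_real ((\<xi> /\<^sub>R 2 + \<zeta> - k) \<bullet> k) * ?E \<zeta> \<partial>lborel)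
        = (\<integral>\<zeta>. complex_of_real ((\<xi> /\<^sub>R 2 - k) \<bullet> k) * ?E \<zeta> + complex_of_real (\<zeta> \<bullet> k) * ?E \<zeta> \<partial>lborel)"
      unfolding distrib_right[symmetric] of_real_add[symmetric] inner_add_left[symmetric] by (simp add: algebra_simps)
    also have "\<dots> = complex_of_real ((\<xi> /\<^sub>R 2 - k) \<bullet> k) * (\<integral>\<zeta>. ?E \<zeta> \<partial>lborel) + (\<integral>\<zeta>. complex_of_real (\<zeta> \<bullet> k) * ?E \<zeta> \<partial>lborel)"
      using int integrable_complex_gaussian[OF s, where 'a = "real^'n"]
      by (subst Bochner_Integration.integral_add) (simp_all only: integral_mult_right_zero integrable_mult_right)
    also have "(\<integral>\<zeta>. complex_of_real (\<zeta> \<bullet> k) * ?E \<zeta> \<partial>lborel) = 0"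
      by (rule integral_odd_eq_0) (simp_all, measurable)
    finally show "(\<integral>\<zeta>. complex_of_real ((\<xi> /\<^sub>R 2 + \<zeta> - k) \<bullet> k) * ?E \<zeta> \<partial>lborel) = complex_of_real ((\<xi> /\<^sub>R 2 - k) \<bullet> k) * (\<integral>\<zeta>. ?E \<zeta> \<partial>lborel)"
      by simp
  next
    have \<tau>: "integrable lborel ?\<tau>" using integrable_powr_quadratic[of "- Re a" "real CARD('n) / 2" "Im a"] a d by simp
    have pos_\<tau>: "0 < (\<integral>t. ?\<tau> t \<partial>lborel)"
    proof (rule integral_pos_if_AE_pos[OF \<tau>])
      have "(Re a)\<^sup>2 + (t - Im a)\<^sup>2 > 0" for t using a by (simp add: add_pos_nonneg)
      then show "AE t in lborel. 0 < ?\<tau> t" by (intro AE_I2) (metis less_irrefl powr_gt_zero)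
    qed
    have drift: "(\<integral>\<xi>. ?\<rho> \<xi> * ((\<xi> - 2 *\<^sub>R k) \<bullet> k) \<partial>lborel) < 0"
      using shifted_gaussian_drift[OF k0, of "2 - real CARD('n)" "- Re a"] a d by simp
    \<comment> \<open>A non-integrable function has integral 0 by convention, so the strict sign
      just obtained already implies integrability.\<close>
    then have int: "integrable lborel (\<lambda>\<xi>. ?\<rho> \<xi> * ((\<xi> - 2 *\<^sub>R k) \<bullet> k))"
      using not_integrable_integral_eq by fastforce
    have half: "?\<tau> t * ?\<rho> \<xi> * Re (complex_of_real ((\<xi> /\<^sub>R 2 - k) \<bullet> k)) = ?\<tau> t * (?\<rho> \<xi> * ((\<xi> - 2 *\<^sub>R k) \<bullet> k)) / 2" for t \<xi>
      by (simp add: inner_diff_left field_simps)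
    have N1: "(\<integral>p. ?\<tau> (fst p) * ?\<rho> (snd p) * Re (complex_of_real ((snd p /\<^sub>R 2 - k) \<bullet> k)) \<partial>(lborel \<Otimes>\<^sub>M lborel))
        = (\<integral>t. ?\<tau> t \<partial>lborel) * (\<integral>\<xi>. ?\<rho> \<xi> * ((\<xi> - 2 *\<^sub>R k) \<bullet> k) \<partial>lborel) / 2"
      unfolding half integral_pair_product[OF \<tau> int, symmetric] by simp
    have E: "0 < (\<integral>\<eta>. rgauss (- 2 * Re a) (\<eta> - k) \<partial>lborel)"
      using integrable_power_shifted_gaussian[of "- 2 * Re a" 0 k] a by (intro integral_pos_if_AE_pos) auto
    have "(\<integral>\<eta>. ((\<eta> - k) \<bullet> k) * rgauss (- 2 * Re a) (\<eta> - k) \<partial>lborel)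
        = (\<integral>\<eta>. (\<eta> \<bullet> k) * rgauss (- 2 * Re a) \<eta> \<partial>lborel)"
      using integral_lborel_affine[of "\<lambda>\<eta>. ((\<eta> - k) \<bullet> k) * rgauss (- 2 * Re a) (\<eta> - k)" 1 k] by simp
    also have "\<dots> = 0" by (rule integral_odd_eq_0) (simp_all, measurable)
    finally have D1: "(\<integral>\<eta>. ((\<eta> - k) \<bullet> k) * rgauss (- 2 * Re a) (\<eta> - k) \<partial>lborel) = 0" .
    show "(\<integral>p. ?\<tau> (fst p) * ?\<rho> (snd p) * Re (complex_of_real ((snd p /\<^sub>R 2 - k) \<bullet> k)) \<partial>(lborel \<Otimes>\<^sub>M lborel))
        * (\<integral>\<eta>. rgauss (- 2 * Re a) (\<eta> - k) \<partial>lborel)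
      \<noteq> (\<integral>t. ?\<tau> t \<partial>lborel) * (\<integral>\<xi>. ?\<rho> \<xi> \<partial>lborel) * (\<integral>\<eta>. ((\<eta> - k) \<bullet> k) * rgauss (- 2 * Re a) (\<eta> - k) \<partial>lborel)"
      unfolding N1 D1 using pos_\<tau> drift E by simp
  qed measurable
qed

section \<open>Gaussians centred at the origin\<close>

lemma gaussian_quartic_moment:
  fixes s :: complex and \<xi> :: "'a::euclidean_space"
  assumes s: "0 < Re s"
  shows "(\<integral>\<zeta>. complex_of_real (norm (\<xi> /\<^sub>R 2 + \<zeta>) ^ 4) * cgauss (2 * s) \<zeta> \<partial>lborel)
    = (complex_of_real (norm \<xi> ^ 4 / 16) + complex_of_real ((norm \<xi>)\<^sup>2 * (real DIM('a) + 2) / 8) / s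
        + complex_of_real (real DIM('a) * (real DIM('a) + 2) / 16) / s\<^sup>2)
      * (\<integral>(\<zeta>::'a). cgauss (2 * s) \<zeta> \<partial>lborel)"
proof -
  let ?E = "\<lambda>\<zeta>::'a. cgauss (2 * s) \<zeta>"
  define N where "N = (norm \<xi>)\<^sup>2"
  define D where "D = complex_of_real (real DIM('a))"
  define J where "J = (\<integral>\<zeta>. ?E \<zeta> \<partial>lborel)"
  define M2 where "M2 = (\<integral>\<zeta>. complex_of_real ((norm \<zeta>)\<^sup>2) * ?E \<zeta> \<partial>lborel)"
  define M4 where "M4 = (\<integral>\<zeta>. complex_of_real ((norm \<zeta>)\<^sup>2 * (norm \<zeta>)\<^sup>2) * ?E \<zeta> \<partial>lborel)"
  define X2 where "X2 = (\<integral>\<zeta>. complex_of_real ((\<zeta> \<bullet> \<xi>)\<^sup>2) * ?E \<zeta> \<partial>lborel)"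
  have s2: "0 < Re (2 * s)" and s0: "s \<noteq> 0" using s by auto
  have i0: "integrable lborel ?E" by (rule integrable_complex_gaussian[OF s2])
  have i2: "integrable lborel (\<lambda>\<zeta>. complex_of_real ((norm \<zeta>)\<^sup>2) * ?E \<zeta>)"
    by (rule integrable_poly_mult_gaussian[OF s2, where C = 1 and k = 2])
      (auto simp: norm_power intro: power_mono)
  have i4: "integrable lborel (\<lambda>\<zeta>. complex_of_real ((norm \<zeta>)\<^sup>2 * (norm \<zeta>)\<^sup>2) * ?E \<zeta>)"
    by (rule integrable_poly_mult_gaussian[OF s2, where C = 1 and k = 4])
      (auto simp: norm_power norm_mult intro: power_mono simp flip: power_add)
  have iX: "integrable lborel (\<lambda>\<zeta>. complex_of_real ((\<zeta> \<bullet> \<xi>)\<^sup>2) * ?E \<zeta>)"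
  proof (rule integrable_poly_mult_gaussian[OF s2, where C = N and k = 2])
    show "cmod (complex_of_real ((\<zeta> \<bullet> \<xi>)\<^sup>2)) \<le> N * (1 + norm \<zeta>)\<^sup>2" for \<zeta>
      using power_mono[OF inner_bound[of \<zeta> \<xi>] abs_ge_zero, of 2] by (simp add: norm_power power_mult_distrib N_def)
  qed measurable
  \<comment> \<open>The terms of the expansion that are odd in \<zeta>, collected so that they
    vanish together.\<close>
  have iO: "integrable lborel (\<lambda>\<zeta>. complex_of_real ((N / 2 + 2 * (norm \<zeta>)\<^sup>2) * (\<zeta> \<bullet> \<xi>)) * ?E \<zeta>)"
  proof (rule integrable_poly_mult_gaussian[OF s2, where C = "(N / 2 + 2) * norm \<xi>" and k = 3])
    fix \<zeta> :: 'a
    have N: "0 \<le> N" by (simp add: N_def)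
    have "1 \<le> (1 + norm \<zeta>)\<^sup>2" by (rule one_le_power) simp
    moreover have "(norm \<zeta>)\<^sup>2 \<le> (1 + norm \<zeta>)\<^sup>2" by (intro power_mono) auto
    ultimately have le: "N / 2 + 2 * (norm \<zeta>)\<^sup>2 \<le> (N / 2 + 2) * (1 + norm \<zeta>)\<^sup>2"
      using mult_left_mono[of 1 "(1 + norm \<zeta>)\<^sup>2" "N / 2"] N unfolding distrib_right mult_1_right by linarith
    have "cmod (complex_of_real ((N / 2 + 2 * (norm \<zeta>)\<^sup>2) * (\<zeta> \<bullet> \<xi>))) = (N / 2 + 2 * (norm \<zeta>)\<^sup>2) * \<bar>\<zeta> \<bullet> \<xi>\<bar>"
      using N unfolding norm_of_real abs_mult by simp
    also have "\<dots> \<le> ((N / 2 + 2) * (1 + norm \<zeta>)\<^sup>2) * (norm \<xi> * (1 + norm \<zeta>))"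
      using N by (intro mult_mono le inner_bound) auto
    finally show "cmod (complex_of_real ((N / 2 + 2 * (norm \<zeta>)\<^sup>2) * (\<zeta> \<bullet> \<xi>))) \<le> (N / 2 + 2) * norm \<xi> * (1 + norm \<zeta>) ^ 3"
      by (simp add: power3_eq_cube power2_eq_square mult_ac)
  qed measurable
  have O: "(\<integral>\<zeta>. complex_of_real ((N / 2 + 2 * (norm \<zeta>)\<^sup>2) * (\<zeta> \<bullet> \<xi>)) * ?E \<zeta> \<partial>lborel) = 0"
    by (rule integral_odd_eq_0) (simp_all, measurable)
  have expand: "complex_of_real (norm (\<xi> /\<^sub>R 2 + \<zeta>) ^ 4) * ?E \<zeta>
      = complex_of_real (N\<^sup>2 / 16) * ?E \<zeta> + complex_of_real (N / 2) * (complex_of_real ((norm \<zeta>)\<^sup>2) * ?E \<zeta>)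
        + complex_of_real ((norm \<zeta>)\<^sup>2 * (norm \<zeta>)\<^sup>2) * ?E \<zeta> + complex_of_real ((\<zeta> \<bullet> \<xi>)\<^sup>2) * ?E \<zeta>
        + complex_of_real ((N / 2 + 2 * (norm \<zeta>)\<^sup>2) * (\<zeta> \<bullet> \<xi>)) * ?E \<zeta>" for \<zeta>
  proof -
    have sq: "(norm (\<xi> /\<^sub>R 2 + \<zeta>))\<^sup>2 = N / 4 + \<zeta> \<bullet> \<xi> + (norm \<zeta>)\<^sup>2"
      unfolding N_def by (simp only: power2_norm_eq_inner) (simp add: inner_simps inner_commute)
    have "x ^ 4 = (x\<^sup>2)\<^sup>2" for x :: real by (simp flip: power_mult)
    then have "norm (\<xi> /\<^sub>R 2 + \<zeta>) ^ 4 = (N / 4 + \<zeta> \<bullet> \<xi> + (norm \<zeta>)\<^sup>2)\<^sup>2"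
      unfolding sq[symmetric] .
    also have "\<dots> = N\<^sup>2 / 16 + N / 2 * (norm \<zeta>)\<^sup>2 + (norm \<zeta>)\<^sup>2 * (norm \<zeta>)\<^sup>2 + (\<zeta> \<bullet> \<xi>)\<^sup>2 + (N / 2 + 2 * (norm \<zeta>)\<^sup>2) * (\<zeta> \<bullet> \<xi>)"
      by (simp add: power2_eq_square field_simps)
    finally have "complex_of_real (norm (\<xi> /\<^sub>R 2 + \<zeta>) ^ 4) = complex_of_real (N\<^sup>2 / 16) + complex_of_real (N / 2) * complex_of_real ((norm \<zeta>)\<^sup>2)
        + complex_of_real ((norm \<zeta>)\<^sup>2 * (norm \<zeta>)\<^sup>2) + complex_of_real ((\<zeta> \<bullet> \<xi>)\<^sup>2) + complex_of_real ((N / 2 + 2 * (norm \<zeta>)\<^sup>2) * (\<zeta> \<bullet> \<xi>))"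
      by (simp only: of_real_add of_real_mult)
    then show ?thesis by (simp only: distrib_right mult.assoc)
  qed
  have "(\<integral>\<zeta>. complex_of_real (norm (\<xi> /\<^sub>R 2 + \<zeta>) ^ 4) * ?E \<zeta> \<partial>lborel)
      = complex_of_real (N\<^sup>2 / 16) * J + complex_of_real (N / 2) * M2 + M4 + X2"
  proof -
    have h: "has_bochner_integral lborel ?E J" "has_bochner_integral lborel (\<lambda>\<zeta>. complex_of_real ((norm \<zeta>)\<^sup>2) * ?E \<zeta>) M2"
      "has_bochner_integral lborel (\<lambda>\<zeta>. complex_of_real ((norm \<zeta>)\<^sup>2 * (norm \<zeta>)\<^sup>2) * ?E \<zeta>) M4"
      "has_bochner_integral lborel (\<lambda>\<zeta>. complex_of_real ((\<zeta> \<bullet> \<xi>)\<^sup>2) * ?E \<zeta>) X2"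
      unfolding J_def M2_def M4_def X2_def by (intro has_bochner_integral_integrable i0 i2 i4 iX)+
    show ?thesis
      unfolding expand
      by (rule trans[OF has_bochner_integral_integral_eq[OF has_bochner_integral_add[OF has_bochner_integral_add[OF
              has_bochner_integral_add[OF has_bochner_integral_add[OF has_bochner_integral_mult_right[OF h(1)]
                has_bochner_integral_mult_right[OF h(2)]] h(3)] h(4)] has_bochner_integral_integrable[OF iO, unfolded O]]]]) simp
  qed
  \<comment> \<open>With parameter 2s every moment identity divides by 4s. Then
    \<open>N / 2 * M2 + X2\<close> yields the coefficient \<open>N (D + 2) / (8 s)\<close> of J, and
    \<open>M4\<close> yields \<open>D (D + 2) / (16 s^2)\<close>.\<close>
  moreover have "M2 = D * J / (4 * s)"
    using gaussian_norm_moment[OF s2, of 0, where 'a = 'a] s0 unfolding M2_def J_def D_def by (simp add: field_simps)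
  moreover have "M4 = (D + 2) * M2 / (4 * s)"
    using gaussian_norm_moment[OF s2, of 2, where 'a = 'a] s0 unfolding M4_def M2_def D_def by (simp add: field_simps)
  moreover have "X2 = complex_of_real N * J / (4 * s)"
    using gaussian_second_moment[OF s2, of \<xi>] s0 unfolding X2_def J_def N_def by (simp add: field_simps)
  ultimately have "(\<integral>\<zeta>. complex_of_real (norm (\<xi> /\<^sub>R 2 + \<zeta>) ^ 4) * ?E \<zeta> \<partial>lborel)
      = (complex_of_real (N\<^sup>2 / 16) + complex_of_real N * (D + 2) / (8 * s) + D * (D + 2) / (16 * s\<^sup>2)) * J"
    using s0 by (simp add: field_simps power2_eq_square)
  then show ?thesis unfolding J_def N_def D_def by simp
qed

text \<open>The algebra of the centred case, separated from the analysis. T0, T1, T2 stand for the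
  time integrals with exponents -D/2, -D/2 - 1, -D/2 - 2; m0, m1, m2 and E0, E2, E4 for the moments
  of order 0, 2, 4 of \<rho> and, up to a constant, of the squared Gaussian. The recurrences express
  everything through T0, m0 and E0.\<close>

lemma centered_variation_ne:
  fixes D \<alpha> T0 T1 T2 m0 m1 m2 E0 E2 E4 :: real
  assumes D: "3 \<le> D" and \<alpha>: "0 < \<alpha>" and pos: "0 < T0" "0 < m0" "0 < E0"
    and T: "D * \<alpha>\<^sup>2 * T1 = (D - 1) * T0" "(D + 2) * \<alpha>\<^sup>2 * T2 = (D + 1) * T1"
    and m: "m0 = \<alpha> * m1" "2 * m1 = \<alpha> * m2"
    and E: "D * E0 = 4 * \<alpha> * E2" "(D + 2) * E2 = 4 * \<alpha> * E4"
  shows "(T0 * m2 / 16 + \<alpha> * (D + 2) / 8 * (T1 * m1) + D * (D + 2) / 16 * ((2 * \<alpha>\<^sup>2 * T2 - T1) * m0)) * E0 \<noteq> T0 * m0 * E4"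
proof -
  have T1: "T1 = (D - 1) * T0 / (D * \<alpha>\<^sup>2)"
    using T D \<alpha> by (auto intro!: eq_divide_imp simp: mult_ac)
  have m1: "m1 = m0 / \<alpha>" and m2: "m2 = 2 * m0 / \<alpha>\<^sup>2" using m \<alpha> by (simp_all add: field_simps power2_eq_square)
  have E4: "E4 = (D + 2) * D * E0 / (16 * \<alpha>\<^sup>2)"
  proof -
    have "E2 = D * E0 / (4 * \<alpha>)" using E(1) \<alpha> by (simp add: field_simps)
    then have "4 * \<alpha> * E4 = (D + 2) * (D * E0 / (4 * \<alpha>))" using E(2) by simp
    then show ?thesis using \<alpha> by (simp add: field_simps power2_eq_square)
  qed
  have "\<alpha>\<^sup>2 * T2 = (D + 1) * T1 / (D + 2)" using T(2) D by (auto intro!: eq_divide_imp simp: mult_ac)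
  then have "2 * \<alpha>\<^sup>2 * T2 - T1 = 2 * ((D + 1) * T1 / (D + 2)) - T1" by (simp only: mult.assoc)
  also have "\<dots> = D / (D + 2) * T1" using D by (simp add: field_simps)
  finally have X: "2 * \<alpha>\<^sup>2 * T2 - T1 = D / (D + 2) * T1" .
  have "T0 * m2 / 16 + \<alpha> * (D + 2) / 8 * (T1 * m1) + D * (D + 2) / 16 * ((2 * \<alpha>\<^sup>2 * T2 - T1) * m0)
      = T0 * m0 / (8 * \<alpha>\<^sup>2) + (D + 2) / 8 * T1 * m0 + D\<^sup>2 / 16 * T1 * m0"
  proof -
    have "D * (D + 2) / 16 * (D / (D + 2) * T1 * m0) = D\<^sup>2 / 16 * T1 * m0"
      using D by (simp add: field_simps power2_eq_square)
    moreover have "\<alpha> * (D + 2) / 8 * (T1 * (m0 / \<alpha>)) = (D + 2) / 8 * T1 * m0" using \<alpha> by simp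
    moreover have "T0 * (2 * m0 / \<alpha>\<^sup>2) / 16 = T0 * m0 / (8 * \<alpha>\<^sup>2)" by simp
    ultimately show ?thesis unfolding X m1 m2 by (simp only:)
  qed
  also have "\<dots> = T0 * m0 / (16 * \<alpha>\<^sup>2 * D) * (2 * D + 2 * (D + 2) * (D - 1) + D\<^sup>2 * (D - 1))"
    unfolding T1 using D \<alpha> by (simp add: field_simps power2_eq_square)
  finally have N1: "T0 * m2 / 16 + \<alpha> * (D + 2) / 8 * (T1 * m1) + D * (D + 2) / 16 * ((2 * \<alpha>\<^sup>2 * T2 - T1) * m0)
      = T0 * m0 / (16 * \<alpha>\<^sup>2 * D) * (2 * D + 2 * (D + 2) * (D - 1) + D\<^sup>2 * (D - 1))" .
  \<comment> \<open>Over the common denominator, the bracket minus \<open>D^2 (D + 2)\<close>, the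
    contribution of E4, is \<open>- (D - 2)^2\<close>.\<close>
  have "T0 * m0 / (16 * \<alpha>\<^sup>2 * D) * (2 * D + 2 * (D + 2) * (D - 1) + D\<^sup>2 * (D - 1)) * E0 - T0 * m0 * E4
      = - (T0 * m0 * E0 / (16 * \<alpha>\<^sup>2 * D) * (D - 2)\<^sup>2)"
    unfolding E4 using D \<alpha> by (simp add: field_simps power2_eq_square)
  moreover have "0 < T0 * m0 * E0 / (16 * \<alpha>\<^sup>2 * D) * (D - 2)\<^sup>2"
    using D \<alpha> pos by simp
  ultimately show ?thesis unfolding N1 by linarith
qed

text \<open>With \<open>R = |s|^2\<close> the real parts of 1/s and \<open>1/s^2\<close> are
  \<open>\<alpha> / R\<close> and \<open>(2 \<alpha>^2 - R) / R^2\<close>. So Re P times the weight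
  is a finite sum of products of a power of R in time with \<rho> times a power of the norm in
  frequency; each integral factorises, and the recurrences in time and in frequency take
  over.\<close>

lemma not_critical_centered:
  fixes a :: complex and b :: "complex ^ 'n" and c c' :: complex and u v :: "real ^ 'n \<Rightarrow> complex"
  assumes d: "3 \<le> CARD('n)" and a: "Re a < 0" and v: "v \<in> L2" and u: "is_fourier_L2 u (gaussian a b c)"
    and c': "c' \<noteq> 0" and vu: "AE x in lborel. v x = c' * u x" and k: "gaussian_center a b = 0"
  shows "\<not> is_critical_point bilinear_functional u v"
proof -
  define D where "D = real CARD('n)"
  define \<alpha> where "\<alpha> = - Re a"
  have D: "3 \<le> D" and \<alpha>: "0 < \<alpha>" using d a by (simp_all add: D_def \<alpha>_def)
  define R where "R t = (Re a)\<^sup>2 + (t - Im a)\<^sup>2" for t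
  have R: "0 < R t" "\<alpha>\<^sup>2 \<le> R t" for t using a by (simp_all add: R_def \<alpha>_def add_pos_nonneg)
  define s where "s t = \<i> * complex_of_real t - a" for t
  have s: "0 < Re (s t)" "s t \<noteq> 0" for t using a by (auto simp: s_def)
  have norm_s: "(cmod (s t))\<^sup>2 = R t" for t by (simp add: s_def R_def cmod_power2)
  have norm_s_ge: "\<alpha> \<le> cmod (s t)" for t
    using complex_Re_le_cmod[of "s t"] by (simp add: s_def \<alpha>_def)
  define P where "P t \<xi> = complex_of_real (norm \<xi> ^ 4 / 16) + complex_of_real ((norm \<xi>)\<^sup>2 * (D + 2) / 8) / s t
        + complex_of_real (D * (D + 2) / 16) / (s t)\<^sup>2" for t and \<xi> :: "real ^ 'n"
  define \<tau> where "\<tau> t = R t powr - (D / 2)" for t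
  define \<rho> where "\<rho> \<xi> = norm \<xi> powr (2 - D) * rgauss \<alpha> \<xi>" for \<xi> :: "real ^ 'n"
  define e where "e \<eta> = rgauss (2 * \<alpha>) \<eta>" for \<eta> :: "real ^ 'n"
  define T where "T p = (\<integral>t. R t powr - p \<partial>lborel)" for p
  have int_T: "integrable lborel (\<lambda>t. R t powr - p)" if "1 \<le> p" for p
    unfolding R_def using integrable_powr_quadratic[of "- Re a" p "Im a"] a that by simp
  have T_pos: "0 < T (D / 2)"
    unfolding T_def
  proof (rule integral_pos_if_AE_pos)
    show "AE t in lborel. 0 < R t powr - (D / 2)"
      using R(1) by (intro AE_I2) (metis less_irrefl powr_gt_zero)
  qed (use D int_T in auto)
  have T_rec: "2 * p * \<alpha>\<^sup>2 * T (p + 1) = (2 * p - 1) * T p" if "3 / 2 \<le> p" for p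
    using integral_powr_quadratic_recurrence[of "- Re a" p "Im a"] a that by (simp add: T_def R_def \<alpha>_def)
  have int_sing: "integrable lborel (\<lambda>\<xi>::real^'n. norm \<xi> powr (2 - D) * (norm \<xi>) ^ j * rgauss \<delta> \<xi>)" if "0 < \<delta>" for j \<delta>
  proof (rule Bochner_Integration.integrable_bound)
    show "integrable lborel (\<lambda>\<xi>::real^'n. norm \<xi> powr (2 - D) * (1 + norm \<xi>) ^ j * rgauss \<delta> (\<xi> - 0))"
      using D that by (intro integrable_singular_shifted_gaussian) (auto simp: D_def)
    show "AE \<xi>::real^'n in lborel. norm (norm \<xi> powr (2 - D) * (norm \<xi>) ^ j * rgauss \<delta> \<xi>)
        \<le> norm (norm \<xi> powr (2 - D) * (1 + norm \<xi>) ^ j * rgauss \<delta> (\<xi> - 0))"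
      by (intro AE_I2) (auto simp: abs_mult power_abs intro!: mult_right_mono mult_left_mono power_mono)
  qed measurable
  have int_\<rho>: "integrable lborel (\<lambda>\<xi>. \<rho> \<xi> * norm \<xi> ^ j)" for j
    using int_sing[OF \<alpha>, of j] by (simp add: \<rho>_def mult_ac)
  define m where "m j = (\<integral>\<xi>. \<rho> \<xi> * norm \<xi> ^ j \<partial>lborel)" for j
  have hom: "norm (h *\<^sub>R \<xi>) powr (2 - D) * norm (h *\<^sub>R \<xi>) ^ j = h powr (2 - D + real j) * (norm \<xi> powr (2 - D) * norm \<xi> ^ j)"
    if "0 < h" for h j and \<xi> :: "real ^ 'n"
    using that by (simp add: powr_mult power_mult_distrib powr_add powr_realpow)
  \<comment> \<open>The degree 2 - D + j plus the dimension D leaves 2 + j: the singular weight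
    makes these moments obey the recurrence of Gaussian moments in the plane.\<close>
  have m_rec: "(2 + real j) * m j = 2 * \<alpha> * m (j + 2)" for j
    using homogeneous_gaussian_identity_real[of "\<lambda>x::real^'n. norm x powr (2 - D) * norm x ^ j" "2 - D + real j", OF _ hom int_sing \<alpha>]
    unfolding m_def power_add by (simp add: \<rho>_def D_def mult_ac)
  have m_pos: "0 < m 0"
    unfolding m_def
  proof (rule integral_pos_if_AE_pos[OF int_\<rho>])
    show "AE \<xi> in lborel. 0 < \<rho> \<xi> * norm \<xi> ^ 0"
      using AE_lborel_singleton[of "0 :: real^'n"] by eventually_elim (simp add: \<rho>_def)
  qed
  define E where "E j = (\<integral>\<eta>. norm \<eta> ^ j * e \<eta> \<partial>lborel)" for j
  have E_rec: "(D + real j) * E j = 4 * \<alpha> * E (j + 2)" for j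
    using homogeneous_gaussian_identity_real[of "\<lambda>x::real^'n. norm x ^ j" "real j" "2 * \<alpha>"] integrable_norm_power_gaussian[where 'a = "real^'n", of _ j] \<alpha>
    unfolding E_def power_add by (simp add: e_def D_def power_mult_distrib powr_realpow mult_ac)
  have E_pos: "0 < E 0"
    unfolding E_def e_def using integrable_gaussian[of "2 * \<alpha>", where 'a = "real^'n"] \<alpha> by (intro integral_pos_if_AE_pos) auto
  \<comment> \<open>Factors \<open>norm \<xi> ^ 0\<close> are kept so that every term is a power of
    R times \<rho> times a power of the norm.\<close>
  have ReP: "\<tau> t * \<rho> \<xi> * Re (P t \<xi>) = R t powr - (D / 2) * (\<rho> \<xi> * norm \<xi> ^ 4) / 16
      + \<alpha> * (D + 2) / 8 * (R t powr - (D / 2 + 1) * (\<rho> \<xi> * norm \<xi> ^ 2))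
      + D * (D + 2) / 16 * (2 * \<alpha>\<^sup>2 * (R t powr - (D / 2 + 1 + 1) * (\<rho> \<xi> * norm \<xi> ^ 0)) - R t powr - (D / 2 + 1) * (\<rho> \<xi> * norm \<xi> ^ 0))" for t \<xi>
  proof -
    have r1: "Re (complex_of_real x / s t) = x * \<alpha> / R t" for x
      by (simp add: Re_divide norm_s[symmetric] cmod_power2 s_def \<alpha>_def)
    have r2: "Re (complex_of_real x / (s t)\<^sup>2) = x * (2 * \<alpha>\<^sup>2 / (R t)\<^sup>2 - 1 / R t)" for x
    proof -
      \<comment> \<open>Since \<open>Re s = \<alpha>\<close> and \<open>|s|^2 = R\<close>, the real
        part \<open>\<alpha>^2 - (Im s)^2\<close> equals \<open>2 \<alpha>^2 - R\<close>.\<close>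
      have "Re ((s t)\<^sup>2) = 2 * \<alpha>\<^sup>2 - R t"
        by (simp add: s_def \<alpha>_def R_def power2_eq_square algebra_simps)
      moreover have "(Re ((s t)\<^sup>2))\<^sup>2 + (Im ((s t)\<^sup>2))\<^sup>2 = (R t)\<^sup>2"
        unfolding cmod_power2[symmetric] norm_power norm_s ..
      ultimately have "Re (complex_of_real x / (s t)\<^sup>2) = x * (2 * \<alpha>\<^sup>2 - R t) / (R t)\<^sup>2"
        by (simp add: Re_divide)
      also have "\<dots> = x * (2 * \<alpha>\<^sup>2 / (R t)\<^sup>2 - 1 / R t)"
        using R(1)[of t] by (simp add: field_simps power2_eq_square)
      finally show ?thesis .
    qed
    have p1: "R t powr - (D / 2 + 1) = R t powr - (D / 2) / R t"
      using R(1)[of t] by (simp add: powr_diff)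
    have p2: "R t powr - (D / 2 + 1 + 1) = R t powr - (D / 2) / (R t)\<^sup>2"
    proof -
      have "- (D / 2 + 1 + 1) = - (D / 2) - 2" by simp
      then show ?thesis using R(1)[of t] by (simp only: powr_diff) simp
    qed
    have ReP: "Re (P t \<xi>) = norm \<xi> ^ 4 / 16 + (norm \<xi>)\<^sup>2 * (D + 2) / 8 * \<alpha> / R t + D * (D + 2) / 16 * (2 * \<alpha>\<^sup>2 / (R t)\<^sup>2 - 1 / R t)"
      unfolding P_def plus_complex.sel r1 r2 by simp
    show ?thesis unfolding p1 p2 \<tau>_def ReP unfolding divide_inverse by (simp add: algebra_simps)
  qed
  have N1: "(\<integral>p. \<tau> (fst p) * \<rho> (snd p) * Re (P (fst p) (snd p)) \<partial>(lborel \<Otimes>\<^sub>M lborel))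
      = T (D / 2) * m 4 / 16 + \<alpha> * (D + 2) / 8 * (T (D / 2 + 1) * m 2)
        + D * (D + 2) / 16 * ((2 * \<alpha>\<^sup>2 * T (D / 2 + 1 + 1) - T (D / 2 + 1)) * m 0)"
  proof -
    define g where "g q j = (\<lambda>p::real \<times> (real ^ 'n). R (fst p) powr - q * (\<rho> (snd p) * norm (snd p) ^ j))" for q j
    have g: "has_bochner_integral (lborel \<Otimes>\<^sub>M lborel) (g q j) (T q * m j)" if "1 \<le> q" for q j
      unfolding g_def T_def m_def has_bochner_integral_iff
      using integrable_pair_product[OF int_T[OF that] int_\<rho>[of j]] integral_pair_product[OF int_T[OF that] int_\<rho>[of j]] by simp
    define g1 g2 g3 g4 where "g1 = g (D / 2) 4" and "g2 = g (D / 2 + 1) 2" and "g3 = g (D / 2 + 1 + 1) 0" and "g4 = g (D / 2 + 1) 0"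
    have int: "integrable (lborel \<Otimes>\<^sub>M lborel) g1" "integrable (lborel \<Otimes>\<^sub>M lborel) g2"
      "integrable (lborel \<Otimes>\<^sub>M lborel) g3" "integrable (lborel \<Otimes>\<^sub>M lborel) g4"
      unfolding g1_def g2_def g3_def g4_def by (rule has_bochner_integral_iff[THEN iffD1, THEN conjunct1, OF g], use D in simp)+
    have eq: "integral\<^sup>L (lborel \<Otimes>\<^sub>M lborel) g1 = T (D / 2) * m 4" "integral\<^sup>L (lborel \<Otimes>\<^sub>M lborel) g2 = T (D / 2 + 1) * m 2"
      "integral\<^sup>L (lborel \<Otimes>\<^sub>M lborel) g3 = T (D / 2 + 1 + 1) * m 0" "integral\<^sup>L (lborel \<Otimes>\<^sub>M lborel) g4 = T (D / 2 + 1) * m 0"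
      unfolding g1_def g2_def g3_def g4_def by (rule has_bochner_integral_integral_eq[OF g], use D in simp)+
    have "\<tau> (fst p) * \<rho> (snd p) * Re (P (fst p) (snd p))
        = g1 p / 16 + \<alpha> * (D + 2) / 8 * g2 p + D * (D + 2) / 16 * (2 * \<alpha>\<^sup>2 * g3 p - g4 p)" for p
      unfolding g1_def g2_def g3_def g4_def g_def by (rule ReP)
    then show ?thesis using int eq by (simp add: left_diff_distrib)
  qed
  \<comment> \<open>The coefficients of P are bounded by means of |s| \<ge> \<alpha>; the summand 1
    covers the quartic term and q itself.\<close>
  define C where "C = 1 + (D + 2) / (8 * \<alpha>) + D * (D + 2) / (16 * \<alpha>\<^sup>2)"
  have C1: "1 \<le> C" using D \<alpha> by (simp add: C_def)
  show ?thesis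
  proof (rule gaussian_not_critical[OF d a v u c' vu, where q = "\<lambda>\<eta>. norm \<eta> ^ 4" and P = P and C = C and m = 4, unfolded k])
    show "\<bar>norm \<eta> ^ 4\<bar> \<le> C * (1 + norm \<eta>) ^ 4" for \<eta> :: "real ^ 'n"
    proof -
      have "norm \<eta> ^ 4 \<le> 1 * (1 + norm \<eta>) ^ 4" by (simp add: power_mono)
      also have "\<dots> \<le> C * (1 + norm \<eta>) ^ 4" using C1 by (intro mult_right_mono) auto
      finally show ?thesis by simp
    qed
    show "(\<lambda>(t, \<xi>). P t \<xi>) \<in> borel_measurable (borel \<Otimes>\<^sub>M borel)"
      unfolding P_def s_def by measurable
    show "cmod (P t \<xi>) \<le> C * (1 + norm \<xi>) ^ 4" for t \<xi>
    proof -
      have "cmod (P t \<xi>) \<le> norm \<xi> ^ 4 / 16 + (norm \<xi>)\<^sup>2 * (D + 2) / 8 / cmod (s t) + D * (D + 2) / 16 / (cmod (s t))\<^sup>2"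
        unfolding P_def using D
        by (intro order_trans[OF norm_triangle_ineq] add_mono) (auto simp: norm_divide norm_mult norm_power)
      also have "\<dots> \<le> 1 * (1 + norm \<xi>) ^ 4 + (1 + norm \<xi>) ^ 4 * (D + 2) / 8 / \<alpha> + (1 + norm \<xi>) ^ 4 * (D * (D + 2) / 16) / \<alpha>\<^sup>2"
      proof (intro add_mono)
        show "norm \<xi> ^ 4 / 16 \<le> 1 * (1 + norm \<xi>) ^ 4"
        proof -
          have "norm \<xi> ^ 4 \<le> (1 + norm \<xi>) ^ 4" by (intro power_mono) auto
          moreover have "0 \<le> norm \<xi> ^ 4" by simp
          ultimately show ?thesis by linarith
        qed
        have "(norm \<xi>)\<^sup>2 \<le> (1 + norm \<xi>)\<^sup>2" by (intro power_mono) auto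
        also have "\<dots> \<le> (1 + norm \<xi>) ^ 4" by (intro power_increasing) auto
        finally show "(norm \<xi>)\<^sup>2 * (D + 2) / 8 / cmod (s t) \<le> (1 + norm \<xi>) ^ 4 * (D + 2) / 8 / \<alpha>"
          using D \<alpha> norm_s_ge by (intro frac_le divide_right_mono mult_right_mono) auto
        have "1 * (D * (D + 2) / 16) \<le> (1 + norm \<xi>) ^ 4 * (D * (D + 2) / 16)"
          using D by (intro mult_right_mono one_le_power) auto
        then show "D * (D + 2) / 16 / (cmod (s t))\<^sup>2 \<le> (1 + norm \<xi>) ^ 4 * (D * (D + 2) / 16) / \<alpha>\<^sup>2"
          using D \<alpha> norm_s_ge by (intro frac_le power_mono) auto
      qed
      also have "\<dots> = C * (1 + norm \<xi>) ^ 4" by (simp add: C_def algebra_simps)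
      finally show ?thesis .
    qed
    show "(\<integral>\<zeta>. complex_of_real (norm (\<xi> /\<^sub>R 2 + \<zeta>) ^ 4) * cgauss (2 * (\<i> * complex_of_real t - a)) \<zeta> \<partial>lborel)
        = P t \<xi> * (\<integral>(\<zeta>::real^'n). cgauss (2 * (\<i> * complex_of_real t - a)) \<zeta> \<partial>lborel)" for t and \<xi> :: "real ^ 'n"
      using gaussian_quartic_moment[OF s(1)[of t], of \<xi>] by (simp only: P_def s_def D_def DIM_cart DIM_real mult_1_right)
    have eqs: "(Re a)\<^sup>2 + (t - Im a)\<^sup>2 = R t" "- Re a = \<alpha>" "- 2 * Re a = 2 * \<alpha>" "real CARD('n) = D" for t
      by (simp_all add: R_def \<alpha>_def D_def)
    have "T (D / 2) = (\<integral>t. \<tau> t \<partial>lborel)" "m 0 = (\<integral>\<xi>. \<rho> \<xi> \<partial>lborel)" "E 0 = (\<integral>\<eta>. e \<eta> \<partial>lborel)" "E 4 = (\<integral>\<eta>. norm \<eta> ^ 4 * e \<eta> \<partial>lborel)"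
      by (simp_all add: T_def \<tau>_def m_def E_def)
    moreover have "(T (D / 2) * m 4 / 16 + \<alpha> * (D + 2) / 8 * (T (D / 2 + 1) * m 2)
        + D * (D + 2) / 16 * ((2 * \<alpha>\<^sup>2 * T (D / 2 + 1 + 1) - T (D / 2 + 1)) * m 0)) * E 0 \<noteq> T (D / 2) * m 0 * E 4"
    proof (rule centered_variation_ne[OF D \<alpha> T_pos m_pos E_pos])
      show "D * \<alpha>\<^sup>2 * T (D / 2 + 1) = (D - 1) * T (D / 2)" using T_rec[of "D / 2"] D by simp
      show "(D + 2) * \<alpha>\<^sup>2 * T (D / 2 + 1 + 1) = (D + 1) * T (D / 2 + 1)" using T_rec[of "D / 2 + 1"] D by (simp add: algebra_simps)
      show "m 0 = \<alpha> * m 2" "2 * m 2 = \<alpha> * m 4" using m_rec[of 0, unfolded add_0] m_rec[of 2] by simp_all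
      show "D * E 0 = 4 * \<alpha> * E 2" "(D + 2) * E 2 = 4 * \<alpha> * E 4" using E_rec[of 0, unfolded add_0] E_rec[of 2] by simp_all
    qed
    ultimately show "(\<integral>p. ((Re a)\<^sup>2 + (fst p - Im a)\<^sup>2) powr - (real CARD('n) / 2) * (norm (snd p) powr (2 - real CARD('n)) * rgauss (- Re a) (snd p - 2 *\<^sub>R 0))
          * Re (P (fst p) (snd p)) \<partial>(lborel \<Otimes>\<^sub>M lborel)) * (\<integral>(\<eta>::real^'n). rgauss (- 2 * Re a) (\<eta> - 0) \<partial>lborel)
      \<noteq> (\<integral>t. ((Re a)\<^sup>2 + (t - Im a)\<^sup>2) powr - (real CARD('n) / 2) \<partial>lborel)
        * (\<integral>(\<xi>::real^'n). norm \<xi> powr (2 - real CARD('n)) * rgauss (- Re a) (\<xi> - 2 *\<^sub>R 0) \<partial>lborel)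
        * (\<integral>(\<eta>::real^'n). norm \<eta> ^ 4 * rgauss (- 2 * Re a) (\<eta> - 0) \<partial>lborel)"
      unfolding eqs scaleR_zero_right diff_zero \<tau>_def[symmetric] \<rho>_def[symmetric] e_def[symmetric] N1 by simp
  qed measurable
qed

theorem theorem1p3:
  fixes u\<^sub>0 v\<^sub>0 G :: "real ^ 'n \<Rightarrow> complex" and c :: complex
  assumes "CARD('n) \<ge> 3"
    and "u\<^sub>0 \<in> L2" and "v\<^sub>0 \<in> L2"
    and "is_fourier_L2 u\<^sub>0 G" and "G \<in> gaussians"
    and "c \<noteq> 0" and "AE x in lborel. v\<^sub>0 x = c * u\<^sub>0 x"
  shows "\<not> is_critical_point bilinear_functional u\<^sub>0 v\<^sub>0"
proof -
  obtain a b c0 where a: "Re a < 0" and G: "G = gaussian a b c0"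
    using assms(5) by (auto simp: gaussians_def gaussian_def[abs_def])
  show ?thesis
    using not_critical_centered not_critical_off_center assms a unfolding G by (cases "gaussian_center a b = 0") blast+
qed

end
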